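(* Let $\Omega\subset\mathbb R^d$ be a domain. Assume that (a) $1\le p_0<p_1<\infty$, $p_0<u_0<\infty$, $p_1<u_1<\infty$; (b) $1\le q_0,q_1\le\infty$; (c) $p_0u_1=p_1u_0$. If $0<s_0<d/u_0$ and if $$s_1:=s_0-d\Big(\frac1{u_0}-\frac1{u_1}\Big)>0,$$ then with $0<\Theta<1$, $\frac1p:=\frac{1-\Theta}{p_0}+\frac{\Theta}{p_1}$, $\frac1u:=\frac{1-\Theta}{u_0}+\frac{\Theta}{u_1}$, $\frac1q:=\frac{1-\Theta}{q_0}+\frac{\Theta}{q_1}$ and $s:=(1-\Theta)s_0+\Theta s_1$ it holds $$[\mathcal E^{s_0}_{u_0,p_0,q_0}(\Omega),\mathcal E^{s_1}_{u_1,p_1,q_1}(\Omega)]_\Theta\not\subset\overset{\diamond}{\mathcal E}{}^{s}_{u,p,q}(\Omega).$$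
   Context: For $1\le p\le u<\infty$ the Morrey space $\mathcal M^u_p(\mathbb R^d)$ is the set of locally integrable $f$ with $\|f|\mathcal M^u_p(\mathbb R^d)\|:=\sup_B |B|^{\frac1u-\frac1p}\big[\int_B|f(x)|^p\,dx\big]^{1/p}<\infty$, the supremum over all balls $B\subset\mathbb R^d$. Let $\varphi_0\in C_0^\infty(\mathbb R^d)$ be non-negative with $\varphi_0(x)=1$ for $|x|\le1$ and $\varphi_0(x)=0$ for $|x|\ge 3/2$; for $k\in\mathbb N$ put $\varphi_k(x)=\varphi_0(2^{-k}x)-\varphi_0(2^{-k+1}x)$. For $1\le p\le u<\infty$, $1\le q\le\infty$, $s\in\mathbb R$, the Lizorkin-Triebel-Morrey space $\mathcal E^s_{u,p,q}(\mathbb R^d)$ is the set of all $f\in\mathcal S'(\mathbb R^d)$ with $$\|f|\mathcal E^s_{u,p,q}(\mathbb R^d)\|:=\Big\|\Big(\sum_{k=0}^\infty 2^{ksq}|\mathcal F^{-1}[\varphi_k\mathcal Ff](\cdot)|^q\Big)^{1/q}\Big|\mathcal M^u_p(\mathbb R^d)\Big\|<\infty$$ (usual modification for $q=\infty$); different $\varphi_0$ give equivalent norms. Spaces on an open set $\Omega$ are defined by restriction: if $X(\mathbb R^d)\hookrightarrow\mathcal S'(\mathbb R^d)$ is a normed space, $X(\Omega)$ is the set of $f\in\mathcal D'(\Omega)$ for which there is $g\in X(\mathbb R^d)$ with $g_{|\Omega}=f$, normed by $\inf\{\|g|X(\mathbb R^d)\|:g_{|\Omega}=f\}$. For a Banach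 space $X$ of functions or distributions, $\overset{\diamond}{X}$ denotes the closure in $X$ of the set of all infinitely often differentiable functions $f$ with $D^\alpha f\in X$ for all $\alpha\in\mathbb N_0^d$. $\overset{\diamond}{\mathcal E}{}^{s}_{u,p,q}(\Omega)$ is this space for $X=\mathcal E^s_{u,p,q}(\Omega)$. A domain is a nonempty open connected set. $[X_0,X_1]_\Theta$ is Calderón's first complex interpolation space. *)

theory Defs
  imports "HOL-Analysis.Analysis"
begin

section \<open>Smooth functions, test functions and distributions\<close>

definition partial :: "'n::finite \<Rightarrow> (real^'n \<Rightarrow> complex) \<Rightarrow> real^'n \<Rightarrow> complex" where
  "partial i f = (\<lambda>x. frechet_derivative f (at x) (axis i 1))"

text \<open>The mixed derivative along a list of coordinate directions.  On smooth functions the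
  order of the list is irrelevant, so these are exactly the \<open>D\<^sup>\<alpha> f\<close> with \<open>\<bar>\<alpha>\<bar> = length js\<close>.\<close>

definition partials :: "'n::finite list \<Rightarrow> (real^'n \<Rightarrow> complex) \<Rightarrow> real^'n \<Rightarrow> complex" where
  "partials js f = foldr partial js f"

text \<open>Intended for open \<open>S\<close>; the values of \<open>f\<close> outside \<open>S\<close> do not matter.\<close>

definition smooth_on :: "(real^'n::finite) set \<Rightarrow> (real^'n \<Rightarrow> complex) \<Rightarrow> bool" where
  "smooth_on S f \<longleftrightarrow> (\<forall>js. \<forall>x\<in>S. partials js f differentiable (at x))"

definition test_functions :: "(real^'n::finite) set \<Rightarrow> (real^'n \<Rightarrow> complex) set" where
  "test_functions \<Omega> =
     {\<phi>. smooth_on UNIV \<phi> \<and> (\<exists>K. compact K \<and> K \<subseteq> \<Omega> \<and> (\<forall>x. x \<notin> K \<longrightarrow> \<phi> x = 0))}"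

definition schwartz :: "(real^'n::finite \<Rightarrow> complex) set" where
  "schwartz = {\<phi>. smooth_on UNIV \<phi> \<and>
     (\<forall>N js. bounded (range (\<lambda>x. (1 + norm x) ^ N *\<^sub>R partials js \<phi> x)))}"

text \<open>\<open>seminorm m N \<phi>\<close> is the supremum of \<open>(1 + \<bar>x\<bar>)\<^sup>m \<bar>D\<^sup>\<alpha> \<phi>(x)\<bar>\<close> over all \<open>x\<close> and all
  \<open>\<bar>\<alpha>\<bar> \<le> N\<close>; it is only used where this supremum is finite.\<close>

definition seminorm :: "nat \<Rightarrow> nat \<Rightarrow> (real^'n::finite \<Rightarrow> complex) \<Rightarrow> real" where
  "seminorm m N \<phi> =
     (SUP (x, js) \<in> UNIV \<times> {js. length js \<le> N}. (1 + norm x) ^ m * cmod (partials js \<phi> x))"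

definition linear_functional_on ::
  "('a \<Rightarrow> complex) set \<Rightarrow> (('a \<Rightarrow> complex) \<Rightarrow> complex) \<Rightarrow> bool" where
  "linear_functional_on D T \<longleftrightarrow>
     (\<forall>\<phi>\<in>D. \<forall>\<psi>\<in>D. \<forall>a b. T (\<lambda>x. a * \<phi> x + b * \<psi> x) = a * T \<phi> + b * T \<psi>)"

text \<open>Functionals are total functions on \<open>real^'n \<Rightarrow> complex\<close>.  They are required to vanish off
  the respective space of test functions, so that equality of distributions is equality in HOL.\<close>

definition distributions :: "(real^'n::finite) set \<Rightarrow> ((real^'n \<Rightarrow> complex) \<Rightarrow> complex) set" where
  "distributions \<Omega> = {T. linear_functional_on (test_functions \<Omega>) T \<and>
     (\<forall>\<phi>. \<phi> \<notin> test_functions \<Omega> \<longrightarrow> T \<phi> = 0) \<and>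
     (\<forall>K. compact K \<and> K \<subseteq> \<Omega> \<longrightarrow> (\<exists>C N. \<forall>\<phi>\<in>test_functions \<Omega>.
        (\<forall>x. x \<notin> K \<longrightarrow> \<phi> x = 0) \<longrightarrow> cmod (T \<phi>) \<le> C * seminorm 0 N \<phi>))}"

definition tempered_distributions :: "((real^'n::finite \<Rightarrow> complex) \<Rightarrow> complex) set" where
  "tempered_distributions = {T. linear_functional_on schwartz T \<and>
     (\<forall>\<phi>. \<phi> \<notin> schwartz \<longrightarrow> T \<phi> = 0) \<and>
     (\<exists>C N. \<forall>\<phi>\<in>schwartz. cmod (T \<phi>) \<le> C * seminorm N N \<phi>)}"

definition restrict_distribution ::
  "(real^'n::finite) set \<Rightarrow> ((real^'n \<Rightarrow> complex) \<Rightarrow> complex) \<Rightarrow> (real^'n \<Rightarrow> complex) \<Rightarrow> complex" where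
  "restrict_distribution \<Omega> g = (\<lambda>\<phi>. if \<phi> \<in> test_functions \<Omega> then g \<phi> else 0)"

definition regular_distribution ::
  "(real^'n::finite) set \<Rightarrow> (real^'n \<Rightarrow> complex) \<Rightarrow> (real^'n \<Rightarrow> complex) \<Rightarrow> complex" where
  "regular_distribution \<Omega> f =
     (\<lambda>\<phi>. if \<phi> \<in> test_functions \<Omega> then (LINT x:\<Omega>|lborel. f x * \<phi> x) else 0)"

section \<open>Fourier transform\<close>

definition fourier :: "(real^'n::finite \<Rightarrow> complex) \<Rightarrow> real^'n \<Rightarrow> complex" where
  "fourier \<phi> = (\<lambda>\<xi>. of_real ((2 * pi) powr (- real CARD('n) / 2)) *
     (LINT x|lborel. exp (- (\<i> * of_real (x \<bullet> \<xi>))) * \<phi> x))"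

definition inverse_fourier :: "(real^'n::finite \<Rightarrow> complex) \<Rightarrow> real^'n \<Rightarrow> complex" where
  "inverse_fourier \<phi> = (\<lambda>x. of_real ((2 * pi) powr (- real CARD('n) / 2)) *
     (LINT \<xi>|lborel. exp (\<i> * of_real (x \<bullet> \<xi>)) * \<phi> \<xi>))"

definition fourier_distribution ::
  "((real^'n::finite \<Rightarrow> complex) \<Rightarrow> complex) \<Rightarrow> (real^'n \<Rightarrow> complex) \<Rightarrow> complex" where
  "fourier_distribution T = (\<lambda>\<psi>. if \<psi> \<in> schwartz then T (fourier \<psi>) else 0)"

definition inverse_fourier_distribution ::
  "((real^'n::finite \<Rightarrow> complex) \<Rightarrow> complex) \<Rightarrow> (real^'n \<Rightarrow> complex) \<Rightarrow> complex" where
  "inverse_fourier_distribution T = (\<lambda>\<psi>. if \<psi> \<in> schwartz then T (inverse_fourier \<psi>) else 0)"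

definition mult_distribution ::
  "(real^'n::finite \<Rightarrow> real) \<Rightarrow> ((real^'n \<Rightarrow> complex) \<Rightarrow> complex) \<Rightarrow> (real^'n \<Rightarrow> complex) \<Rightarrow> complex" where
  "mult_distribution \<eta> T =
     (\<lambda>\<psi>. if \<psi> \<in> schwartz then T (\<lambda>x. of_real (\<eta> x) * \<psi> x) else 0)"

text \<open>The continuous function representing a tempered distribution, when there is one
  (it is then unique).\<close>

definition representing_function ::
  "((real^'n::finite \<Rightarrow> complex) \<Rightarrow> complex) \<Rightarrow> real^'n \<Rightarrow> complex" where
  "representing_function T = (THE h. continuous_on UNIV h \<and>
     (\<forall>\<psi>\<in>schwartz. integrable lborel (\<lambda>x. h x * \<psi> x) \<and> T \<psi> = (LINT x|lborel. h x * \<psi> x)))"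

section \<open>Lizorkin-Triebel-Morrey spaces\<close>

text \<open>A normed space \<open>X\<close> inside an ambient vector space is given by its norm, extended by the
  value \<open>\<infinity>\<close> outside \<open>X\<close>.\<close>

definition finite_part :: "('v \<Rightarrow> ennreal) \<Rightarrow> 'v set" where
  "finite_part N = {x. N x < \<infinity>}"

text \<open>Powers with a positive exponent.\<close>

definition ennreal_powr :: "ennreal \<Rightarrow> real \<Rightarrow> ennreal" where
  "ennreal_powr x a = (if x = \<infinity> then \<infinity> else ennreal (enn2real x powr a))"

text \<open>The Morrey norm as a function of \<open>\<bar>f\<bar>\<close>, which is allowed to take the value \<open>\<infinity>\<close>.\<close>

definition morrey_norm :: "real \<Rightarrow> real \<Rightarrow> (real^'n::finite \<Rightarrow> ennreal) \<Rightarrow> ennreal" where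
  "morrey_norm u p g = (SUP (x, r) \<in> UNIV \<times> {0<..}.
     ennreal (measure lborel (ball x r) powr (1 / u - 1 / p)) *
     ennreal_powr (\<integral>\<^sup>+ y \<in> ball x r. ennreal_powr (g y) p \<partial>lborel) (1 / p))"

definition lq_norm :: "ennreal \<Rightarrow> (nat \<Rightarrow> real) \<Rightarrow> ennreal" where
  "lq_norm q a = (if q = \<infinity> then (SUP k. ennreal \<bar>a k\<bar>)
     else ennreal_powr (\<Sum>k. ennreal (\<bar>a k\<bar> powr enn2real q)) (1 / enn2real q))"

definition resolution_generator :: "(real^'n::finite \<Rightarrow> real) \<Rightarrow> bool" where
  "resolution_generator \<phi>0 \<longleftrightarrow> smooth_on UNIV (\<lambda>x. of_real (\<phi>0 x)) \<and> (\<forall>x. 0 \<le> \<phi>0 x) \<and>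
     (\<forall>x. norm x \<le> 1 \<longrightarrow> \<phi>0 x = 1) \<and> (\<forall>x. norm x \<ge> 3 / 2 \<longrightarrow> \<phi>0 x = 0)"

definition resolution :: "(real^'n::finite \<Rightarrow> real) \<Rightarrow> nat \<Rightarrow> real^'n \<Rightarrow> real" where
  "resolution \<phi>0 k x = (if k = 0 then \<phi>0 x
     else \<phi>0 ((2 powi (- int k)) *\<^sub>R x) - \<phi>0 ((2 powi (- int k + 1)) *\<^sub>R x))"

text \<open>By the Paley-Wiener-Schwartz theorem the distribution \<open>\<F>\<^sup>-\<^sup>1[\<phi>\<^sub>k \<F> f]\<close> is given by a smooth
  function of polynomial growth, hence has a representing function.\<close>

definition frequency_piece ::
  "(real^'n::finite \<Rightarrow> real) \<Rightarrow> nat \<Rightarrow> ((real^'n \<Rightarrow> complex) \<Rightarrow> complex) \<Rightarrow> real^'n \<Rightarrow> complex" where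
  "frequency_piece \<phi>0 k f = representing_function
     (inverse_fourier_distribution (mult_distribution (resolution \<phi>0 k) (fourier_distribution f)))"

definition LTM_norm :: "(real^'n::finite \<Rightarrow> real) \<Rightarrow> real \<Rightarrow> real \<Rightarrow> real \<Rightarrow> ennreal \<Rightarrow>
    ((real^'n \<Rightarrow> complex) \<Rightarrow> complex) \<Rightarrow> ennreal" where
  "LTM_norm \<phi>0 s u p q f = (if f \<in> tempered_distributions
     then morrey_norm u p
       (\<lambda>x. lq_norm q (\<lambda>k. 2 powr (real k * s) * cmod (frequency_piece \<phi>0 k f x)))
     else \<infinity>)"

text \<open>The infimum over the empty set is \<open>\<infinity>\<close>.\<close>

definition restriction_norm ::
  "(((real^'n::finite \<Rightarrow> complex) \<Rightarrow> complex) \<Rightarrow> ennreal) \<Rightarrow> (real^'n) set \<Rightarrow>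
    ((real^'n \<Rightarrow> complex) \<Rightarrow> complex) \<Rightarrow> ennreal" where
  "restriction_norm N \<Omega> f = (if f \<in> distributions \<Omega>
     then (INF g \<in> {g \<in> finite_part N. restrict_distribution \<Omega> g = f}. N g) else \<infinity>)"

definition LTM_norm_on :: "(real^'n::finite) set \<Rightarrow> (real^'n \<Rightarrow> real) \<Rightarrow> real \<Rightarrow> real \<Rightarrow> real \<Rightarrow>
    ennreal \<Rightarrow> ((real^'n \<Rightarrow> complex) \<Rightarrow> complex) \<Rightarrow> ennreal" where
  "LTM_norm_on \<Omega> \<phi>0 s u p q = restriction_norm (LTM_norm \<phi>0 s u p q) \<Omega>"

text \<open>Smooth functions on \<open>\<Omega>\<close> are identified with the regular distributions they define.\<close>

definition diamond ::
  "(real^'n::finite) set \<Rightarrow> (((real^'n \<Rightarrow> complex) \<Rightarrow> complex) \<Rightarrow> ennreal) \<Rightarrow>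
    ((real^'n \<Rightarrow> complex) \<Rightarrow> complex) set" where
  "diamond \<Omega> N = {T \<in> finite_part N. \<forall>\<epsilon>>0. \<exists>f. smooth_on \<Omega> f \<and>
     (\<forall>js. regular_distribution \<Omega> (partials js f) \<in> finite_part N) \<and>
     N (\<lambda>\<phi>. T \<phi> - regular_distribution \<Omega> f \<phi>) < \<epsilon>}"

section \<open>Calderon's first complex interpolation method\<close>

definition sum_norm ::
  "(('b \<Rightarrow> complex) \<Rightarrow> ennreal) \<Rightarrow> (('b \<Rightarrow> complex) \<Rightarrow> ennreal) \<Rightarrow> ('b \<Rightarrow> complex) \<Rightarrow> ennreal" where
  "sum_norm N0 N1 x =
     (INF (x0, x1) \<in> {(x0, x1). x = (\<lambda>b. x0 b + x1 b)}. N0 x0 + N1 x1)"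

definition norm_continuous_on ::
  "'t::topological_space set \<Rightarrow> (('b \<Rightarrow> complex) \<Rightarrow> ennreal) \<Rightarrow> ('t \<Rightarrow> 'b \<Rightarrow> complex) \<Rightarrow> bool" where
  "norm_continuous_on S N F \<longleftrightarrow> (\<forall>t\<in>S. F t \<in> finite_part N \<and>
     ((\<lambda>r. N (\<lambda>b. F r b - F t b)) \<longlongrightarrow> 0) (at t within S))"

definition norm_holomorphic_on ::
  "complex set \<Rightarrow> (('b \<Rightarrow> complex) \<Rightarrow> ennreal) \<Rightarrow> (complex \<Rightarrow> 'b \<Rightarrow> complex) \<Rightarrow> bool" where
  "norm_holomorphic_on S N F \<longleftrightarrow> (\<forall>z\<in>S. \<exists>D\<in>finite_part N.
     ((\<lambda>w. N (\<lambda>b. (F w b - F z b) / (w - z) - D b)) \<longlongrightarrow> 0) (at z within S))"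

definition calderon_functions ::
  "(('b \<Rightarrow> complex) \<Rightarrow> ennreal) \<Rightarrow> (('b \<Rightarrow> complex) \<Rightarrow> ennreal) \<Rightarrow> (complex \<Rightarrow> 'b \<Rightarrow> complex) set" where
  "calderon_functions N0 N1 = {F.
     norm_continuous_on {z. 0 \<le> Re z \<and> Re z \<le> 1} (sum_norm N0 N1) F \<and>
     (\<exists>C. \<forall>z. 0 \<le> Re z \<and> Re z \<le> 1 \<longrightarrow> sum_norm N0 N1 (F z) \<le> ennreal C) \<and>
     norm_holomorphic_on {z. 0 < Re z \<and> Re z < 1} (sum_norm N0 N1) F \<and>
     norm_continuous_on UNIV N0 (\<lambda>t::real. F (Complex 0 t)) \<and>
     norm_continuous_on UNIV N1 (\<lambda>t::real. F (Complex 1 t)) \<and>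
     ((\<lambda>t::real. N0 (F (Complex 0 t))) \<longlongrightarrow> 0) at_infinity \<and>
     ((\<lambda>t::real. N1 (F (Complex 1 t))) \<longlongrightarrow> 0) at_infinity}"

definition complex_interpolation ::
  "(('b \<Rightarrow> complex) \<Rightarrow> ennreal) \<Rightarrow> (('b \<Rightarrow> complex) \<Rightarrow> ennreal) \<Rightarrow> real \<Rightarrow> ('b \<Rightarrow> complex) set" where
  "complex_interpolation N0 N1 \<Theta> = (\<lambda>F. F (of_real \<Theta>)) ` calderon_functions N0 N1"

end

theory Submission
  imports Defs "HOL-Probability.Probability"
begin

text \<open>Put \<open>\<delta> = d / u0 - s0\<close>.  The hypotheses say that \<open>s0 - d / u0 = s1 - d / u1 = s - d / u = - \<delta>\<close>
  and \<open>p0 / u0 = p1 / u1 = p / u < 1\<close>, so a function with a singularity \<open>\<bar>x - x0\<bar> powr (- \<delta>)\<close> at a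
  point \<open>x0 \<in> \<Omega>\<close> lies in both endpoint spaces, hence (as \<open>F z = exp (z\<^sup>2 - \<Theta>\<^sup>2) g\<close> shows) in the
  interpolation space.  For the singularity we take a lacunary series \<open>g\<close>, whose Littlewood-Paley
  pieces are the single terms \<open>2 powr (k \<delta>) \<psi> (2 ^ k (x - x0))\<close>: their sum with the weights
  \<open>2 powr (k s)\<close> is of size \<open>\<bar>x - x0\<bar> powr (- d / u)\<close>, which belongs to the Morrey space because \<open>p < u\<close>.

  If \<open>f\<close> is smooth on \<open>\<Omega>\<close> and \<open>h\<close> is an extension of \<open>g - f\<close> of norm \<open>\<epsilon>\<close>, test with functions \<open>\<Psi>\<^sub>j\<close>
  concentrated at \<open>x0\<close> on the scale \<open>2 ^ (- j)\<close> whose Fourier transform sits where the \<open>j\<close>-th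
  resolution function is 1.  Then \<open>g \<Psi>\<^sub>j = \<kappa> 2 powr (j \<delta>)\<close>, the pairing with \<open>f\<close> stays bounded,
  and \<open>h \<Psi>\<^sub>j = O(\<epsilon> 2 powr (j \<delta>))\<close> since it only sees the \<open>j\<close>-th piece of \<open>h\<close>; cutting \<open>\<Psi>\<^sub>j\<close> off to
  \<open>\<Omega>\<close> costs \<open>o(1)\<close>.  As \<open>\<delta> > 0\<close>, this bounds \<open>\<epsilon>\<close> from below.\<close>

section \<open>Schwartz functions\<close>

text \<open>The extension \<open>h\<close> is an arbitrary tempered distribution of which only the
  norm is known, and that norm speaks of functions given by a definite description. This shapes the
  first half: Fourier inversion on \<open>schwartz\<close> and the identity between \<open>h\<close>
  and its frequency pieces must be available before any estimate of \<open>h\<close> can start. A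
  lacunary series takes the place of the pure power because its pieces are explicit for every
  admissible \<open>\<phi>0\<close>: on the shell between radii \<open>3/4 * 2 ^ j\<close> and
  \<open>2 ^ j\<close> the \<open>j\<close>-th resolution function is 1, whatever
  \<open>\<phi>0\<close> does between radii 1 and 3/2. The upper bound \<open>\<delta> < d\<close>,
  from \<open>s0 > 0\<close> and \<open>u0 > p0 >= 1\<close>, makes the series converge absolutely
  on bounded test functions. The growth of the series and the growth allowed to \<open>h\<close>
  have the same rate, since \<open>d / u - s = \<delta>\<close>; hence the outcome is decided by
  constants. The norm estimates are proved for all multiples \<open>c\<close> of the series at once,
  which stands in for homogeneity of the norms.\<close>

lemma partial_eqI:
  assumes "(f has_derivative D) (at x)"
  shows "partial i f x = D (axis i 1)"
  using frechet_derivative_at[OF assms] by (simp add: partial_def)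

text \<open>Expanding the direction in the standard basis expresses every derivative through
  \<open>partial\<close>, so rules for \<open>has_derivative\<close> can be read off
  coefficientwise.\<close>

lemma has_derivative_partials:
  assumes "f differentiable (at x)"
  shows "(f has_derivative (\<lambda>v. \<Sum>i\<in>UNIV. (v $ i) *\<^sub>R partial i f x)) (at x)"
proof -
  define D where "D = frechet_derivative f (at x)"
  have D: "(f has_derivative D) (at x)"
    using assms by (simp add: D_def frechet_derivative_works)
  interpret D: bounded_linear D using D by (rule has_derivative_bounded_linear)
  have "D v = (\<Sum>i\<in>UNIV. (v $ i) *\<^sub>R partial i f x)" for v
  proof -
    have "v = (\<Sum>i\<in>UNIV. (v $ i) *\<^sub>R axis i 1)"
      using basis_expansion[of v] by (simp add: scalar_mult_eq_scaleR)
    then have "D v = D (\<Sum>i\<in>UNIV. (v $ i) *\<^sub>R axis i 1)" by simp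
    also have "\<dots> = (\<Sum>i\<in>UNIV. (v $ i) *\<^sub>R partial i f x)"
      by (simp add: D.sum D.scaleR partial_eqI[OF D])
    finally show ?thesis .
  qed
  then show ?thesis using D by presburger
qed

lemma sum_axis_scaleR: "(\<Sum>j\<in>UNIV. (axis i 1 $ j) *\<^sub>R (F j :: complex)) = F i"
  and sum_axis_scaleR': "(\<Sum>j\<in>UNIV. (a * axis i 1 $ j) *\<^sub>R (F j :: complex)) = a *\<^sub>R F i"
  by (simp_all add: axis_def if_distrib[of "\<lambda>c. _ * c"] if_distrib[of "\<lambda>c. c *\<^sub>R _"] flip: scaleR_conv_of_real cong: if_cong)

lemma partials_Nil [simp]: "partials [] f = f"
  and partials_Cons [simp]: "partials (i # js) f = partial i (partials js f)"
  by (simp_all add: partials_def)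

lemma partials_append: "partials (js @ ks) f = partials js (partials ks f)"
  by (simp add: partials_def)

lemma partials_in:
  assumes "f \<in> A" and "\<And>f i. f \<in> A \<Longrightarrow> partial i f \<in> A"
  shows "partials js f \<in> A"
  using assms by (induction js) auto

text \<open>Membership asks about all iterated partials. In a class closed under
  \<open>partial\<close> the iterates stay inside, so it is enough to check differentiability and
  decay of the members themselves; the proofs below only have to find a suitable class.\<close>

lemma schwartz_coinduct:
  assumes "f \<in> A"
    and "\<And>f x. f \<in> A \<Longrightarrow> f differentiable (at x)"
    and "\<And>f i. f \<in> A \<Longrightarrow> partial i f \<in> A"
    and "\<And>f N. f \<in> A \<Longrightarrow> \<exists>C. \<forall>x. (1 + norm x) ^ N * cmod (f x) \<le> C"
  shows "f \<in> schwartz"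
proof -
  have in_A: "partials js f \<in> A" for js by (intro partials_in assms)
  have "bounded (range (\<lambda>x. (1 + norm x) ^ N *\<^sub>R partials js f x))" for N js
  proof -
    obtain C where "\<forall>x. (1 + norm x) ^ N * cmod (partials js f x) \<le> C"
      using assms(4)[OF in_A] by blast
    then show ?thesis unfolding bounded_iff by (intro exI[of _ C]) auto
  qed
  then show ?thesis using assms(2)[OF in_A] by (auto simp: schwartz_def smooth_on_def)
qed

lemma schwartz_differentiable: "f \<in> schwartz \<Longrightarrow> f differentiable (at x)"
  unfolding schwartz_def smooth_on_def by (auto dest: spec[of _ "[]"])

lemma schwartz_partials:
  assumes "f \<in> schwartz"
  shows "partials ks f \<in> schwartz"
  using assms unfolding schwartz_def smooth_on_def
  by (simp flip: partials_append)

lemma schwartz_partial: "f \<in> schwartz \<Longrightarrow> partial i f \<in> schwartz"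
  using schwartz_partials[of f "[i]"] by simp

lemma schwartz_decay:
  assumes "f \<in> schwartz"
  obtains C where "C > 0" "\<And>x. (1 + norm x) ^ N * cmod (f x) \<le> C"
proof -
  have "bounded (range (\<lambda>x. (1 + norm x) ^ N *\<^sub>R f x))"
    using assms by (auto simp: schwartz_def dest!: spec[of _ N] spec[of _ "[]"])
  then obtain C where "C > 0" "\<And>x. norm ((1 + norm x) ^ N *\<^sub>R f x) \<le> C"
    unfolding bounded_pos by auto
  then show thesis by (intro that[of C]) auto
qed

lemma schwartz_continuous: "f \<in> schwartz \<Longrightarrow> continuous_on UNIV f"
  by (simp add: schwartz_differentiable differentiable_imp_continuous_within
      continuous_at_imp_continuous_on)

lemma schwartz_borel [measurable_dest]: "f \<in> schwartz \<Longrightarrow> f \<in> borel_measurable borel"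
  by (intro borel_measurable_continuous_onI schwartz_continuous)

text \<open>Schwartz's multiplier space, usually written O_M: the power that bounds a derivative may
  depend on the derivative. It is needed for coordinates, characters and complements of
  cut-offs.\<close>

definition slowly_increasing :: "(real^'n::finite \<Rightarrow> complex) set" where
  "slowly_increasing = {f. smooth_on UNIV f \<and>
     (\<forall>js. \<exists>C N. \<forall>x. cmod (partials js f x) \<le> C * (1 + norm x) ^ N)}"

lemma slowly_increasing_coinduct:
  assumes "f \<in> A"
    and "\<And>f x. f \<in> A \<Longrightarrow> f differentiable (at x)"
    and "\<And>f i. f \<in> A \<Longrightarrow> partial i f \<in> A"
    and "\<And>f. f \<in> A \<Longrightarrow> \<exists>C N. \<forall>x. cmod (f x) \<le> C * (1 + norm x) ^ N"
  shows "f \<in> slowly_increasing"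
proof -
  have "partials js f \<in> A" for js by (intro partials_in assms)
  then show ?thesis using assms(2,4) by (auto simp: slowly_increasing_def smooth_on_def)
qed

lemma slowly_increasing_differentiable: "f \<in> slowly_increasing \<Longrightarrow> f differentiable (at x)"
  unfolding slowly_increasing_def smooth_on_def by (auto dest: spec[of _ "[]"])

lemma slowly_increasing_partial:
  assumes "f \<in> slowly_increasing"
  shows "partial i f \<in> slowly_increasing"
proof -
  have "partials js (partial i f) = partials (js @ [i]) f" for js by (simp add: partials_append)
  then show ?thesis using assms unfolding slowly_increasing_def smooth_on_def by auto
qed

lemma slowly_increasing_bound:
  assumes "f \<in> slowly_increasing"
  obtains C N where "C > 0" "\<And>x. cmod (f x) \<le> C * (1 + norm x) ^ N"
proof -
  have "\<exists>C N. \<forall>x. cmod (partials [] f x) \<le> C * (1 + norm x) ^ N"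
    using assms unfolding slowly_increasing_def by blast
  then obtain C N where C: "\<And>x. cmod (f x) \<le> C * (1 + norm x) ^ N" by auto
  show thesis
  proof (rule that[of "max C 1" N])
    show "cmod (f x) \<le> max C 1 * (1 + norm x) ^ N" for x
      using C[of x] by (smt (verit) mult_right_mono norm_ge_zero zero_le_power)
  qed simp
qed

lemma schwartz_slowly_increasing: "f \<in> schwartz \<Longrightarrow> f \<in> slowly_increasing"
proof (rule slowly_increasing_coinduct[of f schwartz])
  fix f :: "real^'n \<Rightarrow> complex" assume "f \<in> schwartz"
  from schwartz_decay[OF this, of 0] obtain C where "\<And>x. cmod (f x) \<le> C" by auto
  then show "\<exists>C N. \<forall>x. cmod (f x) \<le> C * (1 + norm x) ^ N"
    by (intro exI[of _ C] exI[of _ 0]) auto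
qed (auto intro: schwartz_differentiable schwartz_partial)

section \<open>Product and chain rules, and closure properties of the Schwartz space\<close>

lemma partial_add:
  assumes "f differentiable (at x)" "g differentiable (at x)"
  shows "partial i (\<lambda>x. f x + g x) x = partial i f x + partial i g x"
  using partial_eqI[OF has_derivative_add[OF has_derivative_partials[OF assms(1)] has_derivative_partials[OF assms(2)]]]
  by (simp only: sum_axis_scaleR)

lemma partial_mult:
  assumes "f differentiable (at x)" "g differentiable (at x)"
  shows "partial i (\<lambda>x. f x * g x) x = partial i f x * g x + f x * partial i g x"
  using partial_eqI[OF has_derivative_mult[OF has_derivative_partials[OF assms(1)] has_derivative_partials[OF assms(2)]]]
  by (simp only: sum_axis_scaleR) (simp add: add.commute)

lemma has_derivative_affine_comp:
  fixes f :: "real^'n \<Rightarrow> complex"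
  assumes "f differentiable (at (a *\<^sub>R x + b))"
  shows "((\<lambda>x. f (a *\<^sub>R x + b)) has_derivative
           (\<lambda>v. \<Sum>i\<in>UNIV. (a * v $ i) *\<^sub>R partial i f (a *\<^sub>R x + b))) (at x)"
proof -
  have "((\<lambda>x. a *\<^sub>R x + b) has_derivative (\<lambda>v. a *\<^sub>R v)) (at x)"
    by (auto intro!: derivative_eq_intros)
  from has_derivative_compose[OF this has_derivative_partials[OF assms]]
  show ?thesis by simp
qed

lemma partial_affine_comp:
  fixes f :: "real^'n \<Rightarrow> complex"
  assumes "f differentiable (at (a *\<^sub>R x + b))"
  shows "partial i (\<lambda>x. f (a *\<^sub>R x + b)) x = of_real a * partial i f (a *\<^sub>R x + b)"
  using partial_eqI[OF has_derivative_affine_comp[OF assms], of i]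
  unfolding sum_axis_scaleR' by (simp add: scaleR_conv_of_real)

text \<open>Each derivative of the composition brings out a factor \<open>a\<close>, so the class to
  use contains scalar multiples.\<close>

lemma schwartz_affine_comp:
  fixes f :: "real^'n::finite \<Rightarrow> complex"
  assumes "f \<in> schwartz" "a \<noteq> 0"
  shows "(\<lambda>x. f (a *\<^sub>R x + b)) \<in> schwartz"
proof (rule schwartz_coinduct)
  let ?A = "{\<lambda>x. c * f (a *\<^sub>R x + b) |c f. f \<in> schwartz}"
  show "(\<lambda>x. f (a *\<^sub>R x + b)) \<in> ?A" using assms(1) by (auto intro!: exI[of _ "1::complex"] exI[of _ f])
  have diff: "(\<lambda>x. c * f (a *\<^sub>R x + b)) differentiable (at x)" if "f \<in> schwartz"
    for c x and f :: "real^'n \<Rightarrow> complex"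
    using has_derivative_affine_comp[OF schwartz_differentiable[OF that], where a=a and x=x and b=b]
    by (intro differentiable_mult) (auto intro: differentiableI)
  then show "g differentiable (at x)" if "g \<in> ?A" for g x using that by blast
  show "partial i g \<in> ?A" if g: "g \<in> ?A" for g i
  proof -
    obtain c h where gh: "g = (\<lambda>x. c * h (a *\<^sub>R x + b))" "h \<in> schwartz" using g by blast
    have "partial i g = (\<lambda>x. (c * of_real a) * partial i h (a *\<^sub>R x + b))"
    proof
      fix x
      have "(\<lambda>x. h (a *\<^sub>R x + b)) differentiable (at x)" using diff[OF gh(2), of 1 x] by simp
      then have "partial i g x = c * partial i (\<lambda>x. h (a *\<^sub>R x + b)) x"
        unfolding gh(1) by (subst partial_mult) (auto simp: partial_eqI[OF has_derivative_const])
      then show "partial i g x = (c * of_real a) * partial i h (a *\<^sub>R x + b)"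
        using partial_affine_comp[OF schwartz_differentiable[OF gh(2)], where i=i and a=a and x=x and b=b] by simp
    qed
    then show ?thesis using schwartz_partial[OF gh(2), of i] by blast
  qed
  show "\<exists>C. \<forall>x. (1 + norm x) ^ N * cmod (g x) \<le> C" if g: "g \<in> ?A" for g N
  proof -
    obtain c h where gh: "g = (\<lambda>x. c * h (a *\<^sub>R x + b))" "h \<in> schwartz" using g by blast
    obtain C where C: "C > 0" "\<And>x. (1 + norm x) ^ N * cmod (h x) \<le> C"
      using schwartz_decay[OF gh(2), of N] by metis
    define K where "K = (1 + (1 + norm b) / \<bar>a\<bar>)"
    have K: "1 + norm x \<le> K * (1 + norm (a *\<^sub>R x + b))" for x
    proof -
      have "\<bar>a\<bar> * norm x = norm ((a *\<^sub>R x + b) - b)" by simp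
      also have "\<dots> \<le> norm (a *\<^sub>R x + b) + norm b" by (rule norm_triangle_ineq4)
      finally have 1: "norm x \<le> (norm (a *\<^sub>R x + b) + norm b) / \<bar>a\<bar>"
        using assms(2) by (simp add: field_simps)
      have "norm (a *\<^sub>R x + b) + norm b \<le> (1 + norm b) * (1 + norm (a *\<^sub>R x + b))"
        by (simp add: algebra_simps)
      then have "(norm (a *\<^sub>R x + b) + norm b) / \<bar>a\<bar> \<le> ((1 + norm b) * (1 + norm (a *\<^sub>R x + b))) / \<bar>a\<bar>"
        by (rule divide_right_mono) simp
      with 1 have "norm x \<le> (1 + norm b) / \<bar>a\<bar> * (1 + norm (a *\<^sub>R x + b))" by simp
      then show ?thesis unfolding K_def distrib_right by (smt (verit) norm_ge_zero)
    qed
    have Kpos: "K > 0" unfolding K_def by (intro add_pos_nonneg) auto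
    have "(1 + norm x) ^ N * cmod (g x) \<le> K ^ N * cmod c * C" for x
    proof -
      have "(1 + norm x) ^ N \<le> (K * (1 + norm (a *\<^sub>R x + b))) ^ N"
        using K by (intro power_mono) auto
      then have "(1 + norm x) ^ N * cmod (g x) \<le> (K * (1 + norm (a *\<^sub>R x + b))) ^ N * cmod (g x)"
        by (rule mult_right_mono) simp
      also have "\<dots> = K ^ N * cmod c * ((1 + norm (a *\<^sub>R x + b)) ^ N * cmod (h (a *\<^sub>R x + b)))"
        by (simp add: gh(1) norm_mult power_mult_distrib)
      also have "\<dots> \<le> K ^ N * cmod c * C" using C(2) Kpos by (intro mult_left_mono) auto
      finally show ?thesis .
    qed
    then show ?thesis by blast
  qed
qed

text \<open>Families indexed by \<open>'k\<close>; finite sums are needed to absorb the Leibniz rule.\<close>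

inductive_set sum_closure :: "('k \<Rightarrow> 'a \<Rightarrow> complex) set \<Rightarrow> ('k \<Rightarrow> 'a \<Rightarrow> complex) set" for B where
  base: "f \<in> B \<Longrightarrow> f \<in> sum_closure B"
| add: "f \<in> sum_closure B \<Longrightarrow> g \<in> sum_closure B \<Longrightarrow> (\<lambda>k x. f k x + g k x) \<in> sum_closure B"

lemma sum_closure_partial:
  fixes B :: "('k \<Rightarrow> real^'n::finite \<Rightarrow> complex) set"
  assumes "f \<in> sum_closure B"
    and diff: "\<And>f k x. f \<in> B \<Longrightarrow> f k differentiable (at x)"
    and part: "\<And>f i. f \<in> B \<Longrightarrow> (\<lambda>k. partial i (f k)) \<in> sum_closure B"
  shows "(\<forall>k x. f k differentiable (at x)) \<and> (\<forall>i. (\<lambda>k. partial i (f k)) \<in> sum_closure B)"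
  using assms(1)
proof induction
  case (base f)
  then show ?case using diff part by blast
next
  case (add f g)
  have "partial i (\<lambda>x. f k x + g k x) = (\<lambda>x. partial i (f k) x + partial i (g k) x)" for i k
    using add.IH by (auto intro!: ext partial_add)
  then show ?case using add.IH by (auto intro: sum_closure.add)
qed

text \<open>With index type \<open>unit\<close> the families are single functions; this is the
  coinduction for classes in which the derivative of a generator is a sum of generators. Genuine
  families, indexed by scales, come in with \<open>concentrating_family\<close>.\<close>

lemma sum_closure_subset_schwartz:
  fixes f :: "real^'n::finite \<Rightarrow> complex" and B :: "(unit \<Rightarrow> real^'n \<Rightarrow> complex) set"
  assumes "(\<lambda>_. f) \<in> sum_closure B"
    and diff: "\<And>f k x. f \<in> B \<Longrightarrow> f k differentiable (at x)"
    and part: "\<And>f i. f \<in> B \<Longrightarrow> (\<lambda>k. partial i (f k)) \<in> sum_closure B"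
    and decay: "\<And>f N. f \<in> B \<Longrightarrow> \<exists>C. \<forall>x. (1 + norm x) ^ N * cmod (f () x) \<le> C"
  shows "f \<in> schwartz"
proof (rule schwartz_coinduct)
  let ?A = "{f. (\<lambda>_. f) \<in> sum_closure B}"
  show "f \<in> ?A" using assms(1) by simp
  have 1: "(\<forall>x. f differentiable (at x)) \<and> (\<forall>i. partial i f \<in> ?A)" if "f \<in> ?A" for f
    using sum_closure_partial[of "\<lambda>_. f" B] that diff part by simp
  show "f differentiable (at x)" if "f \<in> ?A" for f x using 1[OF that] by blast
  show "partial i f \<in> ?A" if "f \<in> ?A" for f i using 1[OF that] by blast
  show "\<exists>C. \<forall>x. (1 + norm x) ^ N * cmod (f x) \<le> C" if "f \<in> ?A" for f N
  proof -
    have "\<exists>C. \<forall>x. (1 + norm x) ^ N * cmod (f () x) \<le> C" if "f \<in> sum_closure B" for f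
      using that
    proof induction
      case (base f)
      then show ?case by (rule decay)
    next
      case (add f g)
      then obtain C D where C: "\<And>x. (1 + norm x) ^ N * cmod (f () x) \<le> C"
        and D: "\<And>x. (1 + norm x) ^ N * cmod (g () x) \<le> D" by blast
      have "(1 + norm x) ^ N * cmod (f () x + g () x) \<le> C + D" for x
      proof -
        have "(1 + norm x) ^ N * cmod (f () x + g () x) \<le> (1 + norm x) ^ N * (cmod (f () x) + cmod (g () x))"
          by (intro mult_left_mono norm_triangle_ineq) auto
        also have "\<dots> \<le> C + D" unfolding distrib_left by (intro add_mono C D)
        finally show ?thesis .
      qed
      then show ?case by blast
    qed
    from this[of "\<lambda>_. f"] \<open>f \<in> ?A\<close> show ?thesis by auto
  qed
qed

lemma schwartz_mult:
  fixes m f :: "real^'n::finite \<Rightarrow> complex"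
  assumes "m \<in> slowly_increasing" "f \<in> schwartz"
  shows "(\<lambda>x. m x * f x) \<in> schwartz"
proof (rule sum_closure_subset_schwartz)
  let ?B = "{\<lambda>(_::unit) x. m x * f x |m f. m \<in> slowly_increasing \<and> f \<in> schwartz} :: (unit \<Rightarrow> real^'n \<Rightarrow> complex) set"
  show "(\<lambda>_ x. m x * f x) \<in> sum_closure ?B" using assms by (auto intro!: sum_closure.base)
  fix g assume "g \<in> ?B"
  then obtain m f where mf: "g = (\<lambda>_ x. m x * f x)" "m \<in> slowly_increasing" "f \<in> schwartz" by blast
  note diff = slowly_increasing_differentiable[OF mf(2)] schwartz_differentiable[OF mf(3)]
  show "g k differentiable (at x)" for k x
    unfolding mf(1) by (intro differentiable_mult diff)
  show "(\<lambda>k. partial i (g k)) \<in> sum_closure ?B" for i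
  proof -
    have "(\<lambda>k. partial i (g k)) = (\<lambda>_ x. partial i m x * f x + m x * partial i f x)"
      unfolding mf(1) by (intro ext partial_mult diff)
    moreover have "(\<lambda>_ x. partial i m x * f x) \<in> ?B"
      using mf slowly_increasing_partial[OF mf(2), of i] by blast
    moreover have "(\<lambda>_ x. m x * partial i f x) \<in> ?B"
      using mf schwartz_partial[OF mf(3), of i] by blast
    ultimately show ?thesis
      by (simp only: sum_closure.add[OF sum_closure.base sum_closure.base])
  qed
  fix N
  obtain C M where C: "C > 0" "\<And>x. cmod (m x) \<le> C * (1 + norm x) ^ M"
    using slowly_increasing_bound[OF mf(2)] by metis
  obtain D where D: "D > 0" "\<And>x. (1 + norm x) ^ (N + M) * cmod (f x) \<le> D"
    using schwartz_decay[OF mf(3), of "N + M"] by metis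
  have "(1 + norm x) ^ N * cmod (g () x) \<le> C * D" for x
  proof -
    have "(1 + norm x) ^ N * cmod (g () x) \<le> (1 + norm x) ^ N * ((C * (1 + norm x) ^ M) * cmod (f x))"
      unfolding mf(1) norm_mult using C by (intro mult_left_mono mult_right_mono) auto
    also have "\<dots> = C * ((1 + norm x) ^ (N + M) * cmod (f x))" by (simp add: power_add)
    also have "\<dots> \<le> C * D" using C(1) D(2) by (intro mult_left_mono) auto
    finally show ?thesis .
  qed
  then show "\<exists>C. \<forall>x. (1 + norm x) ^ N * cmod (g () x) \<le> C" by blast
qed

lemma schwartz_add:
  fixes f g :: "real^'n::finite \<Rightarrow> complex"
  assumes "f \<in> schwartz" "g \<in> schwartz"
  shows "(\<lambda>x. f x + g x) \<in> schwartz"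
proof (rule sum_closure_subset_schwartz)
  let ?B = "{\<lambda>_. f |f. f \<in> schwartz} :: (unit \<Rightarrow> real^'n \<Rightarrow> complex) set"
  have "(\<lambda>_. f) \<in> ?B" "(\<lambda>_. g) \<in> ?B" using assms by blast+
  then show "(\<lambda>_ x. f x + g x) \<in> sum_closure ?B" by (simp only: sum_closure.add[OF sum_closure.base sum_closure.base])
  fix h assume "h \<in> ?B"
  then obtain f where f: "h = (\<lambda>_. f)" "f \<in> schwartz" by blast
  show "h k differentiable (at x)" for k x unfolding f(1) by (rule schwartz_differentiable[OF f(2)])
  have "(\<lambda>k. partial i (h k)) \<in> ?B" for i unfolding f(1) using schwartz_partial[OF f(2)] by blast
  then show "(\<lambda>k. partial i (h k)) \<in> sum_closure ?B" for i by (rule sum_closure.base)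
  show "\<exists>C. \<forall>x. (1 + norm x) ^ N * cmod (h () x) \<le> C" for N
    unfolding f(1) using schwartz_decay[OF f(2)] by metis
qed

lemma partial_const: "partial i (\<lambda>_. c) x = 0"
  by (rule partial_eqI[OF has_derivative_const])

lemma slowly_increasing_const: "(\<lambda>_. c) \<in> slowly_increasing"
proof (rule slowly_increasing_coinduct[of _ "range (\<lambda>c _. c)"])
  show "partial i f \<in> range (\<lambda>c _. c)" if "f \<in> range (\<lambda>c _. c)" for f :: "real^'n \<Rightarrow> complex" and i
  proof -
    from that obtain c where "f = (\<lambda>_. c)" by auto
    then have "partial i f = (\<lambda>_. 0)" by (auto simp: partial_const)
    then show ?thesis by auto
  qed
  show "\<exists>C N. \<forall>x. cmod (f x) \<le> C * (1 + norm x) ^ N" if "f \<in> range (\<lambda>c _. c)" for f :: "real^'n \<Rightarrow> complex"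
  proof -
    from that obtain c where "f = (\<lambda>_. c)" by auto
    then show ?thesis by (intro exI[of _ "cmod c"] exI[of _ 0]) simp
  qed
qed auto

lemma schwartz_cmult: "f \<in> schwartz \<Longrightarrow> (\<lambda>x. c * f x) \<in> schwartz"
  by (rule schwartz_mult[OF slowly_increasing_const])

lemma partial_cmult: "f differentiable (at x) \<Longrightarrow> partial i (\<lambda>x. c * f x) x = c * partial i f x"
  by (simp add: partial_mult partial_const)

lemma schwartz_diff:
  assumes "f \<in> schwartz" "g \<in> schwartz"
  shows "(\<lambda>x. f x - g x) \<in> schwartz"
  using schwartz_add[OF assms(1) schwartz_cmult[OF assms(2), of "-1"]] by simp

lemma slowly_increasing_coord: "(\<lambda>x::real^'n::finite. c * of_real (x $ i)) \<in> slowly_increasing"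
proof (rule slowly_increasing_coinduct)
  \<comment> \<open>Affine functions instead of multiples of the coordinate, since the derivative is
    a constant.\<close>
  let ?A = "range (\<lambda>(c, d) x::real^'n. c * of_real (x $ i) + d) :: (real^'n \<Rightarrow> complex) set"
  show "(\<lambda>x::real^'n. c * of_real (x $ i)) \<in> ?A" by (auto intro!: image_eqI[of _ _ "(c, 0)"])
  have D: "((\<lambda>x::real^'n. c * of_real (x $ i) + d :: complex) has_derivative (\<lambda>v. c * of_real (v $ i))) (at x)"
    for c d x
  proof -
    have "bounded_linear (\<lambda>x::real^'n. of_real (x $ i) :: complex)"
      by (rule bounded_linear_compose[OF bounded_linear_of_real bounded_linear_vec_nth])
    then have "bounded_linear (\<lambda>x::real^'n. c * of_real (x $ i))"
      by (rule bounded_linear_const_mult)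
    from has_derivative_add[OF bounded_linear_imp_has_derivative[OF this] has_derivative_const]
    show ?thesis by simp
  qed
  show "f differentiable (at x)" if "f \<in> ?A" for f x using that D by (auto simp: differentiable_def)
  show "partial j f \<in> ?A" if "f \<in> ?A" for f j
  proof -
    from that obtain c d where f: "f = (\<lambda>x::real^'n. c * of_real (x $ i) + d)" by auto
    have "partial j f = (\<lambda>x. 0 * of_real (x $ i) + c * of_real (axis j 1 $ i))"
      unfolding f using partial_eqI[OF D] by auto
    then show ?thesis by (auto intro!: image_eqI[of _ _ "(0, c * of_real (axis j 1 $ i))"])
  qed
  show "\<exists>C N. \<forall>x. cmod (f x) \<le> C * (1 + norm x) ^ N" if "f \<in> ?A" for f
  proof -
    from that obtain c d where f: "f = (\<lambda>x::real^'n. c * of_real (x $ i) + d)" by auto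
    have "cmod (f x) \<le> (cmod c + cmod d) * (1 + norm x) ^ 1" for x
    proof -
      have "cmod (f x) \<le> cmod c * \<bar>x $ i\<bar> + cmod d" unfolding f
        by (metis norm_triangle_ineq norm_mult norm_of_real)
      also have "\<dots> \<le> cmod c * norm x + cmod d" 
        using component_le_norm_cart[of x i] by (auto intro!: mult_left_mono)
      also have "\<dots> \<le> (cmod c + cmod d) * (1 + norm x) ^ 1" by (simp add: algebra_simps)
      finally show ?thesis .
    qed
    then show ?thesis by blast
  qed
qed

lemma slowly_increasing_exp: "(\<lambda>x::real^'n::finite. iexp (x \<bullet> \<xi>)) \<in> slowly_increasing"
proof (rule slowly_increasing_coinduct)
  let ?A = "range (\<lambda>c x::real^'n. c * iexp (x \<bullet> \<xi>)) :: (real^'n \<Rightarrow> complex) set"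
  show "(\<lambda>x::real^'n. iexp (x \<bullet> \<xi>)) \<in> ?A" by (auto intro!: image_eqI[of _ _ "1"])
  have D: "((\<lambda>x::real^'n. c * iexp (x \<bullet> \<xi>)) has_derivative
     (\<lambda>v. c * (iexp (x \<bullet> \<xi>) * (\<i> * of_real (v \<bullet> \<xi>))))) (at x)" for c x
    by (rule has_derivative_mult_right, rule has_derivative_compose[where g=exp, of _ _ x UNIV, simplified, OF _ DERIV_exp[unfolded has_field_derivative_def], THEN has_derivative_eq_rhs])
      (auto intro!: derivative_eq_intros bounded_linear.has_derivative[OF bounded_linear_of_real])
  show "f differentiable (at x)" if "f \<in> ?A" for f x using that D by (auto simp: differentiable_def)
  show "partial j f \<in> ?A" if "f \<in> ?A" for f j
  proof -
    from that obtain c where f: "f = (\<lambda>x::real^'n. c * iexp (x \<bullet> \<xi>))" by (elim imageE)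
    have "partial j f = (\<lambda>x. (c * \<i> * of_real (axis j 1 \<bullet> \<xi>)) * iexp (x \<bullet> \<xi>))"
      unfolding f using partial_eqI[OF D] by (auto simp: mult_ac)
    then show ?thesis by blast
  qed
  show "\<exists>C N. \<forall>x. cmod (f x) \<le> C * (1 + norm x) ^ N" if "f \<in> ?A" for f
  proof -
    from that obtain c where f: "f = (\<lambda>x::real^'n. c * iexp (x \<bullet> \<xi>))" by (elim imageE)
    show ?thesis unfolding f by (intro exI[of _ "cmod c"] exI[of _ 0]) (simp add: norm_mult)
  qed
qed

text \<open>Let \<open>i\<close> be the least index with \<open>norm (x - x0) < 2 ^ i * r\<close>.
  If \<open>i > 0\<close>, the failure at \<open>i - 1\<close> bounds the weight by
  \<open>(1 / 2) ^ ((i - 1) * M)\<close>, which is the \<open>i\<close>-th coefficient; this is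
  where \<open>2 ^ M\<close> comes from. That one summand already dominates.\<close>

lemma inverse_power_le_dyadic:
  fixes x x0 :: "'a::real_normed_vector"
  assumes "r > 0"
  shows "ennreal (inverse ((1 + norm (x - x0) / r) ^ M))
      \<le> (\<Sum>i. ennreal (2 ^ M * (1 / 2) ^ (i * M)) * indicator (ball x0 (2 ^ i * r)) x)"
proof -
  obtain n where "norm (x - x0) / r < 2 ^ n" using real_arch_pow[of 2] by auto
  then have ex: "\<exists>i. norm (x - x0) < 2 ^ i * r" using assms by (auto simp: field_simps)
  define i where "i = (LEAST i. norm (x - x0) < 2 ^ i * r)"
  have i: "norm (x - x0) < 2 ^ i * r" unfolding i_def using ex by (rule LeastI_ex)
  have le: "inverse ((1 + norm (x - x0) / r) ^ M) \<le> 2 ^ M * (1 / 2) ^ (i * M)"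
  proof (cases i)
    case 0
    have "inverse ((1 + norm (x - x0) / r) ^ M) \<le> 1"
      using assms by (intro inverse_le_1_iff[THEN iffD2] disjI2 one_le_power) auto
    also have "1 \<le> (2::real) ^ M" by simp
    finally show ?thesis using 0 by simp
  next
    case (Suc k)
    have "\<not> norm (x - x0) < 2 ^ k * r"
      using not_less_Least[of k "\<lambda>i. norm (x - x0) < 2 ^ i * r"] Suc unfolding i_def by auto
    then have "2 ^ k \<le> 1 + norm (x - x0) / r" using assms by (simp add: field_simps)
    then have "(2 ^ k) ^ M \<le> (1 + norm (x - x0) / r) ^ M" by (intro power_mono) auto
    then have "inverse ((1 + norm (x - x0) / r) ^ M) \<le> inverse ((2 ^ k) ^ M)"
      by (intro le_imp_inverse_le) auto
    also have "\<dots> = 2 ^ M * (1 / 2) ^ (i * M)"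
      by (simp add: Suc power_mult[symmetric] power_add power_one_over field_simps)
    finally show ?thesis .
  qed
  have "ennreal (inverse ((1 + norm (x - x0) / r) ^ M))
      \<le> ennreal (2 ^ M * (1 / 2) ^ (i * M)) * indicator (ball x0 (2 ^ i * r)) x"
    using le i by (auto simp: dist_norm norm_minus_commute intro!: ennreal_leI)
  also have "\<dots> \<le> (\<Sum>i. ennreal (2 ^ M * (1 / 2) ^ (i * M)) * indicator (ball x0 (2 ^ i * r)) x)"
    using sum_le_suminf[of "\<lambda>i. ennreal (2 ^ M * (1 / 2) ^ (i * M)) * indicator (ball x0 (2 ^ i * r)) x" "{i}"]
    by (simp only: summableI finite.intros sum.insert sum.empty empty_iff not_False_eq_True add_0_right zero_le simp_thms)
  finally show ?thesis .
qed

text \<open>Turns a polynomially weighted integral over the whole space into integrals over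
  concentric balls, the only quantities that volumes and Morrey norms control. It is applied with
  \<open>w = 1\<close> and with functions of finite Morrey norm.\<close>

lemma nn_integral_le_dyadic:
  fixes w :: "'a::euclidean_space \<Rightarrow> ennreal"
  assumes [measurable]: "w \<in> borel_measurable borel" and "r > 0"
  shows "(\<integral>\<^sup>+x. w x * ennreal (inverse ((1 + norm (x - x0) / r) ^ M)) \<partial>lborel)
     \<le> (\<Sum>i. ennreal (2 ^ M * (1 / 2) ^ (i * M)) * (\<integral>\<^sup>+x\<in>ball x0 (2 ^ i * r). w x \<partial>lborel))"
proof -
  have "(\<integral>\<^sup>+x. w x * ennreal (inverse ((1 + norm (x - x0) / r) ^ M)) \<partial>lborel)
     \<le> (\<integral>\<^sup>+x. (\<Sum>i. ennreal (2 ^ M * (1 / 2) ^ (i * M)) * (w x * indicator (ball x0 (2 ^ i * r)) x)) \<partial>lborel)"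
  proof (rule nn_integral_mono)
    fix x
    have "w x * ennreal (inverse ((1 + norm (x - x0) / r) ^ M)) \<le>
        w x * (\<Sum>i. ennreal (2 ^ M * (1 / 2) ^ (i * M)) * indicator (ball x0 (2 ^ i * r)) x)"
      by (intro mult_left_mono inverse_power_le_dyadic assms) auto
    also have "\<dots> = (\<Sum>i. ennreal (2 ^ M * (1 / 2) ^ (i * M)) * (w x * indicator (ball x0 (2 ^ i * r)) x))"
      by (simp add: mult_ac flip: ennreal_suminf_cmult)
    finally show "w x * ennreal (inverse ((1 + norm (x - x0) / r) ^ M)) \<le> \<dots>" .
  qed
  also have "\<dots> = (\<Sum>i. ennreal (2 ^ M * (1 / 2) ^ (i * M)) * (\<integral>\<^sup>+x\<in>ball x0 (2 ^ i * r). w x \<partial>lborel))"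
  proof -
    have [measurable]: "ball x0 (2 ^ i * r) \<in> sets borel" for i by simp
    show ?thesis by (subst nn_integral_suminf) (measurable, simp add: nn_integral_cmult)
  qed
  finally show ?thesis .
qed

text \<open>The ball of radius \<open>2 ^ i\<close> has volume of order \<open>2 ^ (i d)\<close> and
  weight of order \<open>2 ^ (- i (d + 1))\<close>, so the dyadic series is geometric with ratio
  1/2.\<close>

lemma integrable_inverse_power:
  "integrable lborel (\<lambda>x::'a::euclidean_space. inverse ((1 + norm x) ^ (DIM('a) + 1)))"
proof (rule integrableI_bounded)
  let ?d = "DIM('a)"
  have "(\<integral>\<^sup>+x. ennreal (norm (inverse ((1 + norm (x::'a)) ^ (?d + 1)))) \<partial>lborel)
     = (\<integral>\<^sup>+x. 1 * ennreal (inverse ((1 + norm (x - (0::'a)) / 1) ^ (?d + 1))) \<partial>lborel)"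
    by (intro nn_integral_cong) (auto simp: abs_of_nonneg)
  also have "\<dots> \<le> (\<Sum>i. ennreal (2 ^ (?d + 1) * (1 / 2) ^ (i * (?d + 1))) * (\<integral>\<^sup>+x\<in>ball (0::'a) (2 ^ i * 1). 1 \<partial>lborel))"
    by (rule nn_integral_le_dyadic) auto
  also have "\<dots> = (\<Sum>i. ennreal (2 ^ (?d + 1) * unit_ball_vol ?d * (1 / 2) ^ i))"
  proof (intro suminf_cong)
    fix i
    have "(\<integral>\<^sup>+x\<in>ball (0::'a) (2 ^ i * 1). 1 \<partial>lborel) = ennreal (unit_ball_vol ?d * (2 ^ i) ^ ?d)"
      by (simp add: emeasure_ball)
    moreover have "(2 ^ (?d + 1) * (1 / 2) ^ (i * (?d + 1))) * (unit_ball_vol ?d * (2 ^ i) ^ ?d)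
       = 2 ^ (?d + 1) * unit_ball_vol ?d * (1 / 2 :: real) ^ i"
      by (simp add: power_add power_mult power_one_over field_simps)
    ultimately show "ennreal (2 ^ (?d + 1) * (1 / 2) ^ (i * (?d + 1))) * (\<integral>\<^sup>+x\<in>ball (0::'a) (2 ^ i * 1). 1 \<partial>lborel)
       = ennreal (2 ^ (?d + 1) * unit_ball_vol ?d * (1 / 2) ^ i)"
      by (simp add: unit_ball_vol_nonneg flip: ennreal_mult)
  qed
  also have "\<dots> < \<infinity>"
  proof -
    have "summable (\<lambda>i. 2 ^ (?d + 1) * unit_ball_vol ?d * (1 / 2 :: real) ^ i)"
      by (intro summable_mult summable_geometric) auto
    then show ?thesis
      by (subst suminf_ennreal2) (auto simp: unit_ball_vol_nonneg)
  qed
  finally show "(\<integral>\<^sup>+x. ennreal (norm (inverse ((1 + norm (x::'a)) ^ (?d + 1)))) \<partial>lborel) < \<infinity>" .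
qed simp

section \<open>Integrals of Schwartz functions and of their derivatives\<close>

lemma schwartz_weight_integrable:
  fixes f :: "real^'n::finite \<Rightarrow> complex"
  assumes "f \<in> schwartz"
  shows "integrable lborel (\<lambda>x. (1 + norm x) ^ N * cmod (f x))"
proof -
  note [measurable] = schwartz_borel[OF assms]
  obtain C where C: "\<And>x. (1 + norm x) ^ (N + (CARD('n) + 1)) * cmod (f x) \<le> C"
    using schwartz_decay[OF assms] by metis
  show ?thesis
  proof (rule Bochner_Integration.integrable_bound)
    show "integrable lborel (\<lambda>x::real^'n. C * inverse ((1 + norm x) ^ (CARD('n) + 1)))"
      using integrable_inverse_power[where 'a="real^'n"] by simp
    have "(1 + norm x) ^ N * cmod (f x) \<le> C * inverse ((1 + norm x) ^ (CARD('n) + 1))" for x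
    proof -
      have "(1 + norm x) ^ (CARD('n) + 1) > 0" by (intro zero_less_power add_pos_nonneg) auto
      with C[of x] show ?thesis by (simp add: power_add field_simps)
    qed
    then show "AE x in lborel. norm ((1 + norm x) ^ N * cmod (f x))
         \<le> norm (C * inverse ((1 + norm x) ^ (CARD('n) + 1)))"
      by (intro AE_I2) (smt (verit) mult_nonneg_nonneg norm_ge_zero real_norm_def zero_le_power)
  qed simp
qed

lemma schwartz_integrable:
  assumes "f \<in> schwartz"
  shows "integrable lborel f"
proof -
  have "integrable lborel (\<lambda>x. cmod (f x))"
    using schwartz_weight_integrable[OF assms, of 0] by simp
  then show ?thesis
    using schwartz_borel[OF assms] by (simp add: integrable_norm_iff)
qed

text \<open>Peetre's inequality: a polynomial weight moves from \<open>x\<close> to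
  \<open>x - y\<close> at the price of a weight in \<open>y\<close>.\<close>

lemma one_plus_norm_le:
  fixes x y :: "'a::real_normed_vector"
  shows "1 + norm x \<le> (1 + norm (x - y)) * (1 + norm y)"
proof -
  have "norm x \<le> norm (x - y) + norm y" using norm_triangle_ineq[of "x - y" y] by simp
  then show ?thesis by (simp add: algebra_simps) (smt (verit) mult_nonneg_nonneg norm_ge_zero)
qed

text \<open>Mean value inequality on the segment from \<open>x - y\<close> to \<open>x - y'\<close>.
  Its points are \<open>x - q\<close> with \<open>norm q <= norm y + norm y'\<close>, so decay of
  the partials there is converted into a weight at \<open>x\<close> by
  \<open>one_plus_norm_le\<close>.\<close>

lemma schwartz_lipschitz:
  fixes f :: "real^'n::finite \<Rightarrow> complex"
  assumes "f \<in> schwartz"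
  obtains L where "L > 0"
    "\<And>x y y'. (1 + norm x) ^ N * cmod (f (x - y) - f (x - y')) \<le> L * norm (y - y') * (1 + norm y + norm y') ^ N"
proof -
  have "\<exists>C>0. \<forall>x. (1 + norm x) ^ N * cmod (partial i f x) \<le> C" for i
    using schwartz_decay[OF schwartz_partial[OF assms]] by metis
  then have "\<exists>C. \<forall>i. C i > 0 \<and> (\<forall>x. (1 + norm x) ^ N * cmod (partial i f x) \<le> C i)"
    by (intro choice) blast
  then obtain C where C: "\<And>i. C i > 0" "\<And>i x. (1 + norm x) ^ N * cmod (partial i f x) \<le> C i" by blast
  define L where "L = (\<Sum>i\<in>UNIV. C i)"
  have "(1 + norm x) ^ N * cmod (f (x - y) - f (x - y')) \<le> L * norm (y - y') * (1 + norm y + norm y') ^ N" for x y y'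
  proof -
    let ?B = "L * (1 + norm y + norm y') ^ N / (1 + norm x) ^ N"
    have xpos: "(1 + norm x) ^ N > 0" by (intro zero_less_power add_pos_nonneg) auto
    have "norm (f (x - y) - f (x - y')) \<le> ?B * norm ((x - y) - (x - y'))"
    proof (rule differentiable_bound[where S="closed_segment (x - y) (x - y')"
          and f'="\<lambda>z v. \<Sum>i\<in>UNIV. (v $ i) *\<^sub>R partial i f z"])
      fix z assume z: "z \<in> closed_segment (x - y) (x - y')"
      show "(f has_derivative (\<lambda>v. \<Sum>i\<in>UNIV. (v $ i) *\<^sub>R partial i f z)) (at z within closed_segment (x - y) (x - y'))"
        by (rule has_derivative_at_withinI[OF has_derivative_partials[OF schwartz_differentiable[OF assms]]])
      obtain u where u: "0 \<le> u" "u \<le> 1" "z = (1 - u) *\<^sub>R (x - y) + u *\<^sub>R (x - y')"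
        using z unfolding closed_segment_def by auto
      define q where "q = (1 - u) *\<^sub>R y + u *\<^sub>R y'"
      have zq: "z = x - q" unfolding u(3) q_def by (simp add: algebra_simps)
      have "norm q \<le> (1 - u) * norm y + u * norm y'"
        unfolding q_def using u by (intro norm_triangle_le) auto
      also have "\<dots> \<le> 1 * norm y + 1 * norm y'" using u by (intro add_mono mult_right_mono) auto
      finally have q: "norm q \<le> norm y + norm y'" by simp
      have "1 + norm x \<le> (1 + norm z) * (1 + norm q)" unfolding zq by (rule one_plus_norm_le)
      also have "\<dots> \<le> (1 + norm z) * (1 + norm y + norm y')" using q by (intro mult_left_mono) auto
      finally have "(1 + norm x) ^ N \<le> ((1 + norm z) * (1 + norm y + norm y')) ^ N"
        by (intro power_mono) auto
      then have wt: "(1 + norm x) ^ N \<le> (1 + norm z) ^ N * (1 + norm y + norm y') ^ N"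
        by (simp add: power_mult_distrib)
      have pb: "cmod (partial i f z) \<le> C i * (1 + norm y + norm y') ^ N / (1 + norm x) ^ N" for i
      proof -
        have "(1 + norm x) ^ N * cmod (partial i f z)
            \<le> ((1 + norm z) ^ N * (1 + norm y + norm y') ^ N) * cmod (partial i f z)"
          by (intro mult_right_mono wt) auto
        also have "\<dots> = ((1 + norm z) ^ N * cmod (partial i f z)) * (1 + norm y + norm y') ^ N" by simp
        also have "\<dots> \<le> C i * (1 + norm y + norm y') ^ N" by (intro mult_right_mono C) auto
        finally show ?thesis using xpos by (simp add: field_simps)
      qed
      show "onorm (\<lambda>v. \<Sum>i\<in>UNIV. (v $ i) *\<^sub>R partial i f z) \<le> ?B"
      proof (rule onorm_le)
        fix v :: "real^'n"
        have "norm (\<Sum>i\<in>UNIV. (v $ i) *\<^sub>R partial i f z) \<le> (\<Sum>i\<in>UNIV. norm v * (C i * (1 + norm y + norm y') ^ N / (1 + norm x) ^ N))"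
          by (intro sum_norm_le order_trans[OF eq_refl[OF norm_scaleR]] mult_mono pb component_le_norm_cart) auto
        also have "\<dots> = ?B * norm v"
          by (simp add: L_def sum_distrib_left sum_distrib_right sum_divide_distrib mult_ac)
        finally show "norm (\<Sum>i\<in>UNIV. (v $ i) *\<^sub>R partial i f z) \<le> ?B * norm v" .
      qed
    qed auto
    then show ?thesis using xpos by (simp add: field_simps norm_minus_commute)
  qed
  moreover have "L > 0" unfolding L_def using C(1) by (intro sum_pos) auto
  ultimately show thesis by (rule that[rotated])
qed

lemma integral_lborel_affine:
  fixes f :: "'a::euclidean_space \<Rightarrow> 'b::{banach, second_countable_topology}"
  assumes [measurable]: "f \<in> borel_measurable borel" and "a \<noteq> 0"
  shows "(LINT x|lborel. f x) = \<bar>a\<bar> ^ DIM('a) *\<^sub>R (LINT x|lborel. f (t + a *\<^sub>R x))"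
proof -
  have "(LINT x|lborel. f x) = (LINT x|density (distr lborel borel (\<lambda>x. t + a *\<^sub>R x)) (\<lambda>_. \<bar>a\<bar>^DIM('a)). f x)"
    using lborel_affine[OF assms(2), of t] by simp
  also have "\<dots> = (LINT x|lborel. \<bar>a\<bar> ^ DIM('a) *\<^sub>R f (t + a *\<^sub>R x))"
    by (simp add: integral_density integral_distr)
  finally show ?thesis by simp
qed

text \<open>Difference quotients in direction \<open>i\<close> have integral 0 by translation
  invariance and converge to the partial derivative; \<open>schwartz_lipschitz\<close> provides the
  integrable majorant.\<close>

lemma integral_partial_schwartz:
  fixes f :: "real^'n::finite \<Rightarrow> complex"
  assumes "f \<in> schwartz"
  shows "(LINT x|lborel. partial i f x) = 0"
proof -
  let ?N = "CARD('n) + 1" and ?e = "axis i 1 :: real^'n"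
  note [measurable] = schwartz_borel[OF assms] schwartz_borel[OF schwartz_partial[OF assms]]
  obtain L where L: "L > 0" "\<And>x y y'. (1 + norm x) ^ ?N * cmod (f (x - y) - f (x - y'))
      \<le> L * norm (y - y') * (1 + norm y + norm y') ^ ?N"
    using schwartz_lipschitz[OF assms] by metis
  define g where "g = (\<lambda>n x. (f (x + (1 / real (Suc n)) *\<^sub>R ?e) - f x) /\<^sub>R (1 / real (Suc n)))"
  have [measurable]: "g n \<in> borel_measurable borel" for n unfolding g_def by measurable
  have "(LINT x|lborel. g n x) = 0" for n
  proof -
    have int: "integrable lborel (\<lambda>x. f (x + (1 / real (Suc n)) *\<^sub>R ?e))"
      using schwartz_integrable[OF schwartz_affine_comp[OF assms, of 1 "(1 / real (Suc n)) *\<^sub>R ?e"]] by simp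
    have "(LINT x|lborel. f x) = (LINT x|lborel. f (x + (1 / real (Suc n)) *\<^sub>R ?e))"
      using integral_lborel_affine[of f 1 "(1 / real (Suc n)) *\<^sub>R ?e"] by (simp add: add.commute)
    then show ?thesis unfolding g_def
      using int schwartz_integrable[OF assms] by simp
  qed
  moreover have "(\<lambda>n. LINT x|lborel. g n x) \<longlonglongrightarrow> (LINT x|lborel. partial i f x)"
  proof (rule integral_dominated_convergence[where w="\<lambda>x. L * 2 ^ ?N * inverse ((1 + norm x) ^ ?N)"])
    show "integrable lborel (\<lambda>x::real^'n. L * 2 ^ ?N * inverse ((1 + norm x) ^ ?N))"
      using integrable_inverse_power[where 'a="real^'n"] by simp
    show "AE x in lborel. (\<lambda>n. g n x) \<longlonglongrightarrow> partial i f x"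
    proof (rule AE_I2)
      fix x :: "real^'n"
      have "((\<lambda>t::real. f (x + t *\<^sub>R ?e)) has_derivative (\<lambda>t. t *\<^sub>R partial i f x)) (at 0)"
      proof -
        have 1: "((\<lambda>t::real. x + t *\<^sub>R ?e) has_derivative (\<lambda>t. t *\<^sub>R ?e)) (at 0)"
          by (auto intro!: derivative_eq_intros)
        have 2: "(f has_derivative (\<lambda>v. \<Sum>j\<in>UNIV. (v $ j) *\<^sub>R partial j f x)) (at (x + 0 *\<^sub>R ?e))"
          using has_derivative_partials[OF schwartz_differentiable[OF assms], of x] by simp
        from has_derivative_compose[OF 1 2] show ?thesis
          by (simp only: vector_scaleR_component real_scaleR_def sum_axis_scaleR')
      qed
      then have "((\<lambda>t. norm (f (x + t *\<^sub>R ?e) - f x - t *\<^sub>R partial i f x) / norm t) \<longlongrightarrow> 0) (at 0)"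
        by (simp add: has_derivative_at)
      then have "((\<lambda>t. norm ((f (x + t *\<^sub>R ?e) - f x) /\<^sub>R t - partial i f x)) \<longlongrightarrow> 0) (at 0)"
      proof (rule Lim_transform_eventually)
        have "norm (f (x + t *\<^sub>R ?e) - f x - t *\<^sub>R partial i f x) / norm t
          = norm ((f (x + t *\<^sub>R ?e) - f x) /\<^sub>R t - partial i f x)" if "t \<noteq> 0" for t :: real
        proof -
          have "f (x + t *\<^sub>R ?e) - f x - t *\<^sub>R partial i f x = t *\<^sub>R ((f (x + t *\<^sub>R ?e) - f x) /\<^sub>R t - partial i f x)"
            using that by (simp add: algebra_simps)
          then show ?thesis using that by (simp del: scaleR_right_diff_distrib)
        qed
        then show "\<forall>\<^sub>F t in at 0. norm (f (x + t *\<^sub>R ?e) - f x - t *\<^sub>R partial i f x) / norm t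
          = norm ((f (x + t *\<^sub>R ?e) - f x) /\<^sub>R t - partial i f x)"
          by (auto simp: eventually_at_filter)
      qed
      then have "((\<lambda>t. (f (x + t *\<^sub>R ?e) - f x) /\<^sub>R t) \<longlongrightarrow> partial i f x) (at 0)"
        using tendsto_norm_zero_iff LIM_zero_cancel by blast
      moreover have "filterlim (\<lambda>n. 1 / real (Suc n)) (at 0) sequentially"
        unfolding filterlim_at using LIMSEQ_Suc[OF lim_1_over_n] by auto
      ultimately show "(\<lambda>n. g n x) \<longlonglongrightarrow> partial i f x"
        unfolding g_def by (rule filterlim_compose)
    qed
    show "AE x in lborel. norm (g n x) \<le> L * 2 ^ ?N * inverse ((1 + norm x) ^ ?N)" for n
    proof (rule AE_I2)
      fix x :: "real^'n"
      have xpos: "(1 + norm x) ^ ?N > 0" by (intro zero_less_power add_pos_nonneg) auto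
      have "(1 + norm x) ^ ?N * cmod (f (x - (- ((1 / real (Suc n)) *\<^sub>R ?e))) - f (x - 0))
        \<le> L * (1 / real (Suc n)) * (1 + 1 / real (Suc n)) ^ ?N"
        using L(2)[of x "- ((1 / real (Suc n)) *\<^sub>R ?e)" 0] by simp
      also have "\<dots> \<le> L * (1 / real (Suc n)) * 2 ^ ?N"
        using L(1) by (intro mult_left_mono power_mono) (auto simp: field_simps)
      finally have "(1 + norm x) ^ ?N * (cmod (f (x + (1 / real (Suc n)) *\<^sub>R ?e) - f x) * Suc n) \<le> L * 2 ^ ?N"
        by (simp add: field_simps)
      then have "(1 + norm x) ^ ?N * norm (g n x) \<le> L * 2 ^ ?N"
        unfolding g_def by (simp add: mult_ac)
      then show "norm (g n x) \<le> L * 2 ^ ?N * inverse ((1 + norm x) ^ ?N)"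
        using pos_le_divide_eq[OF xpos, of "norm (g n x)" "L * 2 ^ ?N"]
        by (simp add: divide_inverse mult_ac)
    qed
  qed auto
  ultimately show ?thesis by (simp add: LIMSEQ_const_iff)
qed

section \<open>The Fourier transform on Schwartz functions\<close>

definition fourier_factor :: "'n::finite itself \<Rightarrow> complex" where
  "fourier_factor _ = of_real ((2 * pi) powr (- real CARD('n) / 2))"

lemma fourier_eq:
  "fourier f \<xi> = fourier_factor TYPE('n) *
    (LINT x|lborel. iexp (x \<bullet> - \<xi>) * f x)" for f :: "real^'n::finite \<Rightarrow> complex"
  by (simp add: fourier_def fourier_factor_def)

lemma inverse_fourier_eq_fourier: "inverse_fourier f \<xi> = fourier f (- \<xi>)"
  by (simp add: fourier_def inverse_fourier_def inner_commute)

lemma norm_exp_i [simp]: "cmod (iexp a) = 1"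
  by simp

lemma exp_i_borel [measurable]: "(\<lambda>x::real^'n::finite. iexp (x \<bullet> \<xi>)) \<in> borel_measurable borel"
  by (intro borel_measurable_continuous_onI continuous_intros)

lemma integrable_exp_i_mult:
  fixes f :: "real^'n::finite \<Rightarrow> complex"
  assumes "integrable lborel f"
  shows "integrable lborel (\<lambda>x. iexp (x \<bullet> \<xi>) * f x)"
proof (rule Bochner_Integration.integrable_bound[OF assms])
  have [measurable]: "f \<in> borel_measurable borel"
    using borel_measurable_integrable[OF assms] by simp
  show "(\<lambda>x. iexp (x \<bullet> \<xi>) * f x) \<in> borel_measurable lborel" by measurable
qed (simp add: norm_mult)

lemma fourier_bound:
  fixes f :: "real^'n::finite \<Rightarrow> complex"
  shows "cmod (fourier f \<xi>) \<le> cmod (fourier_factor TYPE('n)) * (LINT x|lborel. cmod (f x))"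
proof -
  have "cmod (LINT x|lborel. iexp (x \<bullet> - \<xi>) * f x)
      \<le> (LINT x|lborel. cmod (iexp (x \<bullet> - \<xi>) * f x))"
    by (rule integral_norm_bound)
  then show ?thesis unfolding fourier_eq norm_mult norm_exp_i
    by (intro mult_left_mono) auto
qed

lemma has_derivative_quadratic:
  fixes f :: "'a::real_normed_vector \<Rightarrow> 'b::real_normed_vector"
  assumes "bounded_linear D" "\<And>v. norm (f (x + v) - f x - D v) \<le> K * norm v ^ 2"
  shows "(f has_derivative D) (at x)"
  unfolding has_derivative_at
proof
  show "(\<lambda>h. norm (f (x + h) - f x - D h) / norm h) \<midarrow>0\<rightarrow> 0"
  proof (rule Lim_null_comparison)
    have "norm (norm (f (x + h) - f x - D h) / norm h) \<le> K * norm h" if "h \<noteq> 0" for h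
      using assms(2)[of h] that by (simp add: divide_le_eq power2_eq_square)
    then show "\<forall>\<^sub>F h in at 0. norm (norm (f (x + h) - f x - D h) / norm h) \<le> K * norm h"
      by (auto simp: eventually_at_filter)
    show "(\<lambda>h. K * norm h) \<midarrow>0\<rightarrow> 0" by (intro tendsto_eq_intros) auto
  qed
qed (rule assms)

lemma exp_i_quadratic: "cmod (iexp a - 1 - \<i> * of_real a) \<le> a ^ 2"
  using iexp_approx1[of a 1] by (simp add: power2_eq_square algebra_simps) (smt (verit) zero_le_square)

lemma schwartz_coord: "f \<in> schwartz \<Longrightarrow> (\<lambda>x. c * of_real (x $ i) * f x) \<in> schwartz"
  using schwartz_mult[OF slowly_increasing_coord] by (simp add: mult.assoc)

text \<open>The second-order Taylor bound for the exponential leaves a remainder of at most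
  \<open>norm v ^ 2\<close> times a multiple of the integral of
  \<open>(1 + norm x) ^ 2 * cmod (f x)\<close>, which is finite. Differentiation under the integral
  sign thus becomes a plain estimate.\<close>

lemma has_derivative_fourier:
  fixes f :: "real^'n::finite \<Rightarrow> complex"
  assumes f: "f \<in> schwartz"
  shows "(fourier f has_derivative
    (\<lambda>v. \<Sum>i\<in>UNIV. (v $ i) *\<^sub>R fourier (\<lambda>x. - \<i> * of_real (x $ i) * f x) \<xi>)) (at \<xi>)"
proof (rule has_derivative_quadratic)
  show "bounded_linear (\<lambda>v. \<Sum>i\<in>UNIV. (v $ i) *\<^sub>R fourier (\<lambda>x. - \<i> * of_real (x $ i) * f x) \<xi>)"
    by (intro bounded_linear_sum bounded_linear_scaleR_left[THEN bounded_linear_compose] bounded_linear_vec_nth)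
  fix v
  let ?e = "\<lambda>x. iexp (x \<bullet> - \<xi>)" and ?c = "fourier_factor TYPE('n)"
  have coord: "integrable lborel (\<lambda>x. ?e x * (- \<i> * of_real (x $ i) * f x))" for i
    by (intro integrable_exp_i_mult schwartz_integrable schwartz_coord f)
  have "(\<Sum>i\<in>UNIV. (v $ i) *\<^sub>R fourier (\<lambda>x. - \<i> * of_real (x $ i) * f x) \<xi>)
     = ?c * (\<Sum>i\<in>UNIV. (LINT x|lborel. of_real (v $ i) * (?e x * (- \<i> * of_real (x $ i) * f x))))"
    unfolding fourier_eq integral_mult_right_zero sum_distrib_left
    by (intro sum.cong refl) (simp add: scaleR_conv_of_real)
  also have "(\<Sum>i\<in>UNIV. (LINT x|lborel. of_real (v $ i) * (?e x * (- \<i> * of_real (x $ i) * f x))))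
     = (LINT x|lborel. (\<Sum>i\<in>UNIV. of_real (v $ i) * (?e x * (- \<i> * of_real (x $ i) * f x))))"
    by (rule Bochner_Integration.integral_sum[symmetric]) (intro integrable_mult_right coord)
  also have "\<dots> = (LINT x|lborel. ?e x * (\<i> * of_real (x \<bullet> - v) * f x))"
    by (intro Bochner_Integration.integral_cong refl)
      (simp add: inner_vec_def sum_distrib_left sum_distrib_right sum_negf mult_ac)
  finally have D: "(\<Sum>i\<in>UNIV. (v $ i) *\<^sub>R fourier (\<lambda>x. - \<i> * of_real (x $ i) * f x) \<xi>)
     = ?c * (LINT x|lborel. ?e x * (\<i> * of_real (x \<bullet> - v) * f x))" .
  have intD: "integrable lborel (\<lambda>x. ?e x * (\<i> * of_real (x \<bullet> - v) * f x))"
  proof -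
    have "integrable lborel (\<lambda>x. \<Sum>i\<in>UNIV. of_real (v $ i) * (?e x * (- \<i> * of_real (x $ i) * f x)))"
      by (intro Bochner_Integration.integrable_sum integrable_mult_right coord)
    then show ?thesis
      by (simp add: inner_vec_def sum_distrib_left sum_distrib_right sum_negf mult_ac)
  qed
  have int: "integrable lborel (\<lambda>x. iexp (x \<bullet> \<eta>) * f x)" for \<eta>
    by (intro integrable_exp_i_mult schwartz_integrable f)
  have pw: "cmod (iexp (x \<bullet> - (\<xi> + v)) * f x - ?e x * f x - ?e x * (\<i> * of_real (x \<bullet> - v) * f x))
       \<le> norm v ^ 2 * ((1 + norm x) ^ 2 * cmod (f x))" for x
  proof -
    have "iexp (x \<bullet> - (\<xi> + v)) * f x - ?e x * f x - ?e x * (\<i> * of_real (x \<bullet> - v) * f x)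
       = ?e x * (iexp (x \<bullet> - v) - 1 - \<i> * of_real (x \<bullet> - v)) * f x"
      by (simp add: inner_diff_right algebra_simps flip: exp_add)
    moreover have "cmod (iexp (x \<bullet> - v) - 1 - \<i> * of_real (x \<bullet> - v)) \<le> (norm v * (1 + norm x)) ^ 2"
    proof -
      have "\<bar>x \<bullet> - v\<bar> \<le> norm x * norm v" using Cauchy_Schwarz_ineq2[of x "- v"] by simp
      also have "\<dots> \<le> norm v * (1 + norm x)" by (simp add: algebra_simps)
      finally have "\<bar>x \<bullet> - v\<bar> ^ 2 \<le> (norm v * (1 + norm x)) ^ 2" by (intro power_mono) auto
      then show ?thesis using exp_i_quadratic[of "x \<bullet> - v"] by simp
    qed
    then have "cmod (iexp (x \<bullet> - v) - 1 - \<i> * of_real (x \<bullet> - v)) * cmod (f x)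
        \<le> (norm v * (1 + norm x)) ^ 2 * cmod (f x)"
      by (rule mult_right_mono) simp
    ultimately show ?thesis
      by (simp only: norm_mult norm_exp_i power_mult_distrib mult.assoc mult_1_left)
  qed
  have "fourier f (\<xi> + v) - fourier f \<xi> - (\<Sum>i\<in>UNIV. (v $ i) *\<^sub>R fourier (\<lambda>x. - \<i> * of_real (x $ i) * f x) \<xi>)
    = ?c * (LINT x|lborel. iexp (x \<bullet> - (\<xi> + v)) * f x - ?e x * f x - ?e x * (\<i> * of_real (x \<bullet> - v) * f x))"
    unfolding D by (simp only: fourier_eq Bochner_Integration.integral_diff Bochner_Integration.integrable_diff int intD right_diff_distrib)
  also have "cmod \<dots> \<le> cmod ?c * (LINT x|lborel. norm v ^ 2 * ((1 + norm x) ^ 2 * cmod (f x)))"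
    unfolding norm_mult
    by (rule mult_left_mono[OF Bochner_Integration.integral_norm_bound_integral norm_ge_zero])
      (intro Bochner_Integration.integrable_diff int intD integrable_mult_right schwartz_weight_integrable f pw)+
  finally show "cmod (fourier f (\<xi> + v) - fourier f \<xi> - (\<Sum>i\<in>UNIV. (v $ i) *\<^sub>R fourier (\<lambda>x. - \<i> * of_real (x $ i) * f x) \<xi>))
    \<le> (cmod ?c * (LINT x|lborel. (1 + norm x) ^ 2 * cmod (f x))) * norm v ^ 2"
    unfolding integral_mult_right_zero by (simp add: mult_ac)
qed

lemma partial_fourier:
  fixes f :: "real^'n::finite \<Rightarrow> complex"
  assumes "f \<in> schwartz"
  shows "partial i (fourier f) = fourier (\<lambda>x. - \<i> * of_real (x $ i) * f x)"
  using partial_eqI[OF has_derivative_fourier[OF assms]] unfolding sum_axis_scaleR by blast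

text \<open>Integration by parts: the partial derivative of \<open>f\<close> times the character has
  integral 0.\<close>

lemma fourier_partial:
  fixes f :: "real^'n::finite \<Rightarrow> complex"
  assumes f: "f \<in> schwartz"
  shows "fourier (partial i f) \<xi> = \<i> * of_real (\<xi> $ i) * fourier f \<xi>"
proof -
  let ?e = "\<lambda>x. iexp (x \<bullet> - \<xi>)"
  have e: "?e \<in> slowly_increasing" by (rule slowly_increasing_exp)
  have "((\<lambda>x. ?e x) has_derivative (\<lambda>v. ?e x * (\<i> * of_real (v \<bullet> - \<xi>)))) (at x)" for x
    by (rule has_derivative_compose[where g=exp, of _ _ x UNIV, simplified, OF _ DERIV_exp[unfolded has_field_derivative_def], THEN has_derivative_eq_rhs])
      (auto intro!: derivative_eq_intros bounded_linear.has_derivative[OF bounded_linear_of_real])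
  from partial_eqI[OF this] have pe: "partial i ?e x = ?e x * (- \<i> * of_real (\<xi> $ i))" for x
    by (simp add: inner_axis' )
  have eq: "partial i (\<lambda>x. ?e x * f x) x = (- \<i> * of_real (\<xi> $ i)) * (?e x * f x) + ?e x * partial i f x" for x
    using partial_mult[OF slowly_increasing_differentiable[OF e] schwartz_differentiable[OF f], of i x]
    unfolding pe by (simp only: mult_ac)
  have "0 = (LINT x|lborel. (- \<i> * of_real (\<xi> $ i)) * (?e x * f x) + ?e x * partial i f x)"
    using integral_partial_schwartz[OF schwartz_mult[OF e f], of i] unfolding eq by simp
  also have "\<dots> = (- \<i> * of_real (\<xi> $ i)) * (LINT x|lborel. ?e x * f x) + (LINT x|lborel. ?e x * partial i f x)"
    by (subst Bochner_Integration.integral_add)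
      (intro integrable_mult_right integrable_exp_i_mult schwartz_integrable schwartz_partial f,
       intro integrable_exp_i_mult schwartz_integrable schwartz_partial f, simp only: integral_mult_right_zero)
  finally have "(LINT x|lborel. ?e x * partial i f x) = \<i> * of_real (\<xi> $ i) * (LINT x|lborel. ?e x * f x)"
    by (simp add: algebra_simps eq_neg_iff_add_eq_0)
  then show ?thesis unfolding fourier_eq by simp
qed

text \<open>One more factor \<open>1 + norm \<xi>\<close> is at most 1 plus the sum of the absolute
  coordinates, and each coordinate is traded for a partial derivative of \<open>f\<close> by
  \<open>fourier_partial\<close>; hence the induction on \<open>N\<close> runs over all
  \<open>f\<close>.\<close>

lemma fourier_decay:
  fixes f :: "real^'n::finite \<Rightarrow> complex"
  assumes "f \<in> schwartz"
  shows "\<exists>C. \<forall>\<xi>. (1 + norm \<xi>) ^ N * cmod (fourier f \<xi>) \<le> C"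
  using assms
proof (induction N arbitrary: f)
  case 0
  show ?case using fourier_bound[of f] by auto
next
  case (Suc N)
  obtain C where C: "\<And>\<xi>. (1 + norm \<xi>) ^ N * cmod (fourier f \<xi>) \<le> C" using Suc by blast
  have "\<exists>D. \<forall>i \<xi>. (1 + norm \<xi>) ^ N * cmod (fourier (partial i f) \<xi>) \<le> D i"
    using Suc.IH[OF schwartz_partial[OF Suc.prems]] by (intro choice) blast
  then obtain D where D: "\<And>i \<xi>. (1 + norm \<xi>) ^ N * cmod (fourier (partial i f) \<xi>) \<le> D i" by blast
  have "(1 + norm \<xi>) ^ Suc N * cmod (fourier f \<xi>) \<le> C + (\<Sum>i\<in>UNIV. D i)" for \<xi>
  proof -
    let ?w = "(1 + norm \<xi>) ^ N * cmod (fourier f \<xi>)"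
    have w: "0 \<le> ?w" by auto
    have "(1 + norm \<xi>) ^ Suc N * cmod (fourier f \<xi>) = ?w + norm \<xi> * ?w" by (simp add: algebra_simps)
    also have "norm \<xi> * ?w \<le> (\<Sum>i\<in>UNIV. \<bar>\<xi> $ i\<bar>) * ?w"
      by (intro mult_right_mono w norm_le_l1_cart)
    also have "\<dots> = (\<Sum>i\<in>UNIV. (1 + norm \<xi>) ^ N * cmod (fourier (partial i f) \<xi>))"
      unfolding fourier_partial[OF Suc.prems] sum_distrib_right by (simp add: norm_mult mult_ac)
    finally show ?thesis using C[of \<xi>] D[of \<xi>] by (smt (verit) sum_mono)
  qed
  then show ?case by blast
qed

lemma fourier_schwartz:
  assumes "f \<in> schwartz"
  shows "fourier f \<in> schwartz"
proof (rule schwartz_coinduct[of _ "fourier ` schwartz"])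
  show "fourier f \<in> fourier ` schwartz" using assms by blast
  show "g differentiable (at x)" if "g \<in> fourier ` schwartz" for g :: "real^'n \<Rightarrow> complex" and x
    using that differentiableI[OF has_derivative_fourier] by auto
  show "partial i g \<in> fourier ` schwartz" if "g \<in> fourier ` schwartz" for g :: "real^'n \<Rightarrow> complex" and i
    using that schwartz_coord[of _ "- \<i>" i] by (auto simp: partial_fourier intro!: imageI)
  show "\<exists>C. \<forall>x. (1 + norm x) ^ N * cmod (g x) \<le> C" if "g \<in> fourier ` schwartz" for g :: "real^'n \<Rightarrow> complex" and N
    using that fourier_decay by blast
qed

lemma inverse_fourier_schwartz:
  assumes "f \<in> schwartz"
  shows "inverse_fourier f \<in> schwartz"
  using schwartz_affine_comp[OF fourier_schwartz[OF assms], of "-1" 0]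
  by (simp add: inverse_fourier_eq_fourier[abs_def])

lemma exp_i_pair_borel [measurable]:
  "(\<lambda>(x, y). iexp (\<sigma> * (x \<bullet> y))) \<in> borel_measurable (borel \<Otimes>\<^sub>M (borel :: (real^'n::finite) measure))"
proof -
  have "(\<lambda>p::(real^'n) \<times> (real^'n). iexp (\<sigma> * (fst p \<bullet> snd p))) \<in> borel_measurable borel"
    by (intro borel_measurable_continuous_onI continuous_intros)
  then show ?thesis by (simp add: borel_prod case_prod_beta)
qed

text \<open>Fubini for the exponential kernel; \<open>\<sigma> = -1\<close> and
  \<open>\<sigma> = 1\<close> serve the two transforms.\<close>

lemma integral_exp_i_swap:
  fixes f g :: "real^'n::finite \<Rightarrow> complex"
  assumes f: "integrable lborel f" and g: "integrable lborel g"
  shows "(LINT y|lborel. (LINT x|lborel. iexp (\<sigma> * (x \<bullet> y)) * f x) * g y) =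
         (LINT x|lborel. f x * (LINT y|lborel. iexp (\<sigma> * (x \<bullet> y)) * g y))"
proof -
  note [measurable] = borel_measurable_integrable[OF f, simplified] borel_measurable_integrable[OF g, simplified]
  let ?F = "\<lambda>x y. (iexp (\<sigma> * (x \<bullet> y)) * f x) * g y"
  have int_y: "integrable lborel (?F x)" for x
    using integrable_mult_right[OF integrable_exp_i_mult[OF g, of "\<sigma> *\<^sub>R x"], of "f x"]
    by (simp add: inner_commute mult_ac)
  have "integrable (lborel \<Otimes>\<^sub>M lborel) (case_prod ?F)"
  proof (rule lborel_pair.Fubini_integrable)
    show "case_prod ?F \<in> borel_measurable (lborel \<Otimes>\<^sub>M lborel)" by measurable
    have "integrable lborel (\<lambda>x. cmod (f x) * (LINT y|lborel. cmod (g y)))"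
      using f by (intro integrable_mult_left integrable_norm)
    then show "integrable lborel (\<lambda>x. LINT y|lborel. norm (case_prod ?F (x, y)))"
      by (simp add: norm_mult)
    show "AE x in lborel. integrable lborel (\<lambda>y. case_prod ?F (x, y))" using int_y by simp
  qed
  from lborel_pair.Fubini_integral[OF this] show ?thesis
    by (simp add: mult_ac flip: integral_mult_right_zero integral_mult_left_zero)
qed

lemma fourier_multiplication_formula:
  fixes f g :: "real^'n::finite \<Rightarrow> complex"
  assumes "integrable lborel f" "integrable lborel g"
  shows "(LINT \<xi>|lborel. fourier f \<xi> * g \<xi>) = (LINT x|lborel. f x * fourier g x)"
  using integral_exp_i_swap[OF assms, of "-1"] unfolding fourier_eq
  by (simp add: inner_commute mult_ac)

lemma inverse_fourier_multiplication_formula: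
  fixes f g :: "real^'n::finite \<Rightarrow> complex"
  assumes "integrable lborel f" "integrable lborel g"
  shows "(LINT \<xi>|lborel. inverse_fourier f \<xi> * g \<xi>) = (LINT x|lborel. f x * inverse_fourier g x)"
  using integral_exp_i_swap[OF assms, of "1"] unfolding inverse_fourier_eq_fourier fourier_eq minus_minus
  by (simp add: inner_commute mult_ac)

text \<open>The convolution theorem. The character in the outer transform is absorbed into
  \<open>k\<close>, where it acts as a translation; the extra \<open>fourier_factor\<close> is due
  to the symmetric normalisation of the transforms.\<close>

lemma fourier_mult_inverse_fourier:
  fixes k w :: "real^'n::finite \<Rightarrow> complex"
  assumes k: "integrable lborel k" and w: "integrable lborel w"
  shows "fourier (\<lambda>\<xi>. k \<xi> * inverse_fourier w \<xi>) x =
    (LINT y|lborel. w y * (fourier_factor TYPE('n) * fourier k (x - y)))"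
proof -
  let ?c = "fourier_factor TYPE('n)"
  let ?g = "\<lambda>\<xi>. iexp (\<xi> \<bullet> - x) * k \<xi>"
  have "fourier (\<lambda>\<xi>. k \<xi> * inverse_fourier w \<xi>) x = ?c * (LINT \<xi>|lborel. inverse_fourier w \<xi> * ?g \<xi>)"
    unfolding fourier_eq by (simp add: mult_ac)
  also have "\<dots> = ?c * (LINT y|lborel. w y * inverse_fourier ?g y)"
    using inverse_fourier_multiplication_formula[OF w integrable_exp_i_mult[OF k, of "- x"]] by simp
  also have "inverse_fourier ?g = (\<lambda>y. fourier k (x - y))"
    unfolding inverse_fourier_eq_fourier fourier_eq
    by (simp add: inner_diff_right exp_diff exp_minus field_simps)
  finally show ?thesis by (simp add: mult_ac flip: integral_mult_right_zero)
qed

section \<open>Gaussians and Fourier inversion\<close>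

lemma integrable_lborel_affine:
  fixes f :: "'a::euclidean_space \<Rightarrow> 'b::{banach, second_countable_topology}"
  assumes f: "integrable lborel f" and a: "a \<noteq> 0"
  shows "integrable lborel (\<lambda>x. f (t + a *\<^sub>R x))"
proof -
  note [measurable] = borel_measurable_integrable[OF f, simplified]
  have "integrable (density (distr lborel borel (\<lambda>x. t + a *\<^sub>R x)) (\<lambda>_. ennreal (\<bar>a\<bar> ^ DIM('a)))) f"
    using f lborel_affine[OF a, of t] by simp
  then have "integrable lborel (\<lambda>x. \<bar>a\<bar> ^ DIM('a) *\<^sub>R f (t + a *\<^sub>R x))"
    by (subst (asm) integrable_density) (auto simp: integrable_distr_eq)
  from integrable_scaleR_right[OF this, of "1 / \<bar>a\<bar> ^ DIM('a)"] a show ?thesis by simp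
qed

text \<open>Up to the factor \<open>sqrt (2 * pi)\<close> this is the characteristic function of the
  standard normal distribution.\<close>

lemma gaussian_1d:
  fixes t :: real
  shows "integrable lborel (\<lambda>x. iexp (t * x) * of_real (exp (- x\<^sup>2 / 2)))" (is ?i)
    and "(LINT x|lborel. iexp (t * x) * of_real (exp (- x\<^sup>2 / 2)))
       = of_real (sqrt (2 * pi) * exp (- t\<^sup>2 / 2))" (is ?e)
proof -
  have "integrable lborel (\<lambda>x. std_normal_density x)"
    by (rule integrable_normal_density) simp
  then have "integrable lborel (\<lambda>x. sqrt (2 * pi) * std_normal_density x)"
    by (rule integrable_mult_right)
  then have int: "integrable lborel (\<lambda>x::real. exp (- x\<^sup>2 / 2))"
    by (simp add: std_normal_density_def)
  show ?i by (rule Bochner_Integration.integrable_bound[OF int]) (auto simp: norm_mult)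
  have "of_real (exp (- t\<^sup>2 / 2)) = char std_normal_distribution t"
    by (simp add: char_std_normal_distribution)
  also have "\<dots> = (LINT x|lborel. std_normal_density x *\<^sub>R iexp (t * x))"
    unfolding char_def by (subst integral_density) (auto simp: normal_density_nonneg)
  also have "\<dots> = (LINT x|lborel. of_real (1 / sqrt (2 * pi)) * (iexp (t * x) * of_real (exp (- x\<^sup>2 / 2))))"
    by (intro Bochner_Integration.integral_cong refl) (simp add: std_normal_density_def scaleR_conv_of_real)
  also have "\<dots> = of_real (1 / sqrt (2 * pi)) * (LINT x|lborel. iexp (t * x) * of_real (exp (- x\<^sup>2 / 2)))"
    by (rule integral_mult_right_zero)
  finally show ?e by (simp add: field_simps)
qed

text \<open>Character and Gaussian both factor over the coordinates, and \<open>lborel\<close> is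
  the image of a product measure, so the integral is a product of one-dimensional ones.\<close>

lemma gaussian:
  fixes z :: "real^'n::finite"
  shows "integrable lborel (\<lambda>x. iexp (x \<bullet> z) * of_real (exp (- (norm x)\<^sup>2 / 2)))" (is ?i)
    and "(LINT x|lborel. iexp (x \<bullet> z) * of_real (exp (- (norm x)\<^sup>2 / 2)))
       = of_real ((2 * pi) powr (real CARD('n) / 2) * exp (- (norm z)\<^sup>2 / 2))" (is ?e)
proof -
  let ?h = "\<lambda>b y. iexp ((z \<bullet> b) * y) * of_real (exp (- y\<^sup>2 / 2)) :: complex"
  let ?G = "\<lambda>x::real^'n. iexp (x \<bullet> z) * of_real (exp (- (norm x)\<^sup>2 / 2)) :: complex"
  interpret product_sigma_finite "\<lambda>_::real^'n. lborel :: real measure" ..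
  let ?T = "\<lambda>f. \<Sum>b\<in>Basis. f b *\<^sub>R b :: real^'n"
  have [measurable]: "?G \<in> borel_measurable borel"
    by (intro borel_measurable_continuous_onI continuous_intros) auto
  have norm2: "(norm x)\<^sup>2 = (\<Sum>b\<in>Basis. (x \<bullet> b)\<^sup>2)" for x :: "real^'n"
    unfolding power2_norm_eq_inner by (subst euclidean_inner) (simp add: power2_eq_square)
  have G: "?G x = (\<Prod>b\<in>Basis. ?h b (x \<bullet> b))" for x
  proof -
    have "?G x = exp (\<Sum>b\<in>Basis. \<i> * of_real ((z \<bullet> b) * (x \<bullet> b))) * of_real (exp (\<Sum>b\<in>Basis. - (x \<bullet> b)\<^sup>2 / 2))"
      by (simp add: norm2 euclidean_inner[of x z] sum_distrib_left mult.commute sum_negf sum_divide_distrib)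
    then show ?thesis by (simp add: exp_sum prod.distrib)
  qed
  have T: "?G (?T f) = (\<Prod>b\<in>Basis. ?h b (f b))" for f
    unfolding G by (intro prod.cong refl) (simp add: inner_sum_left inner_Basis if_distrib cong: if_cong)
  have int: "integrable (Pi\<^sub>M Basis (\<lambda>_. lborel)) (\<lambda>f. \<Prod>b\<in>Basis. ?h b (f b))"
    by (intro product_integrable_prod gaussian_1d) auto
  have Tm: "?T \<in> measurable (Pi\<^sub>M Basis (\<lambda>_. lborel)) borel" by measurable
  show ?i
    by (subst lborel_eq, subst integrable_distr_eq[OF Tm]) (simp_all only: T int \<open>?G \<in> borel_measurable borel\<close>)
  have "(LINT x|lborel. ?G x) = (LINT f|Pi\<^sub>M Basis (\<lambda>_. lborel). ?G (?T f))"
    by (subst lborel_eq) (rule integral_distr[OF Tm], measurable)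
  also have "\<dots> = (\<Prod>b\<in>(Basis::(real^'n) set). of_real (sqrt (2 * pi) * exp (- (z \<bullet> b)\<^sup>2 / 2)))"
    unfolding T by (subst product_integral_prod) (rule finite_Basis gaussian_1d(1) | simp only: gaussian_1d(2))+
  also have "\<dots> = of_real ((\<Prod>b\<in>(Basis::(real^'n) set). sqrt (2 * pi)) * exp (\<Sum>b\<in>Basis. - (z \<bullet> b)\<^sup>2 / 2))"
    by (simp only: of_real_prod[symmetric] prod.distrib exp_sum[OF finite_Basis])
  also have "(\<Sum>b\<in>Basis. - (z \<bullet> b)\<^sup>2 / 2) = - (norm z)\<^sup>2 / 2"
    by (simp add: norm2 sum_negf sum_divide_distrib)
  also have "(\<Prod>b\<in>(Basis::(real^'n) set). sqrt (2 * pi)) = (2 * pi) powr (real CARD('n) / 2)"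
    by (simp add: powr_half_sqrt[symmetric] powr_powr flip: powr_realpow)
  finally show ?e .
qed

lemma fourier_factor_mult [simp]:
  "fourier_factor TYPE('n::finite) * of_real ((2 * pi) powr (real CARD('n) / 2)) = 1"
  unfolding fourier_factor_def of_real_mult[symmetric] powr_add[symmetric] by simp

lemma fourier_scaled_gaussian:
  fixes x :: "real^'n::finite"
  assumes "\<epsilon> > 0"
  shows "integrable lborel (\<lambda>\<xi>. iexp (\<xi> \<bullet> x) * of_real (exp (- (norm (\<epsilon> *\<^sub>R \<xi>))\<^sup>2 / 2)))" (is ?i)
    and "fourier (\<lambda>\<xi>. iexp (\<xi> \<bullet> x) * of_real (exp (- (norm (\<epsilon> *\<^sub>R \<xi>))\<^sup>2 / 2))) y
      = of_real ((1 / \<epsilon>) ^ CARD('n) * exp (- (norm ((1 / \<epsilon>) *\<^sub>R (x - y)))\<^sup>2 / 2))" (is ?e)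
proof -
  have "integrable lborel (\<lambda>x::real^'n. of_real (exp (- (norm x)\<^sup>2 / 2)) :: complex)"
    using gaussian(1)[of 0] by simp
  from integrable_lborel_affine[OF this, of \<epsilon> 0] assms
  have "integrable lborel (\<lambda>\<xi>::real^'n. of_real (exp (- (norm (\<epsilon> *\<^sub>R \<xi>))\<^sup>2 / 2)) :: complex)"
    by simp
  then show ?i by (rule integrable_exp_i_mult)
  let ?h = "\<lambda>\<eta>. iexp (\<eta> \<bullet> ((1 / \<epsilon>) *\<^sub>R (x - y))) * of_real (exp (- (norm \<eta>)\<^sup>2 / 2)) :: complex"
  have [measurable]: "?h \<in> borel_measurable borel"
    by (intro borel_measurable_continuous_onI continuous_intros) auto
  have "(LINT \<xi>|lborel. iexp (\<xi> \<bullet> - y) * (iexp (\<xi> \<bullet> x) * of_real (exp (- (norm (\<epsilon> *\<^sub>R \<xi>))\<^sup>2 / 2))))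
    = (LINT \<xi>|lborel. ?h (0 + \<epsilon> *\<^sub>R \<xi>))"
    using assms by (intro Bochner_Integration.integral_cong refl) (simp add: inner_diff_right exp_diff exp_minus field_simps)
  also have "\<dots> = of_real ((1 / \<epsilon>) ^ CARD('n)) * (LINT \<eta>|lborel. ?h \<eta>)"
    using assms integral_lborel_affine[of ?h \<epsilon> 0] by (simp add: scaleR_conv_of_real field_simps)
  also have "(LINT \<eta>|lborel. ?h \<eta>) = of_real ((2 * pi) powr (real CARD('n) / 2) * exp (- (norm ((1 / \<epsilon>) *\<^sub>R (x - y)))\<^sup>2 / 2))"
    by (rule gaussian(2))
  finally have "fourier (\<lambda>\<xi>. iexp (\<xi> \<bullet> x) * of_real (exp (- (norm (\<epsilon> *\<^sub>R \<xi>))\<^sup>2 / 2))) y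
    = (fourier_factor TYPE('n) * of_real ((2 * pi) powr (real CARD('n) / 2))) *
      of_real ((1 / \<epsilon>) ^ CARD('n) * exp (- (norm ((1 / \<epsilon>) *\<^sub>R (x - y)))\<^sup>2 / 2))"
    unfolding fourier_eq of_real_mult by (simp only: mult_ac)
  then show ?e by simp
qed

text \<open>The iterated integral is in general not absolutely convergent as a double integral, so a
  Gaussian damping is inserted. The multiplication formula and the substitution
  \<open>y = x + ?e n *\<^sub>R z\<close> turn it into a Gaussian average of \<open>f\<close> around
  \<open>x\<close>. Both sides then pass to the limit, and the mass of the Gaussian cancels
  \<open>fourier_factor\<close>.\<close>

lemma inverse_fourier_fourier:
  fixes f :: "real^'n::finite \<Rightarrow> complex"
  assumes f: "f \<in> schwartz"
  shows "inverse_fourier (fourier f) = f"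
proof
  fix x :: "real^'n"
  let ?c = "fourier_factor TYPE('n)"
  let ?\<gamma> = "\<lambda>z::real^'n. of_real (exp (- (norm z)\<^sup>2 / 2)) :: complex"
  let ?e = "\<lambda>n. 1 / real (Suc n)"
  let ?b = "\<lambda>n \<xi>. iexp (\<xi> \<bullet> x) * ?\<gamma> (?e n *\<^sub>R \<xi>)"
  note Ff = fourier_schwartz[OF f]
  have [measurable]: "?\<gamma> \<in> borel_measurable borel"
    by (intro borel_measurable_continuous_onI continuous_intros) auto
  note [measurable] = schwartz_borel[OF f] schwartz_borel[OF Ff]
  have eq: "(LINT \<xi>|lborel. fourier f \<xi> * ?b n \<xi>) = (LINT z|lborel. f (x + ?e n *\<^sub>R z) * ?\<gamma> z)" for n
  proof -
    have "(LINT \<xi>|lborel. fourier f \<xi> * ?b n \<xi>) = (LINT y|lborel. f y * fourier (?b n) y)"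
      by (intro fourier_multiplication_formula schwartz_integrable f fourier_scaled_gaussian) simp
    also have "\<dots> = (LINT y|lborel. f y * (of_real ((1 / ?e n) ^ CARD('n)) * ?\<gamma> ((1 / ?e n) *\<^sub>R (x - y))))"
      by (subst fourier_scaled_gaussian(2)) (simp_all only: of_real_mult zero_less_divide_1_iff of_nat_0_less_iff zero_less_Suc)
    also have "\<dots> = ?e n ^ CARD('n) *\<^sub>R (LINT z|lborel. f (x + ?e n *\<^sub>R z) * (of_real ((1 / ?e n) ^ CARD('n)) * ?\<gamma> ((1 / ?e n) *\<^sub>R (x - (x + ?e n *\<^sub>R z)))))"
      by (subst integral_lborel_affine[where a="?e n" and t=x]) auto
    also have "\<dots> = (LINT z|lborel. of_real (?e n ^ CARD('n)) * (f (x + ?e n *\<^sub>R z) * (of_real ((1 / ?e n) ^ CARD('n)) * ?\<gamma> z)))"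
    proof -
      have "norm ((1 / ?e n) *\<^sub>R (x - (x + ?e n *\<^sub>R z))) = norm z" for z :: "real^'n"
        by simp
      then show ?thesis unfolding scaleR_conv_of_real by (simp only: integral_mult_right_zero)
    qed
    also have "\<dots> = (LINT z|lborel. f (x + ?e n *\<^sub>R z) * ?\<gamma> z)"
    proof (intro Bochner_Integration.integral_cong refl)
      fix z
      have "(?e n) ^ CARD('n) * (1 / ?e n) ^ CARD('n) = 1" by (simp add: power_divide)
      then have 1: "of_real (?e n ^ CARD('n)) * of_real ((1 / ?e n) ^ CARD('n)) = (1::complex)"
        by (metis of_real_1 of_real_mult)
      show "of_real (?e n ^ CARD('n)) * (f (x + ?e n *\<^sub>R z) * (of_real ((1 / ?e n) ^ CARD('n)) * ?\<gamma> z)) = f (x + ?e n *\<^sub>R z) * ?\<gamma> z"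
        using arg_cong[OF 1, of "\<lambda>u. u * (f (x + ?e n *\<^sub>R z) * ?\<gamma> z)"] by (simp only: mult_ac mult_1_left)
    qed
    finally show ?thesis .
  qed
  have e0: "?e \<longlonglongrightarrow> 0" using LIMSEQ_Suc[OF lim_1_over_n] .
  have "(\<lambda>n. LINT \<xi>|lborel. fourier f \<xi> * ?b n \<xi>) \<longlonglongrightarrow> (LINT \<xi>|lborel. fourier f \<xi> * iexp (\<xi> \<bullet> x))"
  proof (rule integral_dominated_convergence[where w="\<lambda>\<xi>. cmod (fourier f \<xi>)"])
    show "integrable lborel (\<lambda>\<xi>. cmod (fourier f \<xi>))"
      using schwartz_integrable[OF Ff] by (rule integrable_norm)
    show "AE \<xi> in lborel. (\<lambda>n. fourier f \<xi> * ?b n \<xi>) \<longlonglongrightarrow> fourier f \<xi> * iexp (\<xi> \<bullet> x)"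
    proof (rule AE_I2)
      fix \<xi>
      have "(\<lambda>n. fourier f \<xi> * ?b n \<xi>) \<longlonglongrightarrow> fourier f \<xi> * (iexp (\<xi> \<bullet> x) * ?\<gamma> (0 *\<^sub>R \<xi>))"
        by (intro tendsto_intros e0) auto
      then show "(\<lambda>n. fourier f \<xi> * ?b n \<xi>) \<longlonglongrightarrow> fourier f \<xi> * iexp (\<xi> \<bullet> x)" by simp
    qed
    show "AE \<xi> in lborel. norm (fourier f \<xi> * ?b n \<xi>) \<le> cmod (fourier f \<xi>)" for n
      by (intro AE_I2) (simp add: norm_mult mult_left_le)
  qed measurable
  moreover have "(\<lambda>n. LINT z|lborel. f (x + ?e n *\<^sub>R z) * ?\<gamma> z) \<longlonglongrightarrow> (LINT z|lborel. f x * ?\<gamma> z)"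
  proof -
    obtain C where C: "\<And>x. cmod (f x) \<le> C" using schwartz_decay[OF f, of 0] by auto
    show ?thesis
    proof (rule integral_dominated_convergence[where w="\<lambda>z. C * cmod (?\<gamma> z)"])
      show "integrable lborel (\<lambda>z. C * cmod (?\<gamma> z))"
        using gaussian(1)[of 0] by (intro integrable_mult_right integrable_norm) simp
      show "AE z in lborel. (\<lambda>n. f (x + ?e n *\<^sub>R z) * ?\<gamma> z) \<longlonglongrightarrow> f x * ?\<gamma> z"
      proof (intro AE_I2 tendsto_mult tendsto_const)
        fix z
        have "(\<lambda>n. x + ?e n *\<^sub>R z) \<longlonglongrightarrow> x + 0 *\<^sub>R z" by (intro tendsto_intros e0)
        then show "(\<lambda>n. f (x + ?e n *\<^sub>R z)) \<longlonglongrightarrow> f x"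
          using schwartz_continuous[OF f] by (intro continuous_on_tendsto_compose[of UNIV f]) auto
      qed
      show "AE z in lborel. norm (f (x + ?e n *\<^sub>R z) * ?\<gamma> z) \<le> C * cmod (?\<gamma> z)" for n
        by (intro AE_I2) (simp only: norm_mult, intro mult_right_mono C norm_ge_zero)
    qed measurable
  qed
  ultimately have "(LINT \<xi>|lborel. fourier f \<xi> * iexp (\<xi> \<bullet> x)) = (LINT z|lborel. f x * ?\<gamma> z)"
    unfolding eq by (rule LIMSEQ_unique)
  also have "\<dots> = f x * of_real ((2 * pi) powr (real CARD('n) / 2))"
    using gaussian(2)[of "0 :: real^'n"] by simp
  finally have "inverse_fourier (fourier f) x = f x * (?c * of_real ((2 * pi) powr (real CARD('n) / 2)))"
    unfolding inverse_fourier_eq_fourier fourier_eq by (simp add: mult_ac)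
  then show "inverse_fourier (fourier f) x = f x" by simp
qed

text \<open>Parseval in bilinear form, without complex conjugation. It moves the pairings of the
  lacunary series to the frequency side, where supports can be compared.\<close>

lemma fourier_pairing:
  fixes a b :: "real^'n::finite \<Rightarrow> complex"
  assumes "a \<in> schwartz" "b \<in> schwartz"
  shows "(LINT x|lborel. inverse_fourier a x * fourier b x) = (LINT \<xi>|lborel. a \<xi> * b \<xi>)"
  using inverse_fourier_multiplication_formula[OF schwartz_integrable[OF assms(1)] schwartz_integrable[OF fourier_schwartz[OF assms(2)]]]
  by (simp add: inverse_fourier_fourier[OF assms(2)])

section \<open>Tempered distributions\<close>

lemma schwartz_zero: "(\<lambda>_. 0) \<in> schwartz"
  by (rule schwartz_coinduct[of _ "{\<lambda>_. 0}"]) (auto simp: partial_const)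

lemma partials_add:
  assumes "f \<in> schwartz" "g \<in> schwartz"
  shows "partials js (\<lambda>x. f x + g x) = (\<lambda>x. partials js f x + partials js g x)"
  using assms
  by (induction js) (auto simp: partial_add schwartz_differentiable schwartz_partials)

lemma partials_cmult:
  assumes "f \<in> schwartz"
  shows "partials js (\<lambda>x. c * f x) = (\<lambda>x. c * partials js f x)"
  using assms
  by (induction js) (auto simp: partial_cmult schwartz_differentiable schwartz_partials)

lemma partials_diff:
  assumes "f \<in> schwartz" "g \<in> schwartz"
  shows "partials js (\<lambda>x. f x - g x) = (\<lambda>x. partials js f x - partials js g x)"
  using partials_add[OF assms(1) schwartz_cmult[OF assms(2), of "-1"], of js]
    partials_cmult[OF assms(2), of js "-1"] by simp

lemma schwartz_translate:
  assumes "f \<in> schwartz"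
  shows "(\<lambda>x. f (x - y)) \<in> schwartz"
  using schwartz_affine_comp[OF assms, of 1 "- y"] by simp

lemma partials_translate:
  assumes "f \<in> schwartz"
  shows "partials js (\<lambda>x. f (x - y)) = (\<lambda>x. partials js f (x - y))"
proof (induction js)
  case (Cons i js)
  have "partial i (\<lambda>x. partials js f (x - y)) x = partial i (partials js f) (x - y)" for x
    using partial_affine_comp[of "partials js f" 1 x "- y" i] schwartz_differentiable[OF schwartz_partials[OF assms]]
    by simp
  then show ?case using Cons by auto
qed simp

lemma schwartz_sum:
  assumes "finite V" "\<And>v. v \<in> V \<Longrightarrow> f v \<in> schwartz"
  shows "(\<lambda>x. \<Sum>v\<in>V. a v * f v x) \<in> schwartz"
  using assms by (induction V) (auto simp: schwartz_zero intro!: schwartz_add schwartz_cmult)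

lemma partials_sum:
  assumes "finite V" "\<And>v. v \<in> V \<Longrightarrow> f v \<in> schwartz"
  shows "partials js (\<lambda>x. \<Sum>v\<in>V. a v * f v x) = (\<lambda>x. \<Sum>v\<in>V. a v * partials js (f v) x)"
  using assms
proof (induction V)
  case empty
  show ?case by (induction js) (auto simp: partial_const)
next
  case (insert v V)
  then show ?case
    by (simp add: partials_add schwartz_sum schwartz_cmult partials_cmult)
qed

lemma linear_functional_sum:
  assumes "linear_functional_on schwartz h" "finite V" "\<And>v. v \<in> V \<Longrightarrow> f v \<in> schwartz"
  shows "h (\<lambda>x. \<Sum>v\<in>V. a v * f v x) = (\<Sum>v\<in>V. a v * h (f v))"
  using assms(2,3)
proof (induction V)
  case empty
  have "h (\<lambda>x. 0 * 0 + 0 * 0) = 0 * h (\<lambda>_. 0) + 0 * h (\<lambda>_. 0)"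
    using assms(1)[unfolded linear_functional_on_def, rule_format, OF schwartz_zero schwartz_zero, of 0 0] by simp
  then show ?case by simp
next
  case (insert v V)
  have "h (\<lambda>x. a v * f v x + 1 * (\<Sum>v\<in>V. a v * f v x)) = a v * h (f v) + 1 * h (\<lambda>x. \<Sum>v\<in>V. a v * f v x)"
    using assms(1)[unfolded linear_functional_on_def, rule_format, of "f v" "\<lambda>x. \<Sum>v\<in>V. a v * f v x" "a v" 1]
      insert.prems schwartz_sum[OF insert.hyps(1), of f a] by simp
  then show ?case using insert by simp
qed

lemma linear_functional_diff:
  assumes "linear_functional_on D h" "f \<in> D" "g \<in> D"
  shows "h (\<lambda>x. f x - g x) = h f - h g"
proof -
  have "h (\<lambda>x. 1 * f x + (-1) * g x) = 1 * h f + (-1) * h g"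
    using assms unfolding linear_functional_on_def by blast
  then show ?thesis by simp
qed

text \<open>\<open>seminorm\<close> is a supremum of reals and says something only for a bounded
  set; the hypothesis supplies the bound.\<close>

lemma seminorm_le:
  fixes f :: "real^'n::finite \<Rightarrow> complex"
  assumes "\<And>x js. length js \<le> N \<Longrightarrow> (1 + norm x) ^ m * cmod (partials js f x) \<le> b"
  shows "seminorm m N f \<le> b" and "0 \<le> seminorm m N f"
proof -
  show "seminorm m N f \<le> b" unfolding seminorm_def
    by (rule cSUP_least) (use assms in \<open>auto intro!: exI[of _ "[]"]\<close>)
  have "(1 + norm (0::real^'n)) ^ m * cmod (partials [] f 0) \<le> seminorm m N f"
    unfolding seminorm_def
    using cSUP_upper[of "(0, [])" "UNIV \<times> {js. length js \<le> N}" "\<lambda>(x, js). (1 + norm x) ^ m * cmod (partials js f x)"]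
      bdd_aboveI2[of "UNIV \<times> {js. length js \<le> N}" "\<lambda>(x, js). (1 + norm x) ^ m * cmod (partials js f x)" b]
      assms by auto
  then show "0 \<le> seminorm m N f" by (rule order_trans[rotated]) simp
qed

text \<open>Continuity in a usable form: any common bound \<open>b\<close> stands in for the
  supremum. Passing to \<open>|C| + 1\<close> makes the constant positive.\<close>

lemma tempered_bound:
  assumes "h \<in> tempered_distributions"
  obtains C N where "C > 0" "\<And>f b. f \<in> schwartz \<Longrightarrow>
    (\<And>x js. length js \<le> N \<Longrightarrow> (1 + norm x) ^ N * cmod (partials js f x) \<le> b) \<Longrightarrow> cmod (h f) \<le> C * b"
proof -
  obtain C N where C: "\<And>f. f \<in> schwartz \<Longrightarrow> cmod (h f) \<le> C * seminorm N N f"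
    using assms unfolding tempered_distributions_def by blast
  show thesis
  proof (rule that[of "\<bar>C\<bar> + 1" N])
    fix f :: "real^'a \<Rightarrow> complex" and b
    assume f: "f \<in> schwartz"
      "\<And>x js. length js \<le> N \<Longrightarrow> (1 + norm x) ^ N * cmod (partials js f x) \<le> b"
    have "cmod (h f) \<le> C * seminorm N N f" by (rule C[OF f(1)])
    also have "\<dots> \<le> (\<bar>C\<bar> + 1) * b"
      using seminorm_le[of N N f b, OF f(2)] by (intro mult_mono) auto
    finally show "cmod (h f) \<le> (\<bar>C\<bar> + 1) * b" .
  qed simp
qed

lemma tempered_linear: "h \<in> tempered_distributions \<Longrightarrow> linear_functional_on schwartz h"
  by (simp add: tempered_distributions_def)

lemma schwartz_partials_lipschitz:
  fixes f :: "real^'n::finite \<Rightarrow> complex"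
  assumes "f \<in> schwartz"
  obtains L where "L > 0" "\<And>js x y y'. length js \<le> N \<Longrightarrow>
    (1 + norm x) ^ N * cmod (partials js f (x - y) - partials js f (x - y'))
      \<le> L * norm (y - y') * (1 + norm y + norm y') ^ N"
proof -
  have "\<forall>js. \<exists>L. L > 0 \<and> (\<forall>x y y'. (1 + norm x) ^ N * cmod (partials js f (x - y) - partials js f (x - y'))
      \<le> L * norm (y - y') * (1 + norm y + norm y') ^ N)"
  proof
    fix js :: "'n list"
    obtain L where "L > 0" "\<And>x y y'. (1 + norm x) ^ N * cmod (partials js f (x - y) - partials js f (x - y'))
      \<le> L * norm (y - y') * (1 + norm y + norm y') ^ N"
      using schwartz_lipschitz[OF schwartz_partials[OF assms, of js], of N] by blast
    then show "\<exists>L. L > 0 \<and> (\<forall>x y y'. (1 + norm x) ^ N * cmod (partials js f (x - y) - partials js f (x - y'))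
      \<le> L * norm (y - y') * (1 + norm y + norm y') ^ N)" by blast
  qed
  from choice[OF this] obtain L where L: "\<And>js. L js > 0"
    "\<And>js x y y'. (1 + norm x) ^ N * cmod (partials js f (x - y) - partials js f (x - y'))
      \<le> L js * norm (y - y') * (1 + norm y + norm y') ^ N" by blast
  let ?J = "{js::'n list. length js \<le> N}"
  have fin: "finite ?J" using finite_lists_length_le[of "UNIV :: 'n set" N] by simp
  show thesis
  proof (rule that[of "sum L ?J"])
    show "sum L ?J > 0" using L(1) fin by (intro sum_pos) (auto intro: exI[of _ "[]"])
    fix js :: "'n list" and x y y' :: "real^'n"
    assume "length js \<le> N"
    then have "L js \<le> sum L ?J" using fin L(1) by (intro member_le_sum) (auto intro: less_imp_le)
    then have "L js * (norm (y - y') * (1 + norm y + norm y') ^ N) \<le> sum L ?J * (norm (y - y') * (1 + norm y + norm y') ^ N)"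
      by (intro mult_right_mono) auto
    then show "(1 + norm x) ^ N * cmod (partials js f (x - y) - partials js f (x - y'))
      \<le> sum L ?J * norm (y - y') * (1 + norm y + norm y') ^ N"
      using L(2)[of x js y y'] by (simp add: mult.assoc)
  qed
qed

lemma schwartz_monomial:
  assumes "f \<in> schwartz"
  shows "foldr (\<lambda>i f x. - \<i> * of_real (x $ i) * f x) js f \<in> schwartz"
  by (induction js) (auto intro: assms schwartz_coord[of _ "- \<i>", simplified])

lemma partials_fourier:
  assumes "f \<in> schwartz"
  shows "partials js (fourier f) = fourier (foldr (\<lambda>i f x. - \<i> * of_real (x $ i) * f x) js f)"
proof (induction js)
  case (Cons i js)
  then show ?case using partial_fourier[OF schwartz_monomial[OF assms, of js], of i] by simp
qed simp

text \<open>Under the transform a partial derivative is a factor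
  \<open>- \<i> * of_real (x $ i)\<close>. These factors may be attached to \<open>k\<close> alone,
  so the convolution formula applies again and all derivatives land on
  \<open>fourier k\<close>.\<close>

lemma partials_fourier_mult_inverse_fourier:
  fixes k w :: "real^'n::finite \<Rightarrow> complex"
  assumes k: "k \<in> schwartz" and w: "w \<in> schwartz"
  shows "partials js (fourier (\<lambda>\<xi>. k \<xi> * inverse_fourier w \<xi>)) x =
    (LINT y|lborel. w y * partials js (\<lambda>z. fourier_factor TYPE('n) * fourier k z) (x - y))"
proof -
  let ?M = "\<lambda>js. foldr (\<lambda>i f x. - \<i> * of_real (x $ i) * f x) js :: (real^'n \<Rightarrow> complex) \<Rightarrow> _"
  have kw: "(\<lambda>\<xi>. k \<xi> * inverse_fourier w \<xi>) \<in> schwartz"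
    by (intro schwartz_mult schwartz_slowly_increasing k inverse_fourier_schwartz w)
  have "?M js (\<lambda>\<xi>. k \<xi> * inverse_fourier w \<xi>) = (\<lambda>\<xi>. ?M js k \<xi> * inverse_fourier w \<xi>)"
    by (induction js) auto
  then show ?thesis
    using fourier_mult_inverse_fourier[OF schwartz_integrable[OF schwartz_monomial[OF k, of js]] schwartz_integrable[OF w], of x]
    by (simp add: partials_fourier kw k partials_cmult fourier_schwartz)
qed

lemma integral_simple_function_comp:
  fixes w G :: "real^'n::finite \<Rightarrow> complex"
  assumes \<sigma>: "simple_function lborel \<sigma>" and w: "integrable lborel w"
  shows "(LINT y|lborel. w y * G (\<sigma> y)) =
    (\<Sum>v\<in>range \<sigma>. (LINT y|lborel. w y * indicator (\<sigma> -` {v}) y) * G v)"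
proof -
  have fin: "finite (range \<sigma>)" using simple_functionD(1)[OF \<sigma>] by simp
  have meas: "\<sigma> -` {v} \<in> sets lborel" for v using simple_functionD(2)[OF \<sigma>, of "{v}"] by simp
  have int: "integrable lborel (\<lambda>y. w y * indicator (\<sigma> -` {v}) y)" for v
    using integrable_mult_indicator[OF meas w, of v] by (simp add: scaleR_conv_of_real mult.commute of_real_indicator)
  have "(LINT y|lborel. w y * G (\<sigma> y)) = (LINT y|lborel. (\<Sum>v\<in>range \<sigma>. (w y * indicator (\<sigma> -` {v}) y) * G v))"
  proof (intro Bochner_Integration.integral_cong refl)
    fix y :: "real^'n"
    have "(\<Sum>v\<in>range \<sigma>. (w y * indicator (\<sigma> -` {v}) y) * G v) = (\<Sum>v\<in>range \<sigma>. if v = \<sigma> y then w y * G v else 0)"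
      by (intro sum.cong) (auto simp: indicator_def)
    then show "w y * G (\<sigma> y) = (\<Sum>v\<in>range \<sigma>. (w y * indicator (\<sigma> -` {v}) y) * G v)"
      using fin by simp
  qed
  also have "\<dots> = (\<Sum>v\<in>range \<sigma>. (LINT y|lborel. w y * indicator (\<sigma> -` {v}) y) * G v)"
    by (subst Bochner_Integration.integral_sum) (auto intro: int)
  finally show ?thesis .
qed

text \<open>The Fourier side of \<open>h (\<Phi> * w) = \<integral> w(y) h (\<Phi> (\<cdot> - y)) dy\<close>.  The integral is interchanged with \<open>h\<close> by
  replacing \<open>y\<close> with simple functions \<open>\<sigma> n y \<longlonglongrightarrow> y\<close>, for which it becomes a finite sum.\<close>

lemma tempered_convolution:
  fixes h :: "(real^'n::finite \<Rightarrow> complex) \<Rightarrow> complex"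
  assumes h: "h \<in> tempered_distributions" and k: "k \<in> schwartz"
  defines "H \<equiv> \<lambda>y. h (\<lambda>x. fourier_factor TYPE('n) * fourier k (x - y))"
  shows "continuous_on UNIV H"
    and "w \<in> schwartz \<Longrightarrow> integrable lborel (\<lambda>y. H y * w y)"
    and "w \<in> schwartz \<Longrightarrow> h (fourier (\<lambda>\<xi>. k \<xi> * inverse_fourier w \<xi>)) = (LINT y|lborel. H y * w y)"
proof -
  define \<Phi> where "\<Phi> = (\<lambda>z. fourier_factor TYPE('n) * fourier k z)"
  have \<Phi>: "\<Phi> \<in> schwartz" unfolding \<Phi>_def by (intro schwartz_cmult fourier_schwartz k)
  have H: "H y = h (\<lambda>x. \<Phi> (x - y))" for y by (simp add: H_def \<Phi>_def)
  note lin = tempered_linear[OF h]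
  obtain C N where C: "C > 0" "\<And>f b. f \<in> schwartz \<Longrightarrow>
      (\<And>x js. length js \<le> N \<Longrightarrow> (1 + norm x) ^ N * cmod (partials js f x) \<le> b) \<Longrightarrow> cmod (h f) \<le> C * b"
    using tempered_bound[OF h] by blast
  obtain L where L: "L > 0" "\<And>js x y y'. length js \<le> N \<Longrightarrow>
      (1 + norm x) ^ N * cmod (partials js \<Phi> (x - y) - partials js \<Phi> (x - y')) \<le> L * norm (y - y') * (1 + norm y + norm y') ^ N"
    using schwartz_partials_lipschitz[OF \<Phi>] by blast
  \<comment> \<open>Both the continuity and the polynomial growth of \<open>H\<close> follow from
    this estimate; the growth exponent is \<open>N + 1\<close> because the factor
    \<open>norm (y - y')\<close> adds a power.\<close>
  have lip: "cmod (H y - H y') \<le> C * L * norm (y - y') * (1 + norm y + norm y') ^ N" for y y'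
  proof -
    have "H y - H y' = h (\<lambda>x. \<Phi> (x - y) - \<Phi> (x - y'))"
      unfolding H using linear_functional_diff[OF lin schwartz_translate[OF \<Phi>, of y] schwartz_translate[OF \<Phi>, of y']] by simp
    also have "cmod \<dots> \<le> C * (L * norm (y - y') * (1 + norm y + norm y') ^ N)"
      by (intro C(2) schwartz_diff schwartz_translate \<Phi>)
        (simp add: partials_diff schwartz_translate \<Phi> partials_translate L(2))
    finally show ?thesis by (simp add: mult.assoc)
  qed
  show cont: "continuous_on UNIV H"
  proof (rule continuous_at_imp_continuous_on, rule ballI)
    fix y :: "real^'n"
    have "(\<lambda>y'. C * L * norm (y' - y) * (1 + norm y' + norm y) ^ N) \<midarrow>y\<rightarrow> C * L * norm (y - y) * (1 + norm y + norm y) ^ N"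
      by (intro tendsto_intros)
    then have "(\<lambda>y'. C * L * norm (y' - y) * (1 + norm y' + norm y) ^ N) \<midarrow>y\<rightarrow> 0" by simp
    then have "(\<lambda>y'. H y' - H y) \<midarrow>y\<rightarrow> 0"
      by (rule Lim_null_comparison[rotated]) (use lip in auto)
    then show "isCont H y" unfolding isCont_def by (rule LIM_zero_cancel)
  qed
  then have [measurable]: "H \<in> borel_measurable borel" by (rule borel_measurable_continuous_onI)
  define K where "K = cmod (H 0) + C * L"
  have K: "K \<ge> 0" unfolding K_def using C L by simp
  have growth: "cmod (H y) \<le> K * (1 + norm y) ^ (N + 1)" for y
  proof -
    have "cmod (H y) \<le> cmod (H 0) + cmod (H y - H 0)" by (metis add.commute norm_triangle_sub)
    also have "cmod (H y - H 0) \<le> C * L * (norm y * (1 + norm y) ^ N)" using lip[of y 0] by (simp add: mult.assoc)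
    also have "\<dots> \<le> C * L * (1 + norm y) ^ (N + 1)"
      using C L by (intro mult_left_mono) (auto intro!: mult_right_mono)
    also have "cmod (H 0) \<le> cmod (H 0) * (1 + norm y) ^ (N + 1)"
      using mult_left_mono[OF one_le_power[of "1 + norm y" "N + 1"], of "cmod (H 0)"] by simp
    finally show ?thesis unfolding K_def by (simp add: distrib_right)
  qed
  assume w: "w \<in> schwartz"
  note [measurable] = schwartz_borel[OF w]
  note wint = schwartz_integrable[OF w]
  have wK: "integrable lborel (\<lambda>y. K' * ((1 + norm y) ^ M * cmod (w y)))" for K' M
    by (intro integrable_mult_right schwartz_weight_integrable w)
  show "integrable lborel (\<lambda>y. H y * w y)"
  proof (rule Bochner_Integration.integrable_bound[OF wK[of K "N + 1"]])
    show "AE y in lborel. norm (H y * w y) \<le> norm (K * ((1 + norm y) ^ (N + 1) * cmod (w y)))"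
    proof (rule AE_I2)
      fix y :: "real^'n"
      have "norm (H y * w y) \<le> (K * (1 + norm y) ^ (N + 1)) * cmod (w y)"
        unfolding norm_mult by (intro mult_right_mono growth) auto
      then show "norm (H y * w y) \<le> norm (K * ((1 + norm y) ^ (N + 1) * cmod (w y)))"
        unfolding real_norm_def mult.assoc by (rule order_trans[OF _ abs_ge_self])
    qed
  qed measurable
  \<comment> \<open>Simple approximations of the identity map. The base point 0 yields
    \<open>norm (\<sigma> n y) <= 2 * norm y\<close>, which gives majorants independent of
    \<open>n\<close>.\<close>
  obtain \<sigma> :: "nat \<Rightarrow> real^'n \<Rightarrow> real^'n" where \<sigma>: "\<And>n. simple_function lborel (\<sigma> n)"
    "\<And>y. (\<lambda>n. \<sigma> n y) \<longlonglongrightarrow> y" "\<And>n y. norm (\<sigma> n y) \<le> 2 * norm y"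
  proof -
    have "(\<lambda>y::real^'n. y) \<in> borel_measurable lborel" by simp
    from borel_measurable_implies_sequence_metric[OF this, of 0] that show ?thesis
      by (auto simp: space_lborel)
  qed
  have [measurable]: "\<sigma> n \<in> borel_measurable borel" for n
    using borel_measurable_simple_function[OF \<sigma>(1), of n] by simp
  have fin: "finite (range (\<sigma> n))" for n using simple_functionD(1)[OF \<sigma>(1), of n] by simp
  define a where "a n v = (LINT y|lborel. w y * indicator (\<sigma> n -` {v}) y)" for n v
  define S where "S n x = (\<Sum>v\<in>range (\<sigma> n). a n v * \<Phi> (x - v))" for n x
  have simple: "(LINT y|lborel. w y * G (\<sigma> n y)) = (\<Sum>v\<in>range (\<sigma> n). a n v * G v)" for G n
    unfolding a_def by (rule integral_simple_function_comp[OF \<sigma>(1) wint])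
  have S: "S n \<in> schwartz" for n unfolding S_def by (intro schwartz_sum fin schwartz_translate \<Phi>)
  have hS: "h (S n) = (LINT y|lborel. w y * H (\<sigma> n y))" for n
    unfolding simple[of H n] unfolding H S_def by (intro linear_functional_sum lin fin schwartz_translate \<Phi>)
  have pS: "partials js (S n) x = (LINT y|lborel. w y * partials js \<Phi> (x - \<sigma> n y))" for js n x
    unfolding simple[of "\<lambda>v. partials js \<Phi> (x - v)" n] S_def by (simp add: partials_sum fin schwartz_translate \<Phi> partials_translate)
  define W where "W = fourier (\<lambda>\<xi>. k \<xi> * inverse_fourier w \<xi>)"
  have W: "W \<in> schwartz" unfolding W_def
    by (intro fourier_schwartz schwartz_mult schwartz_slowly_increasing k inverse_fourier_schwartz w)
  have pW: "partials js W x = (LINT y|lborel. w y * partials js \<Phi> (x - y))" for js x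
    unfolding W_def \<Phi>_def by (rule partials_fourier_mult_inverse_fourier[OF k w])
  \<comment> \<open>\<open>?g n y\<close> bounds, uniformly in \<open>x\<close>, the weighted
    difference between the integrands of \<open>W\<close> and \<open>S n\<close> together with their
    derivatives up to order \<open>N\<close>. Its integral therefore bounds every quantity that
    enters the continuity of \<open>h\<close>.\<close>
  let ?g = "\<lambda>n y. cmod (w y) * (L * norm (y - \<sigma> n y) * (1 + norm y + norm (\<sigma> n y)) ^ N)"
  have gbound: "?g n y \<le> (3 ^ (N + 1) * L) * ((1 + norm y) ^ (N + 1) * cmod (w y))" for n y
  proof -
    have "norm (y - \<sigma> n y) \<le> norm y + norm (\<sigma> n y)" by (rule norm_triangle_ineq4)
    then have "norm (y - \<sigma> n y) \<le> 3 * (1 + norm y)" using \<sigma>(3)[of n y] by simp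
    moreover have "(1 + norm y + norm (\<sigma> n y)) ^ N \<le> (3 * (1 + norm y)) ^ N"
      using \<sigma>(3)[of n y] by (intro power_mono) auto
    ultimately have "?g n y \<le> cmod (w y) * (L * (3 * (1 + norm y)) * (3 * (1 + norm y)) ^ N)"
      using L(1) by (intro mult_left_mono mult_mono) auto
    also have "\<dots> = (3 ^ (N + 1) * L) * ((1 + norm y) ^ (N + 1) * cmod (w y))"
      unfolding power_mult_distrib power_add power_one_right by (simp only: mult_ac)
    finally show ?thesis .
  qed
  have gnn: "0 \<le> ?g n y" for n y using L(1) by simp
  have gint: "integrable lborel (?g n)" for n
    by (rule Bochner_Integration.integrable_bound[OF wK[of "3 ^ (N + 1) * L" "N + 1"]])
      (measurable, use gbound gnn in \<open>auto intro!: AE_I2 simp: abs_of_nonneg simp del: power_Suc intro: order_trans[OF _ abs_ge_self]\<close>)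
  have g0: "(\<lambda>n. LINT y|lborel. ?g n y) \<longlonglongrightarrow> (LINT y|(lborel :: (real^'n) measure). 0 :: real)"
  proof (rule integral_dominated_convergence[where w="\<lambda>y. (3 ^ (N + 1) * L) * ((1 + norm y) ^ (N + 1) * cmod (w y))"])
    show "integrable lborel (\<lambda>y. (3 ^ (N + 1) * L) * ((1 + norm y) ^ (N + 1) * cmod (w y)))" by (rule wK)
    show "AE y in lborel. (\<lambda>n. ?g n y) \<longlonglongrightarrow> 0"
    proof (rule AE_I2)
      fix y :: "real^'n"
      have "(\<lambda>n. ?g n y) \<longlonglongrightarrow> cmod (w y) * (L * norm (y - y) * (1 + norm y + norm y) ^ N)"
        by (intro tendsto_intros \<sigma>(2))
      then show "(\<lambda>n. ?g n y) \<longlonglongrightarrow> 0" by simp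
    qed
    show "AE y in lborel. norm (?g n y) \<le> (3 ^ (N + 1) * L) * ((1 + norm y) ^ (N + 1) * cmod (w y))" for n
      using gbound gnn by (intro AE_I2) (simp only: real_norm_def abs_of_nonneg)
  qed measurable
  have diff: "cmod (h W - h (S n)) \<le> C * (LINT y|lborel. ?g n y)" for n
  proof -
    have "h W - h (S n) = h (\<lambda>x. W x - S n x)"
      by (rule linear_functional_diff[OF lin W S, symmetric])
    also have "cmod \<dots> \<le> C * (LINT y|lborel. ?g n y)"
    proof (intro C(2) schwartz_diff W S)
      fix x :: "real^'n" and js assume js: "length (js :: 'n list) \<le> N"
      note pc = schwartz_borel[OF schwartz_partials[OF \<Phi>, of js]]
      obtain B where B: "\<And>x. cmod (partials js \<Phi> x) \<le> B"
        using schwartz_decay[OF schwartz_partials[OF \<Phi>, of js], of 0] by auto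
      have intB: "integrable lborel (\<lambda>y. w y * partials js \<Phi> (x - \<tau> y))"
        if [measurable]: "\<tau> \<in> borel_measurable borel" for \<tau>
      proof (rule Bochner_Integration.integrable_bound)
        show "integrable lborel (\<lambda>y. B * cmod (w y))" using wint by (intro integrable_mult_right integrable_norm)
        note [measurable] = pc
        show "(\<lambda>y. w y * partials js \<Phi> (x - \<tau> y)) \<in> borel_measurable lborel" by measurable
        show "AE y in lborel. norm (w y * partials js \<Phi> (x - \<tau> y)) \<le> norm (B * cmod (w y))"
          unfolding norm_mult real_norm_def abs_mult mult.commute[of "cmod (w _)"]
          by (intro AE_I2 mult_mono order_trans[OF B abs_ge_self]) auto
      qed
      have "partials js (\<lambda>x. W x - S n x) x =
          (LINT y|lborel. w y * (partials js \<Phi> (x - y) - partials js \<Phi> (x - \<sigma> n y)))"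
        unfolding partials_diff[OF W S] pW pS right_diff_distrib
        by (rule Bochner_Integration.integral_diff[symmetric]) (rule intB, measurable)+
      then have "(1 + norm x) ^ N * cmod (partials js (\<lambda>x. W x - S n x) x) =
          cmod (LINT y|lborel. of_real ((1 + norm x) ^ N) * (w y * (partials js \<Phi> (x - y) - partials js \<Phi> (x - \<sigma> n y))))"
        unfolding integral_mult_right_zero by (simp add: norm_mult del: of_real_power of_real_add)
      also have "\<dots> \<le> (LINT y|lborel. ?g n y)"
      proof (rule Bochner_Integration.integral_norm_bound_integral[OF _ gint])
        show "integrable lborel (\<lambda>y. of_real ((1 + norm x) ^ N) * (w y * (partials js \<Phi> (x - y) - partials js \<Phi> (x - \<sigma> n y))))"
          unfolding right_diff_distrib
          by (intro integrable_mult_right Bochner_Integration.integrable_diff intB) measurable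
        fix y :: "real^'n"
        have "cmod (of_real ((1 + norm x) ^ N) * (w y * (partials js \<Phi> (x - y) - partials js \<Phi> (x - \<sigma> n y))))
          = cmod (w y) * ((1 + norm x) ^ N * cmod (partials js \<Phi> (x - y) - partials js \<Phi> (x - \<sigma> n y)))"
          by (simp add: norm_mult del: of_real_power of_real_add)
        also have "\<dots> \<le> ?g n y" by (intro mult_left_mono L(2) js) auto
        finally show "cmod (of_real ((1 + norm x) ^ N) * (w y * (partials js \<Phi> (x - y) - partials js \<Phi> (x - \<sigma> n y)))) \<le> ?g n y" .
      qed
      finally show "(1 + norm x) ^ N * cmod (partials js (\<lambda>x. W x - S n x) x) \<le> (LINT y|lborel. ?g n y)" .
    qed
    finally show ?thesis .
  qed
  have "(\<lambda>n. h W - h (S n)) \<longlonglongrightarrow> 0"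
  proof (rule Lim_null_comparison)
    show "\<forall>\<^sub>F n in sequentially. norm (h W - h (S n)) \<le> C * (LINT y|lborel. ?g n y)" using diff by simp
    show "(\<lambda>n. C * (LINT y|lborel. ?g n y)) \<longlonglongrightarrow> 0"
      using tendsto_mult_right_zero[of _ _ C] g0 by simp
  qed
  then have 1: "(\<lambda>n. h (S n)) \<longlonglongrightarrow> h W"
    using LIM_zero_cancel[of "\<lambda>n. h (S n)" "h W" sequentially] tendsto_minus[of "\<lambda>n. h W - h (S n)" 0 sequentially] by simp
  have "(\<lambda>n. LINT y|lborel. w y * H (\<sigma> n y)) \<longlonglongrightarrow> (LINT y|lborel. w y * H y)"
  proof (rule integral_dominated_convergence[where w="\<lambda>y. (2 ^ (N + 1) * K) * ((1 + norm y) ^ (N + 1) * cmod (w y))"])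
    show "integrable lborel (\<lambda>y. (2 ^ (N + 1) * K) * ((1 + norm y) ^ (N + 1) * cmod (w y)))" by (rule wK)
    show "AE y in lborel. (\<lambda>n. w y * H (\<sigma> n y)) \<longlonglongrightarrow> w y * H y"
      by (intro AE_I2 tendsto_mult tendsto_const continuous_on_tendsto_compose[OF cont \<sigma>(2)]) auto
    show "AE y in lborel. norm (w y * H (\<sigma> n y)) \<le> (2 ^ (N + 1) * K) * ((1 + norm y) ^ (N + 1) * cmod (w y))" for n
    proof (rule AE_I2)
      fix y :: "real^'n"
      have "cmod (H (\<sigma> n y)) \<le> K * (1 + norm (\<sigma> n y)) ^ (N + 1)" by (rule growth)
      also have "\<dots> \<le> K * (2 * (1 + norm y)) ^ (N + 1)"
        using K \<sigma>(3)[of n y] by (intro mult_left_mono power_mono) auto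
      finally have "cmod (w y) * cmod (H (\<sigma> n y)) \<le> cmod (w y) * (K * (2 * (1 + norm y)) ^ (N + 1))"
        by (intro mult_left_mono) auto
      then show "norm (w y * H (\<sigma> n y)) \<le> (2 ^ (N + 1) * K) * ((1 + norm y) ^ (N + 1) * cmod (w y))"
        by (simp only: norm_mult power_mult_distrib mult_ac)
    qed
  qed measurable
  then have 2: "(\<lambda>n. h (S n)) \<longlonglongrightarrow> (LINT y|lborel. w y * H y)" by (simp only: hS)
  show "h (fourier (\<lambda>\<xi>. k \<xi> * inverse_fourier w \<xi>)) = (LINT y|lborel. H y * w y)"
    using LIMSEQ_unique[OF 1 2] by (simp add: W_def mult.commute)
qed

section \<open>Littlewood-Paley pieces\<close>

lemma partial_zero_outside:
  fixes f :: "real^'n::finite \<Rightarrow> complex"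
  assumes "open U" "\<And>x. x \<in> U \<Longrightarrow> f x = 0" "x \<in> U"
  shows "partial i f x = 0"
proof -
  have "(f has_derivative (\<lambda>_. 0)) (at x)"
    by (rule has_derivative_transform_within_open[OF has_derivative_const[of 0] assms(1,3)])
      (simp add: assms(2))
  from partial_eqI[OF this] show ?thesis .
qed

lemma compact_support_schwartz:
  fixes f :: "real^'n::finite \<Rightarrow> complex"
  assumes "smooth_on UNIV f" "compact K" "\<And>x. x \<notin> K \<Longrightarrow> f x = 0"
  shows "f \<in> schwartz"
proof (rule schwartz_coinduct)
  let ?A = "{f :: real^'n \<Rightarrow> complex. smooth_on UNIV f \<and> (\<forall>x. x \<notin> K \<longrightarrow> f x = 0)}"
  show "f \<in> ?A" using assms by simp
  show diff: "f differentiable (at x)" if "f \<in> ?A" for f x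
    using that by (auto simp: smooth_on_def dest: spec[of _ "[]"])
  show "partial i f \<in> ?A" if f: "f \<in> ?A" for f i
  proof -
    have "partials js (partial i f) = partials (js @ [i]) f" for js by (simp add: partials_append)
    then have "smooth_on UNIV (partial i f)" using f unfolding smooth_on_def by simp
    moreover have "partial i f x = 0" if "x \<notin> K" for x
      using partial_zero_outside[of "- K" f x i] f that compact_imp_closed[OF assms(2)] by auto
    ultimately show ?thesis by simp
  qed
  show "\<exists>C. \<forall>x. (1 + norm x) ^ N * cmod (f x) \<le> C" if f: "f \<in> ?A" for f N
  proof -
    have "continuous_on K f"
      by (intro continuous_at_imp_continuous_on ballI differentiable_imp_continuous_within diff f)
    then have "compact ((\<lambda>x. (1 + norm x) ^ N * cmod (f x)) ` K)"
      by (intro compact_continuous_image continuous_intros assms(2))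
    then have "bounded ((\<lambda>x. (1 + norm x) ^ N * cmod (f x)) ` K)" by (rule compact_imp_bounded)
    then obtain C where C: "\<And>x. x \<in> K \<Longrightarrow> norm ((1 + norm x) ^ N * cmod (f x)) \<le> C"
      by (auto simp: bounded_iff)
    have "(1 + norm x) ^ N * cmod (f x) \<le> max C 0" for x
    proof (cases "x \<in> K")
      case True
      then show ?thesis using C[OF True] by simp
    next
      case False
      then show ?thesis using f by simp
    qed
    then show ?thesis by blast
  qed
qed

lemma test_functions_subset_schwartz: "test_functions \<Omega> \<subseteq> schwartz"
  using compact_support_schwartz unfolding test_functions_def by blast

lemma resolution_generator_schwartz:
  assumes "resolution_generator \<phi>0"
  shows "(\<lambda>x::real^'n::finite. of_real (\<phi>0 x) :: complex) \<in> schwartz"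
  by (rule compact_support_schwartz[of _ "cball 0 (3 / 2)"])
    (use assms in \<open>auto simp: resolution_generator_def\<close>)

lemma resolution_schwartz:
  assumes "resolution_generator \<phi>0"
  shows "(\<lambda>x::real^'n::finite. of_real (resolution \<phi>0 k x) :: complex) \<in> schwartz"
proof (cases "k = 0")
  case True
  then show ?thesis using resolution_generator_schwartz[OF assms] by (simp add: resolution_def)
next
  case False
  note * = schwartz_affine_comp[OF resolution_generator_schwartz[OF assms], where b = 0]
  show ?thesis
    using schwartz_diff[OF *[of "2 powi (- int k)"] *[of "2 powi (- int k + 1)"]] False
    by (simp add: resolution_def)
qed

section \<open>Bump functions, and existence and uniqueness of the frequency pieces\<close>

lemma integral_pos_of_ball:
  fixes f :: "'a::euclidean_space \<Rightarrow> real"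
  assumes "integrable lborel f" "\<And>x. 0 \<le> f x" "\<And>x. x \<in> ball c r \<Longrightarrow> 1 \<le> f x" "r > 0"
  shows "(LINT x|lborel. f x) > 0"
proof -
  have "0 < measure lborel (ball c r)" using content_ball_pos assms(4) by simp
  also have "\<dots> = (LINT x|lborel. indicator (ball c r) x)" by simp
  also have "\<dots> \<le> (LINT x|lborel. f x)"
  proof (rule integral_mono)
    show "integrable lborel (indicator (ball c r) :: _ \<Rightarrow> real)"
      using emeasure_lborel_ball_finite[of c r] by simp
    show "indicator (ball c r) x \<le> f x" for x using assms(2,3) by (auto simp: indicator_def)
  qed (rule assms)
  finally show ?thesis .
qed

lemma bump_eq_1:
  fixes \<phi>0 :: "real^'n::finite \<Rightarrow> real"
  assumes "resolution_generator \<phi>0" "a > 0" "x \<in> ball (- b /\<^sub>R a) (1 / a)"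
  shows "\<phi>0 (a *\<^sub>R x + b) = 1"
proof -
  have "a *\<^sub>R x + b = a *\<^sub>R (x - (- b /\<^sub>R a))" using assms(2) by (simp add: algebra_simps)
  then have "norm (a *\<^sub>R x + b) = a * dist x (- b /\<^sub>R a)"
    using assms(2) by (simp only: norm_scaleR dist_norm abs_of_pos)
  also have "\<dots> \<le> 1" using assms(2,3) by (simp add: dist_commute field_simps)
  finally show ?thesis using assms(1) by (simp add: resolution_generator_def)
qed

text \<open>This gives the uniqueness behind the definite description in
  \<open>representing_function\<close>. Where two continuous functions differ, their difference is
  nearly constant on a small ball, and a dilated and translated \<open>\<phi>0\<close> supported in
  that ball detects it.\<close>

lemma continuous_eq_by_test:
  fixes h1 h2 :: "real^'n::finite \<Rightarrow> complex"
  assumes rg: "resolution_generator (\<phi>0 :: real^'n \<Rightarrow> real)"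
    and cont: "continuous_on UNIV h1" "continuous_on UNIV h2"
    and int: "\<And>w. w \<in> schwartz \<Longrightarrow> integrable lborel (\<lambda>x. h1 x * w x)"
      "\<And>w. w \<in> schwartz \<Longrightarrow> integrable lborel (\<lambda>x. h2 x * w x)"
    and eq: "\<And>w. w \<in> schwartz \<Longrightarrow> (LINT x|lborel. h1 x * w x) = (LINT x|lborel. h2 x * w x)"
  shows "h1 = h2"
proof (rule ccontr)
  assume "h1 \<noteq> h2"
  then obtain x0 where x0: "h1 x0 \<noteq> h2 x0" by auto
  define v where "v = (\<lambda>x. h1 x - h2 x)"
  define \<epsilon> where "\<epsilon> = cmod (v x0) / 2"
  have \<epsilon>: "\<epsilon> > 0" using x0 by (simp add: \<epsilon>_def v_def)
  have "continuous_on UNIV v" unfolding v_def by (intro continuous_intros cont)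
  then have "isCont v x0" by (simp add: continuous_on_eq_continuous_at)
  then obtain r where r: "r > 0" "\<And>x. dist x x0 < r \<Longrightarrow> dist (v x) (v x0) < \<epsilon>"
    using \<epsilon> unfolding continuous_at_eps_delta by blast
  \<comment> \<open>\<open>\<phi>0\<close> vanishes from radius 3/2 on, and \<open>a * r = 2\<close>
    is beyond it, so the bump lives in the ball of radius \<open>r\<close>.\<close>
  define a where "a = 2 / r"
  have a: "a > 0" using r by (simp add: a_def)
  define \<beta> where "\<beta> x = \<phi>0 (a *\<^sub>R x + (- a *\<^sub>R x0))" for x
  let ?\<beta> = "\<lambda>x. of_real (\<beta> x) :: complex"
  have \<beta>S: "?\<beta> \<in> schwartz" unfolding \<beta>_def
    using schwartz_affine_comp[OF resolution_generator_schwartz[OF rg], of a "- a *\<^sub>R x0"] a by simp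
  have \<beta>nn: "\<beta> x \<ge> 0" for x using rg by (simp add: \<beta>_def resolution_generator_def)
  have \<beta>supp: "dist x x0 < r" if "\<beta> x \<noteq> 0" for x
  proof (rule ccontr)
    assume "\<not> dist x x0 < r"
    then have "a * r \<le> a * norm (x - x0)" using a by (simp add: dist_norm)
    then have "norm (a *\<^sub>R x + (- a *\<^sub>R x0)) \<ge> 3 / 2"
      using a r(1) by (simp add: a_def flip: scaleR_diff_right)
    then show False using rg that by (simp add: \<beta>_def resolution_generator_def)
  qed
  have \<beta>int: "integrable lborel \<beta>" using schwartz_integrable[OF \<beta>S] by (simp only: complex_of_real_integrable_eq)
  then have pos: "(LINT x|lborel. \<beta> x) > 0"
    by (rule integral_pos_of_ball[of _ "- (- a *\<^sub>R x0) /\<^sub>R a" "1 / a"])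
      (use \<beta>nn bump_eq_1[OF rg a] a in \<open>simp_all add: \<beta>_def del: scaleR_minus_left\<close>)
  have vint: "integrable lborel (\<lambda>x. v x * ?\<beta> x)"
    unfolding v_def left_diff_distrib by (intro Bochner_Integration.integrable_diff int \<beta>S)
  have "(LINT x|lborel. v x * ?\<beta> x) = 0"
    unfolding v_def left_diff_distrib using int[OF \<beta>S] eq[OF \<beta>S] by simp
  \<comment> \<open>As \<open>v x * \<beta> x\<close> has integral 0, subtracting it is free; what
    is left is the oscillation of \<open>v\<close> on the ball, at most half of
    \<open>cmod (v x0)\<close>.\<close>
  then have "(LINT x|lborel. v x0 * ?\<beta> x) = (LINT x|lborel. v x0 * ?\<beta> x - v x * ?\<beta> x)"
    using vint schwartz_integrable[OF \<beta>S] by (subst Bochner_Integration.integral_diff) auto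
  also have "cmod \<dots> \<le> (LINT x|lborel. \<epsilon> * \<beta> x)"
  proof (rule Bochner_Integration.integral_norm_bound_integral)
    show "integrable lborel (\<lambda>x. v x0 * ?\<beta> x - v x * ?\<beta> x)"
      by (intro Bochner_Integration.integrable_diff vint integrable_mult_right schwartz_integrable \<beta>S)
    show "integrable lborel (\<lambda>x. \<epsilon> * \<beta> x)" by (intro integrable_mult_right \<beta>int)
    show "cmod (v x0 * ?\<beta> x - v x * ?\<beta> x) \<le> \<epsilon> * \<beta> x" for x
    proof (cases "\<beta> x = 0")
      case False
      then have "cmod (v x0 - v x) \<le> \<epsilon>"
        using r(2)[OF \<beta>supp[OF False]] by (metis dist_commute dist_norm less_imp_le)
      then have "cmod (v x0 - v x) * \<beta> x \<le> \<epsilon> * \<beta> x" using \<beta>nn by (rule mult_right_mono)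
      moreover have "cmod (v x0 * ?\<beta> x - v x * ?\<beta> x) = cmod (v x0 - v x) * \<beta> x"
        using \<beta>nn[of x] by (simp add: norm_mult flip: left_diff_distrib)
      ultimately show ?thesis by simp
    qed simp
  qed
  finally have "cmod (v x0) * (LINT x|lborel. \<beta> x) \<le> \<epsilon> * (LINT x|lborel. \<beta> x)"
    using pos by (simp add: norm_mult)
  then have "cmod (v x0) \<le> \<epsilon>" using pos by simp
  then show False using \<epsilon> by (simp add: \<epsilon>_def)
qed

lemma frequency_distribution_apply:
  fixes h :: "(real^'n::finite \<Rightarrow> complex) \<Rightarrow> complex"
  assumes rg: "resolution_generator \<phi>0" and w: "w \<in> schwartz"
  shows "inverse_fourier_distribution (mult_distribution (resolution \<phi>0 k) (fourier_distribution h)) w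
    = h (fourier (\<lambda>\<xi>. of_real (resolution \<phi>0 k \<xi>) * inverse_fourier w \<xi>))"
  using inverse_fourier_schwartz[OF w]
    schwartz_mult[OF schwartz_slowly_increasing[OF resolution_schwartz[OF rg]] inverse_fourier_schwartz[OF w]] w
  by (simp add: inverse_fourier_distribution_def mult_distribution_def fourier_distribution_def)

text \<open>The description yields a usable function only once a candidate has been verified;
  uniqueness comes from \<open>continuous_eq_by_test\<close>.\<close>

lemma frequency_piece_eqI:
  fixes h :: "(real^'n::finite \<Rightarrow> complex) \<Rightarrow> complex"
  assumes rg: "resolution_generator \<phi>0" and cont: "continuous_on UNIV H"
    and int: "\<And>w. w \<in> schwartz \<Longrightarrow> integrable lborel (\<lambda>x. H x * w x)"
    and eq: "\<And>w. w \<in> schwartz \<Longrightarrow>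
      h (fourier (\<lambda>\<xi>. of_real (resolution \<phi>0 k \<xi>) * inverse_fourier w \<xi>)) = (LINT x|lborel. H x * w x)"
  shows "frequency_piece \<phi>0 k h = H"
  unfolding frequency_piece_def representing_function_def
proof (rule the_equality)
  show "continuous_on UNIV H \<and> (\<forall>\<psi>\<in>schwartz. integrable lborel (\<lambda>x. H x * \<psi> x) \<and>
      inverse_fourier_distribution (mult_distribution (resolution \<phi>0 k) (fourier_distribution h)) \<psi> = (LINT x|lborel. H x * \<psi> x))"
    using cont int eq by (simp add: frequency_distribution_apply[OF rg])
  fix H' assume "continuous_on UNIV H' \<and> (\<forall>\<psi>\<in>schwartz. integrable lborel (\<lambda>x. H' x * \<psi> x) \<and>
      inverse_fourier_distribution (mult_distribution (resolution \<phi>0 k) (fourier_distribution h)) \<psi> = (LINT x|lborel. H' x * \<psi> x))"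
  then show "H' = H"
    using cont int eq by (intro continuous_eq_by_test[OF rg]) (auto simp: frequency_distribution_apply[OF rg])
qed

text \<open>Existence of the pieces for an arbitrary tempered distribution, in the spirit of
  Paley-Wiener-Schwartz. The \<open>k\<close>-th piece is \<open>h\<close> convolved with the
  transform of the resolution function, and \<open>tempered_convolution\<close> shows that this is
  continuous and represents the distribution.\<close>

lemma frequency_piece_represents:
  fixes h :: "(real^'n::finite \<Rightarrow> complex) \<Rightarrow> complex"
  assumes rg: "resolution_generator \<phi>0" and h: "h \<in> tempered_distributions"
  shows "continuous_on UNIV (frequency_piece \<phi>0 k h)"
    and "w \<in> schwartz \<Longrightarrow> integrable lborel (\<lambda>x. frequency_piece \<phi>0 k h x * w x)"
    and "w \<in> schwartz \<Longrightarrow> h (fourier (\<lambda>\<xi>. of_real (resolution \<phi>0 k \<xi>) * inverse_fourier w \<xi>))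
      = (LINT x|lborel. frequency_piece \<phi>0 k h x * w x)"
proof -
  note conv = tempered_convolution[OF h resolution_schwartz[OF rg, of k]]
  have eq: "frequency_piece \<phi>0 k h = (\<lambda>y. h (\<lambda>x. fourier_factor TYPE('n) *
      fourier (\<lambda>\<xi>. of_real (resolution \<phi>0 k \<xi>)) (x - y)))"
    by (rule frequency_piece_eqI[OF rg conv])
  show "continuous_on UNIV (frequency_piece \<phi>0 k h)"
    "w \<in> schwartz \<Longrightarrow> integrable lborel (\<lambda>x. frequency_piece \<phi>0 k h x * w x)"
    "w \<in> schwartz \<Longrightarrow> h (fourier (\<lambda>\<xi>. of_real (resolution \<phi>0 k \<xi>) * inverse_fourier w \<xi>))
      = (LINT x|lborel. frequency_piece \<phi>0 k h x * w x)"
    unfolding eq by (rule conv | assumption)+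
qed

section \<open>Morrey norms\<close>

lemma ennreal_powr_mono: "0 \<le> a \<Longrightarrow> x \<le> y \<Longrightarrow> ennreal_powr x a \<le> ennreal_powr y a"
  by (cases x; cases y) (auto simp: ennreal_powr_def top_unique intro!: ennreal_leI powr_mono2)

lemma ennreal_powr_ennreal: "0 \<le> x \<Longrightarrow> ennreal_powr (ennreal x) a = ennreal (x powr a)"
  by (simp add: ennreal_powr_def)

lemma borel_measurable_ennreal_powr [measurable (raw)]:
  assumes [measurable]: "f \<in> borel_measurable M"
  shows "(\<lambda>x. ennreal_powr (f x) a) \<in> borel_measurable M"
  unfolding ennreal_powr_def by measurable

text \<open>The space \<open>l^1\<close> embeds into \<open>l^q\<close> with constant 1: every term
  is at most \<open>A\<close>, so \<open>|a k| powr r <= A powr (r - 1) * |a k|\<close>. One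
  summation thus serves all \<open>q\<close>.\<close>

lemma lq_norm_le:
  assumes q: "1 \<le> q" and A: "\<And>n. (\<Sum>k<n. \<bar>a k\<bar>) \<le> A"
  shows "lq_norm q a \<le> ennreal A"
proof -
  have A0: "0 \<le> A" using A[of 0] by simp
  have ak: "\<bar>a k\<bar> \<le> A" for k
  proof -
    have "0 \<le> (\<Sum>i<k. \<bar>a i\<bar>)" by (intro sum_nonneg) auto
    moreover have "(\<Sum>i<k. \<bar>a i\<bar>) + \<bar>a k\<bar> \<le> A" using A[of "Suc k"] by simp
    ultimately show ?thesis by linarith
  qed
  show ?thesis
  proof (cases "q = \<infinity>")
    case True
    then show ?thesis using ak by (auto simp: lq_norm_def intro!: SUP_least ennreal_leI)
  next
    case False
    define r where "r = enn2real q"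
    have qr: "q = ennreal r" using False by (simp add: r_def less_top)
    then have r: "1 \<le> r" using q by (simp add: ennreal_ge_1)
    have "(\<Sum>k. ennreal (\<bar>a k\<bar> powr r)) \<le> ennreal (A powr r)"
    proof (rule suminf_le_const[OF summableI])
      fix n
      have "(\<Sum>k<n. \<bar>a k\<bar> powr r) \<le> (\<Sum>k<n. A powr (r - 1) * \<bar>a k\<bar>)"
      proof (rule sum_mono)
        fix k
        have "\<bar>a k\<bar> powr r = \<bar>a k\<bar> powr (r - 1) * \<bar>a k\<bar>"
          by (cases "a k = 0") (auto simp: powr_diff)
        also have "\<dots> \<le> A powr (r - 1) * \<bar>a k\<bar>"
          using ak r by (intro mult_right_mono powr_mono2) auto
        finally show "\<bar>a k\<bar> powr r \<le> A powr (r - 1) * \<bar>a k\<bar>" .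
      qed
      also have "\<dots> \<le> A powr (r - 1) * A" using A[of n] by (simp add: mult_left_mono flip: sum_distrib_left)
      also have "\<dots> = A powr r" using A0 by (cases "A = 0") (auto simp: powr_diff)
      finally show "(\<Sum>k<n. ennreal (\<bar>a k\<bar> powr r)) \<le> ennreal (A powr r)"
        by (simp add: sum_ennreal ennreal_leI)
    qed
    then have "lq_norm q a \<le> ennreal_powr (ennreal (A powr r)) (1 / r)"
      unfolding lq_norm_def r_def using False by (simp add: ennreal_powr_mono)
    also have "\<dots> = ennreal A" using A0 r by (simp add: ennreal_powr_ennreal powr_powr)
    finally show ?thesis .
  qed
qed

lemma lq_norm_ge:
  assumes "q > 0"
  shows "ennreal \<bar>a k\<bar> \<le> lq_norm q a"
proof (cases "q = \<infinity>")
  case True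
  then show ?thesis by (auto simp: lq_norm_def intro: SUP_upper)
next
  case False
  define r where "r = enn2real q"
  have r: "r > 0" using False assms by (simp add: r_def enn2real_positive_iff less_top)
  have "ennreal (\<bar>a k\<bar> powr r) \<le> (\<Sum>k. ennreal (\<bar>a k\<bar> powr r))"
    using sum_le_suminf[of "\<lambda>k. ennreal (\<bar>a k\<bar> powr r)" "{k}"]
    by (simp only: summableI finite.intros sum.insert sum.empty empty_iff not_False_eq_True add_0_right zero_le simp_thms)
  then have "ennreal_powr (ennreal (\<bar>a k\<bar> powr r)) (1 / r) \<le> lq_norm q a"
    unfolding lq_norm_def using False r by (simp add: r_def ennreal_powr_mono)
  then show ?thesis using r by (simp add: ennreal_powr_ennreal powr_powr)
qed

text \<open>With \<open>y = 2 ^ k t\<close> the summands are dominated by differences \<open>\<phi> (2 y) - \<phi> y\<close> of the bounded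
  function \<open>\<phi> y = - 1 / (1 + y powr \<beta>)\<close>, so the sum telescopes.\<close>

lemma dyadic_sum_bound:
  assumes \<beta>: "\<beta> > 0"
  obtains C where "C > 0" "\<And>t n. t > 0 \<Longrightarrow>
    (\<Sum>k<n. 2 powr (real k * \<beta>) * (1 + 2 ^ k * t) powr (- 2 * \<beta>)) \<le> C * t powr (- \<beta>)"
proof -
  define b where "b = 2 powr \<beta>"
  have b: "b > 1" using \<beta> by (simp add: b_def)
  \<comment> \<open>The 4 pays for \<open>(1 + z)\<^sup>2 <= 4 * (1 + y) powr (2 * \<beta>)\<close>.
    A telescoping difference equals \<open>z * (b - 1) / ((1 + z) * (1 + b * z))\<close>, and
    \<open>1 + b * z <= b * (1 + z)\<close> makes it at least \<open>(b - 1) / b\<close> times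
    \<open>z / (1 + z)\<^sup>2\<close>.\<close>
  define C where "C = 4 * b / (b - 1)"
  have C: "C > 0" using b by (simp add: C_def)
  have "(\<Sum>k<n. 2 powr (real k * \<beta>) * (1 + 2 ^ k * t) powr (- 2 * \<beta>)) \<le> C * t powr (- \<beta>)" if t: "t > 0" for t n
  proof -
    define g where "g k = - 1 / (1 + (2 ^ k * t) powr \<beta>)" for k :: nat
    have summand: "2 powr (real k * \<beta>) * (1 + 2 ^ k * t) powr (- 2 * \<beta>) \<le> t powr (- \<beta>) * C * (g (Suc k) - g k)" for k
    proof -
      define y where "y = 2 ^ k * t"
      define z where "z = y powr \<beta>"
      have y: "y > 0" using t by (simp add: y_def)
      then have z: "z > 0" by (simp add: z_def)
      have "1 powr \<beta> \<le> (1 + y) powr \<beta>" "y powr \<beta> \<le> (1 + y) powr \<beta>"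
        using y \<beta> by (intro powr_mono2; simp)+
      then have "(1 + z)\<^sup>2 \<le> (2 * (1 + y) powr \<beta>)\<^sup>2" using z by (intro power_mono) (simp_all add: z_def)
      also have "\<dots> = 4 * (1 + y) powr (2 * \<beta>)"
        using powr_add[of "1 + y" \<beta> \<beta>] by (simp add: power2_eq_square)
      finally have "(1 + y) powr (- 2 * \<beta>) \<le> 4 / (1 + z)\<^sup>2"
        using y z by (simp add: powr_minus field_simps)
      then have "z * (1 + y) powr (- 2 * \<beta>) \<le> z * (4 / (1 + z)\<^sup>2)" using z by (intro mult_left_mono) auto
      also have "\<dots> \<le> C * (z * (b - 1) / ((1 + z) * (1 + b * z)))"
      proof -
        have "1 + b * z \<le> b * (1 + z)" using b by (simp add: algebra_simps)
        then have "(1 + z) * (1 + b * z) \<le> b * (1 + z)\<^sup>2"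
          using z by (simp add: power2_eq_square mult_left_mono mult.left_commute)
        then have "4 * z * b / (b * (1 + z)\<^sup>2) \<le> 4 * z * b / ((1 + z) * (1 + b * z))"
          using b z by (intro divide_left_mono mult_pos_pos add_pos_pos zero_less_power) auto
        moreover have "C * (z * (b - 1) / w) = 4 * z * b / w" for w using b by (simp add: C_def)
        moreover have "4 * z * b / (b * (1 + z)\<^sup>2) = z * (4 / (1 + z)\<^sup>2)" using b by simp
        ultimately show ?thesis by (simp only:)
      qed
      also have "z * (b - 1) / ((1 + z) * (1 + b * z)) = g (Suc k) - g k"
      proof -
        have "(2 * y) powr \<beta> = b * z" using y by (simp add: powr_mult b_def z_def)
        then have "g (Suc k) - g k = 1 / (1 + z) - 1 / (1 + b * z)" by (simp add: g_def y_def z_def mult.assoc)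
        moreover have "1 + z \<noteq> 0" "1 + b * z \<noteq> 0" using z b by (smt (verit) mult_pos_pos)+
        ultimately show ?thesis by (simp add: field_simps)
      qed
      finally have "t powr (- \<beta>) * (z * (1 + y) powr (- 2 * \<beta>)) \<le> t powr (- \<beta>) * (C * (g (Suc k) - g k))"
        by (intro mult_left_mono) auto
      moreover have "2 powr (real k * \<beta>) = t powr (- \<beta>) * z"
        using t by (simp add: y_def z_def powr_mult powr_minus powr_powr field_simps flip: powr_realpow)
      ultimately show ?thesis by (simp add: y_def mult.assoc)
    qed
    have "(\<Sum>k<n. 2 powr (real k * \<beta>) * (1 + 2 ^ k * t) powr (- 2 * \<beta>))
        \<le> t powr (- \<beta>) * C * (g n - g 0)"
      unfolding sum_lessThan_telescope[symmetric] sum_distrib_left by (intro sum_mono summand)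
    also have "\<dots> \<le> t powr (- \<beta>) * C * 1"
    proof (intro mult_left_mono)
      have "- g 0 \<le> 1" "g n \<le> 0" unfolding g_def by (simp_all add: divide_le_eq_1 add_pos_nonneg add_nonneg_nonneg)
      then show "g n - g 0 \<le> 1" by simp
    qed (use C in simp)
    finally show ?thesis by (simp add: mult.commute)
  qed
  with C show thesis by (rule that)
qed

text \<open>For a ball centred at \<open>x0\<close>, dyadic shells give a geometric series with
  ratio \<open>2 powr (a - d)\<close>, convergent as \<open>a < d\<close>. In any other ball of
  radius \<open>r\<close>, the points within \<open>r\<close> of \<open>x0\<close> are covered by
  that case, and elsewhere the integrand is at most \<open>r powr (- a)\<close>.\<close>

lemma nn_integral_ball_powr:
  fixes x0 :: "'a::euclidean_space" and a :: real
  assumes a: "0 < a" "a < DIM('a)"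
  obtains C where "C > 0" "\<And>y r. r > 0 \<Longrightarrow>
    (\<integral>\<^sup>+x\<in>ball y r. ennreal (norm (x - x0) powr (- a)) \<partial>lborel) \<le> ennreal (C * r powr (DIM('a) - a))"
proof -
  let ?d = "DIM('a)"
  let ?v = "unit_ball_vol ?d"
  have v: "?v > 0" by (simp add: unit_ball_vol_pos)
  define \<rho> where "\<rho> = 2 powr (a - ?d)"
  have \<rho>: "0 < \<rho>" "\<rho> < 1" using a by (auto simp: \<rho>_def intro!: powr_less_one)
  define D where "D = 2 powr a * ?v / (1 - \<rho>)"
  have D: "D > 0" using v \<rho> by (simp add: D_def)
  have centre: "(\<integral>\<^sup>+x\<in>ball x0 r. ennreal (norm (x - x0) powr (- a)) \<partial>lborel) \<le> ennreal (D * r powr (?d - a))"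
    if r: "r > 0" for r
  proof -
    let ?c = "\<lambda>i. (r / 2 ^ (i + 1)) powr (- a)"
    have "(\<integral>\<^sup>+x\<in>ball x0 r. ennreal (norm (x - x0) powr (- a)) \<partial>lborel)
      \<le> (\<integral>\<^sup>+x. (\<Sum>i. ennreal (?c i) * indicator (ball x0 (r / 2 ^ i)) x) \<partial>lborel)"
    proof (rule nn_integral_mono)
      fix x :: 'a
      show "ennreal (norm (x - x0) powr (- a)) * indicator (ball x0 r) x
        \<le> (\<Sum>i. ennreal (?c i) * indicator (ball x0 (r / 2 ^ i)) x)"
      \<comment> \<open>At \<open>x = x0\<close> the left side is 0, because
        \<open>0 powr (- a) = 0\<close>; every other point of the ball lies in one of the
        shells.\<close>
      proof (cases "x \<in> ball x0 r \<and> x \<noteq> x0")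
        case True
        then have nx: "0 < norm (x - x0)" "norm (x - x0) < r" by (auto simp: dist_norm norm_minus_commute)
        obtain n where "r / norm (x - x0) < 2 ^ n" using real_arch_pow[of 2] by auto
        then have ex: "\<exists>i. r / 2 ^ i \<le> norm (x - x0)" using nx r by (intro exI[of _ n]) (simp add: field_simps)
        define j where "j = (LEAST i. r / 2 ^ i \<le> norm (x - x0))"
        have j: "r / 2 ^ j \<le> norm (x - x0)" unfolding j_def using ex by (rule LeastI_ex)
        then obtain i where i: "j = Suc i" using nx by (cases j) auto
        have "\<not> r / 2 ^ i \<le> norm (x - x0)"
          using not_less_Least[of i "\<lambda>i. r / 2 ^ i \<le> norm (x - x0)"] i unfolding j_def by auto
        then have xi: "x \<in> ball x0 (r / 2 ^ i)" by (simp add: dist_norm norm_minus_commute)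
        have "norm (x - x0) powr (- a) \<le> ?c i"
          using j i r a by (intro powr_mono2') auto
        then have "ennreal (norm (x - x0) powr (- a)) * indicator (ball x0 r) x
            \<le> ennreal (?c i) * indicator (ball x0 (r / 2 ^ i)) x"
          using True xi by (simp add: ennreal_leI)
        also have "\<dots> \<le> (\<Sum>i. ennreal (?c i) * indicator (ball x0 (r / 2 ^ i)) x)"
          using sum_le_suminf[of "\<lambda>i. ennreal (?c i) * indicator (ball x0 (r / 2 ^ i)) x" "{i}"]
          by (simp only: summableI finite.intros sum.insert sum.empty empty_iff not_False_eq_True add_0_right zero_le simp_thms)
        finally show ?thesis .
      qed auto
    qed
    also have "\<dots> = (\<Sum>i. ennreal (?c i) * emeasure lborel (ball x0 (r / 2 ^ i)))"
    proof -
      have [measurable]: "ball x0 (r / 2 ^ i) \<in> sets borel" for i by simp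
      show ?thesis by (subst nn_integral_suminf) (measurable, simp add: nn_integral_cmult)
    qed
    also have "\<dots> = (\<Sum>i. ennreal (2 powr a * ?v * r powr (?d - a) * \<rho> ^ i))"
    proof (intro suminf_cong)
      fix i
      have "?c i * (?v * (r / 2 ^ i) ^ ?d) = 2 powr a * ?v * r powr (?d - a) * \<rho> ^ i"
      proof -
        have "(r / 2 ^ (i + 1)) powr (- a) = r powr (- a) * 2 powr (a * (real i + 1))"
        proof -
          have "r / 2 ^ (i + 1) = r * 2 powr (- (real i + 1))"
            unfolding powr_minus[of 2 "real i + 1"] by (simp add: powr_add powr_realpow field_simps)
          then show ?thesis using r by (simp only: powr_mult powr_powr) (simp add: algebra_simps)
        qed
        moreover have "(r / 2 ^ i) ^ ?d = r powr ?d * 2 powr (- real i * ?d)"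
        proof -
          have "r / 2 ^ i = r * 2 powr (- real i)" by (simp add: powr_minus powr_realpow field_simps)
          moreover have "(r / 2 ^ i) ^ ?d = (r / 2 ^ i) powr ?d" using r by (simp add: powr_realpow)
          ultimately show ?thesis using r by (simp only: powr_mult powr_powr)
        qed
        moreover have "\<rho> ^ i = 2 powr ((a - ?d) * i)"
          by (simp add: \<rho>_def powr_powr flip: powr_realpow)
        ultimately have "?c i * (?v * (r / 2 ^ i) ^ ?d)
            = ?v * (r powr (- a) * r powr ?d) * (2 powr (a * (real i + 1)) * 2 powr (- real i * ?d))" by simp
        also have "\<dots> = ?v * r powr (?d - a) * (2 powr a * 2 powr ((a - ?d) * i))"
          by (simp add: algebra_simps flip: powr_add)
        finally show ?thesis using \<open>\<rho> ^ i = _\<close> by (simp only: mult_ac)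
      qed
      then show "ennreal (?c i) * emeasure lborel (ball x0 (r / 2 ^ i)) = ennreal (2 powr a * ?v * r powr (?d - a) * \<rho> ^ i)"
        using less_imp_le[OF divide_pos_pos[OF r zero_less_power[of "2::real" i]]]
        by (subst emeasure_ball) (simp_all only: ennreal_mult'[symmetric] powr_ge_zero zero_less_numeral)
    qed
    also have "\<dots> = ennreal (\<Sum>i. 2 powr a * ?v * r powr (?d - a) * \<rho> ^ i)"
      using \<rho> v by (intro suminf_ennreal2) (auto intro!: summable_mult summable_geometric)
    also have "(\<Sum>i. 2 powr a * ?v * r powr (?d - a) * \<rho> ^ i) = D * r powr (?d - a)"
      using \<rho> by (simp add: suminf_mult suminf_geometric D_def)
    finally show ?thesis .
  qed
  show thesis
  proof (rule that[of "D + ?v"])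
    show "D + ?v > 0" by (rule add_pos_pos[OF D v])
    fix y :: 'a and r :: real
    assume r: "r > 0"
    have "(\<integral>\<^sup>+x\<in>ball y r. ennreal (norm (x - x0) powr (- a)) \<partial>lborel)
      \<le> (\<integral>\<^sup>+x. ennreal (norm (x - x0) powr (- a)) * indicator (ball x0 r) x + ennreal (r powr (- a)) * indicator (ball y r) x \<partial>lborel)"
    proof (rule nn_integral_mono)
      fix x :: 'a
      show "ennreal (norm (x - x0) powr (- a)) * indicator (ball y r) x
        \<le> ennreal (norm (x - x0) powr (- a)) * indicator (ball x0 r) x + ennreal (r powr (- a)) * indicator (ball y r) x"
      proof (cases "x \<in> ball x0 r")
        case False
        then have "r \<le> norm (x - x0)" by (simp add: dist_norm norm_minus_commute)
        then have "norm (x - x0) powr (- a) \<le> r powr (- a)" using r a by (intro powr_mono2') auto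
        then show ?thesis by (auto simp: indicator_def intro: ennreal_leI)
      qed (auto simp: indicator_def)
    qed
    also have "\<dots> = (\<integral>\<^sup>+x\<in>ball x0 r. ennreal (norm (x - x0) powr (- a)) \<partial>lborel) + ennreal (r powr (- a)) * emeasure lborel (ball y r)"
    proof -
      have [measurable]: "ball z r \<in> sets borel" for z :: 'a by simp
      show ?thesis by (subst nn_integral_add) (measurable, simp add: nn_integral_cmult)
    qed
    also have "\<dots> \<le> ennreal (D * r powr (?d - a)) + ennreal (r powr (- a) * (?v * r ^ ?d))"
      using centre[OF r] r v by (intro add_mono) (simp_all add: emeasure_ball ennreal_mult')
    also have "\<dots> = ennreal ((D + ?v) * r powr (?d - a))"
    proof -
      have "r powr (- a) * (?v * r ^ ?d) = ?v * r powr (?d - a)"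
        using r by (simp add: powr_diff powr_minus powr_realpow field_simps)
      moreover have "0 \<le> D * r powr (?d - a)" "0 \<le> ?v * r powr (?d - a)" using D v by simp_all
      ultimately show ?thesis by (simp only: distrib_right ennreal_plus)
    qed
    finally show "(\<integral>\<^sup>+x\<in>ball y r. ennreal (norm (x - x0) powr (- a)) \<partial>lborel) \<le> ennreal ((D + ?v) * r powr (?d - a))" .
  qed
qed


text \<open>As \<open>p < u\<close>, the \<open>p\<close>-th power of the profile has exponent
  \<open>d * p / u < d\<close> and is integrable on balls; the powers of the radius then cancel
  exactly against the Morrey factor. The null set \<open>x = x0\<close> is excluded because the
  profile is 0 there by the convention for \<open>powr\<close>.\<close>

lemma morrey_norm_singular:
  fixes x0 :: "real^'n::finite"
  assumes p: "1 \<le> p" "p < u"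
  obtains C where "C > 0" "\<And>A G. 0 \<le> A \<Longrightarrow>
    (\<And>x. x \<noteq> x0 \<Longrightarrow> G x \<le> ennreal (A * norm (x - x0) powr (- (real CARD('n) / u)))) \<Longrightarrow>
    morrey_norm u p G \<le> ennreal (A * C)"
proof -
  let ?d = "real CARD('n)"
  define a where "a = ?d / u * p"
  have "a < ?d" using p by (simp add: a_def field_simps)
  moreover have "0 < a" using p by (simp add: a_def)
  ultimately obtain C0 where C0: "C0 > 0" "\<And>(y::real^'n) r. r > 0 \<Longrightarrow>
    (\<integral>\<^sup>+x\<in>ball y r. ennreal (norm (x - x0) powr (- a)) \<partial>lborel) \<le> ennreal (C0 * r powr (?d - a))"
    using nn_integral_ball_powr[of a x0] by auto
  define v where "v = unit_ball_vol ?d"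
  have v: "v > 0" unfolding v_def by (simp add: unit_ball_vol_pos)
  let ?C = "v powr (1 / u - 1 / p) * C0 powr (1 / p)"
  show thesis
  proof (rule that[of ?C])
    show "?C > 0" using v C0 by simp
    fix A :: real and G :: "real^'n \<Rightarrow> ennreal"
    assume A: "0 \<le> A" and G: "\<And>x. x \<noteq> x0 \<Longrightarrow> G x \<le> ennreal (A * norm (x - x0) powr (- (?d / u)))"
    show "morrey_norm u p G \<le> ennreal (A * ?C)"
      unfolding morrey_norm_def
    proof (rule SUP_least, clarify)
      fix y :: "real^'n" and r :: real
      assume r: "0 < r"
      have Gp: "ennreal_powr (G x) p \<le> ennreal (A powr p) * ennreal (norm (x - x0) powr (- a))" if "x \<noteq> x0" for x
      proof -
        have "ennreal_powr (G x) p \<le> ennreal_powr (ennreal (A * norm (x - x0) powr (- (?d / u)))) p"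
          using p by (intro ennreal_powr_mono G that) auto
        also have "\<dots> = ennreal (A powr p * norm (x - x0) powr (- a))"
          using A p by (subst ennreal_powr_ennreal) (auto simp: powr_mult powr_powr a_def)
        finally show ?thesis by (simp add: ennreal_mult')
      qed
      have "(\<integral>\<^sup>+x\<in>ball y r. ennreal_powr (G x) p \<partial>lborel)
          \<le> (\<integral>\<^sup>+x. ennreal (A powr p) * (ennreal (norm (x - x0) powr (- a)) * indicator (ball y r) x) \<partial>lborel)"
      proof (rule nn_integral_mono_AE)
        show "AE x in lborel. ennreal_powr (G x) p * indicator (ball y r) x
            \<le> ennreal (A powr p) * (ennreal (norm (x - x0) powr (- a)) * indicator (ball y r) x)"
          using AE_lborel_singleton[of x0] by eventually_elim (use Gp in \<open>auto simp: indicator_def\<close>)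
      qed
      also have "\<dots> = ennreal (A powr p) * (\<integral>\<^sup>+x\<in>ball y r. ennreal (norm (x - x0) powr (- a)) \<partial>lborel)"
      proof -
        have [measurable]: "ball y r \<in> sets borel" by simp
        show ?thesis by (rule nn_integral_cmult) measurable
      qed
      also have "\<dots> \<le> ennreal (A powr p) * ennreal (C0 * r powr (?d - a))"
        by (intro mult_left_mono C0 r) auto
      also have "\<dots> = ennreal (A powr p * (C0 * r powr (?d - a)))" by (simp add: ennreal_mult')
      finally have "ennreal_powr (\<integral>\<^sup>+x\<in>ball y r. ennreal_powr (G x) p \<partial>lborel) (1 / p)
          \<le> ennreal_powr (ennreal (A powr p * (C0 * r powr (?d - a)))) (1 / p)"
        using p by (intro ennreal_powr_mono) auto
      also have "\<dots> = ennreal (A * C0 powr (1 / p) * r powr (?d / p - ?d / u))"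
      proof -
        have "(A powr p * (C0 * r powr (?d - a))) powr (1 / p) = A * (C0 powr (1 / p) * r powr ((?d - a) / p))"
          using A C0 p r by (simp add: powr_mult powr_powr)
        moreover have "(?d - a) / p = ?d / p - ?d / u" using p by (simp add: a_def field_simps)
        ultimately show ?thesis using C0 by (simp add: ennreal_powr_ennreal mult.assoc)
      qed
      finally have 1: "ennreal_powr (\<integral>\<^sup>+x\<in>ball y r. ennreal_powr (G x) p \<partial>lborel) (1 / p)
          \<le> ennreal (A * C0 powr (1 / p) * r powr (?d / p - ?d / u))" .
      have m: "measure lborel (ball y r) = v * r powr ?d"
        using r by (simp add: content_ball v_def powr_realpow)
      have "measure lborel (ball y r) powr (1 / u - 1 / p) * (A * C0 powr (1 / p) * r powr (?d / p - ?d / u))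
        = A * ?C * (r powr (?d * (1 / u - 1 / p)) * r powr (?d / p - ?d / u))"
        unfolding m using v r by (simp add: powr_mult powr_powr)
      also have "r powr (?d * (1 / u - 1 / p)) * r powr (?d / p - ?d / u) = 1"
        using r by (simp add: algebra_simps flip: powr_add)
      finally have 2: "measure lborel (ball y r) powr (1 / u - 1 / p) * (A * C0 powr (1 / p) * r powr (?d / p - ?d / u)) = A * ?C"
        by simp
      have "ennreal (measure lborel (ball y r) powr (1 / u - 1 / p)) *
          ennreal_powr (\<integral>\<^sup>+x\<in>ball y r. ennreal_powr (G x) p \<partial>lborel) (1 / p)
        \<le> ennreal (measure lborel (ball y r) powr (1 / u - 1 / p)) * ennreal (A * C0 powr (1 / p) * r powr (?d / p - ?d / u))"
        by (intro mult_left_mono 1) auto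
      also have "\<dots> = ennreal (A * ?C)" unfolding ennreal_mult'[symmetric, OF powr_ge_zero] 2 ..
      finally show "ennreal (measure lborel (ball y r) powr (1 / u - 1 / p)) *
          ennreal_powr (\<integral>\<^sup>+x\<in>ball y r. ennreal_powr (G x) p \<partial>lborel) (1 / p) \<le> ennreal (A * ?C)" .
    qed
  qed
qed

text \<open>The factor 2 comes from replacing Hoelder's inequality by \<open>G \<le> K + K powr (1 - p) * G powr p\<close>.\<close>

lemma morrey_norm_imp_local_L1:
  fixes G :: "real^'n::finite \<Rightarrow> ennreal"
  assumes [measurable]: "G \<in> borel_measurable borel"
    and p: "1 \<le> p" and \<epsilon>: "0 < \<epsilon>" and G: "morrey_norm u p G \<le> ennreal \<epsilon>" and r: "r > 0"
  shows "(\<integral>\<^sup>+x\<in>ball y r. G x \<partial>lborel) \<le> ennreal (2 * \<epsilon> * measure lborel (ball y r) powr (1 - 1 / u))"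
proof -
  have [measurable]: "ball y r \<in> sets borel" by simp
  define b where "b = measure lborel (ball y r)"
  have b: "b > 0" unfolding b_def using content_ball_pos[OF r] by simp
  have eb: "emeasure lborel (ball y r) = ennreal b"
    unfolding b_def using emeasure_lborel_ball_finite[of y r] by (intro emeasure_eq_ennreal_measure) auto
  define I where "I = (\<integral>\<^sup>+x\<in>ball y r. ennreal_powr (G x) p \<partial>lborel)"
  \<comment> \<open>The level at which the two terms balance: the Morrey bound becomes
    \<open>J <= K powr p * b\<close>, so each term contributes at most \<open>K * b\<close>.\<close>
  define K where "K = \<epsilon> * b powr (- 1 / u)"
  have K: "K > 0" using \<epsilon> b by (simp add: K_def)
  have le: "ennreal (b powr (1 / u - 1 / p)) * ennreal_powr I (1 / p) \<le> ennreal \<epsilon>"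
  proof -
    have "ennreal (b powr (1 / u - 1 / p)) * ennreal_powr I (1 / p) \<le> morrey_norm u p G"
      unfolding morrey_norm_def b_def I_def using r
      by (intro SUP_upper2[of "(y, r)"]) auto
    then show ?thesis using G by (rule order_trans)
  qed
  have "I \<noteq> \<infinity>"
  proof
    assume "I = \<infinity>"
    then show False using le b by (simp add: ennreal_powr_def ennreal_mult_top top_unique)
  qed
  then obtain J where J: "I = ennreal J" "J \<ge> 0" by (cases I) auto
  have "b powr (1 / u - 1 / p) * J powr (1 / p) \<le> \<epsilon>"
    using le J \<epsilon> by (simp add: ennreal_powr_ennreal flip: ennreal_mult')
  then have "b powr (1 / p - 1 / u) * (b powr (1 / u - 1 / p) * J powr (1 / p)) \<le> b powr (1 / p - 1 / u) * \<epsilon>"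
    by (intro mult_left_mono) auto
  moreover have "b powr (1 / p - 1 / u) * b powr (1 / u - 1 / p) = 1" using b by (simp flip: powr_add)
  ultimately have "J powr (1 / p) \<le> b powr (1 / p - 1 / u) * \<epsilon>" by (simp flip: mult.assoc)
  also have "\<dots> = K * b powr (1 / p)" unfolding K_def by (simp flip: powr_add)
  finally have "(J powr (1 / p)) powr p \<le> (K * b powr (1 / p)) powr p" using p by (intro powr_mono2) auto
  then have Jle: "J \<le> K powr p * b" using J p K b by (simp add: powr_powr powr_mult)
  have pw: "G x \<le> ennreal K + ennreal (K powr (1 - p)) * ennreal_powr (G x) p" for x
  proof (cases "G x")
    case (real g)
    show ?thesis
    proof (cases "g \<le> K")
      case True
      then show ?thesis using real by (simp add: add_increasing2 ennreal_leI)
    next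
      case False
      have "g = K powr (1 - p) * (K powr (p - 1) * g powr 1)" using K real by (simp flip: powr_add mult.assoc)
      also have "\<dots> \<le> K powr (1 - p) * (g powr (p - 1) * g powr 1)"
        using False K p by (intro mult_left_mono mult_right_mono powr_mono2) auto
      also have "\<dots> = K powr (1 - p) * g powr p" by (simp only: powr_add[symmetric]) simp
      finally have "ennreal g \<le> ennreal (K powr (1 - p) * g powr p)" by (rule ennreal_leI)
      then show ?thesis using real by (simp add: ennreal_powr_ennreal add_increasing flip: ennreal_mult')
    qed
  next
    case top
    then show ?thesis using K by (simp add: ennreal_powr_def ennreal_mult_top)
  qed
  have "(\<integral>\<^sup>+x\<in>ball y r. G x \<partial>lborel) \<le> (\<integral>\<^sup>+x. ennreal K * indicator (ball y r) x
      + ennreal (K powr (1 - p)) * (ennreal_powr (G x) p * indicator (ball y r) x) \<partial>lborel)"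
    by (intro nn_integral_mono) (use pw in \<open>auto simp: indicator_def\<close>)
  also have "\<dots> = ennreal K * ennreal b + ennreal (K powr (1 - p)) * I"
    unfolding I_def eb[symmetric] by (subst nn_integral_add) (measurable, simp add: nn_integral_cmult)
  also have "\<dots> = ennreal (K * b + K powr (1 - p) * J)" using K b J by (simp add: ennreal_mult)
  also have "\<dots> \<le> ennreal (2 * \<epsilon> * b powr (1 - 1 / u))"
  proof (rule ennreal_leI)
    have "K powr (1 - p) * J \<le> K powr (1 - p) * (K powr p * b)" by (intro mult_left_mono Jle) auto
    also have "\<dots> = K * b" using K by (simp flip: powr_add mult.assoc)
    finally have "K * b + K powr (1 - p) * J \<le> 2 * (K * b)" by simp
    moreover have "K * b = \<epsilon> * b powr (1 - 1 / u)" using b by (simp add: K_def powr_diff powr_minus field_simps)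
    ultimately show "K * b + K powr (1 - p) * J \<le> 2 * \<epsilon> * b powr (1 - 1 / u)" by simp
  qed
  finally show ?thesis unfolding b_def .
qed

text \<open>On the ball of radius \<open>2 ^ i * r\<close> the local bound gains at most
  \<open>2 ^ (i d)\<close> over the one for radius \<open>r\<close>, while the weight is of order
  \<open>2 ^ (- i (d + 1))\<close>. What remains is a geometric series with ratio 1/2, whose sum is
  the last factor 2 of the constant.\<close>

lemma morrey_norm_imp_weighted_L1:
  assumes u: "0 < u" and p: "1 \<le> p"
  obtains C where "C > 0" "\<And>(G :: real^'n::finite \<Rightarrow> ennreal) \<epsilon> r x0. G \<in> borel_measurable borel \<Longrightarrow> 0 < \<epsilon> \<Longrightarrow>
    morrey_norm u p G \<le> ennreal \<epsilon> \<Longrightarrow> 0 < r \<Longrightarrow>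
    (\<integral>\<^sup>+x. G x * ennreal (inverse ((1 + norm (x - x0) / r) ^ (CARD('n) + 1))) \<partial>lborel)
      \<le> ennreal (C * \<epsilon> * r powr (real CARD('n) - real CARD('n) / u))"
proof -
  let ?d = "real CARD('n)" and ?M = "CARD('n) + 1"
  define v where "v = unit_ball_vol ?d"
  have v: "v > 0" unfolding v_def by (simp add: unit_ball_vol_pos)
  let ?C = "2 ^ ?M * 2 * v powr (1 - 1 / u) * 2"
  show thesis
  proof (rule that[of ?C])
    show "?C > 0" using v by simp
    fix G :: "real^'n \<Rightarrow> ennreal" and \<epsilon> r :: real and x0 :: "real^'n"
    assume G: "G \<in> borel_measurable borel" "morrey_norm u p G \<le> ennreal \<epsilon>" and \<epsilon>: "0 < \<epsilon>" and r: "0 < r"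
    let ?Q = "2 ^ ?M * 2 * v powr (1 - 1 / u) * \<epsilon> * r powr (?d - ?d / u)"
    have "(\<integral>\<^sup>+x. G x * ennreal (inverse ((1 + norm (x - x0) / r) ^ ?M)) \<partial>lborel)
      \<le> (\<Sum>i. ennreal (2 ^ ?M * (1 / 2) ^ (i * ?M)) * (\<integral>\<^sup>+x\<in>ball x0 (2 ^ i * r). G x \<partial>lborel))"
      by (rule nn_integral_le_dyadic[OF G(1) r])
    also have "\<dots> \<le> (\<Sum>i. ennreal (?Q * (1 / 2) ^ i))"
    proof (intro suminf_le summableI allI)
      fix i
      have m: "measure lborel (ball x0 (2 ^ i * r)) = v * (2 powr i * r) powr ?d"
        using r by (simp add: content_ball v_def powr_realpow)
      have "ennreal (2 ^ ?M * (1 / 2) ^ (i * ?M)) * (\<integral>\<^sup>+x\<in>ball x0 (2 ^ i * r). G x \<partial>lborel)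
        \<le> ennreal (2 ^ ?M * (1 / 2) ^ (i * ?M)) * ennreal (2 * \<epsilon> * (v * (2 powr i * r) powr ?d) powr (1 - 1 / u))"
        unfolding m[symmetric] using r by (intro mult_left_mono morrey_norm_imp_local_L1[OF G(1) p \<epsilon> G(2)]) auto
      also have "\<dots> = ennreal ((2 ^ ?M * (1 / 2) ^ (i * ?M)) * (2 * \<epsilon> * (v * (2 powr i * r) powr ?d) powr (1 - 1 / u)))"
        by (rule ennreal_mult'[symmetric]) simp
      also have "\<dots> \<le> ennreal (?Q * (1 / 2) ^ i)"
      proof (rule ennreal_leI)
        have 1: "(v * (2 powr i * r) powr ?d) powr (1 - 1 / u)
            = v powr (1 - 1 / u) * (2 powr (i * (?d * (1 - 1 / u))) * r powr (?d * (1 - 1 / u)))"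
          using v r by (simp add: powr_mult powr_powr mult.assoc)
        have "2 powr (i * (?d * (1 - 1 / u))) \<le> 2 powr (i * ?d)"
          using u by (intro powr_mono mult_left_mono) auto
        also have "\<dots> = 2 ^ (i * CARD('n))" by (simp flip: powr_realpow)
        finally have "(v * (2 powr i * r) powr ?d) powr (1 - 1 / u)
            \<le> v powr (1 - 1 / u) * (2 ^ (i * CARD('n)) * r powr (?d * (1 - 1 / u)))"
          unfolding 1 by (intro mult_left_mono mult_right_mono) auto
        then have "(2 ^ ?M * (1 / 2) ^ (i * ?M)) * (2 * \<epsilon> * (v * (2 powr i * r) powr ?d) powr (1 - 1 / u))
            \<le> (2 ^ ?M * (1 / 2) ^ (i * ?M)) * (2 * \<epsilon> * (v powr (1 - 1 / u) * (2 ^ (i * CARD('n)) * r powr (?d * (1 - 1 / u)))))"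
          using \<epsilon> by (intro mult_left_mono) auto
        also have "\<dots> = 2 ^ ?M * 2 * v powr (1 - 1 / u) * \<epsilon> * r powr (?d * (1 - 1 / u)) * ((1 / 2) ^ (i * ?M) * 2 ^ (i * CARD('n)))"
          by (simp only: mult_ac)
        also have "(1 / 2) ^ (i * ?M) * 2 ^ (i * CARD('n)) = (1 / 2 :: real) ^ i"
          by (simp add: power_add power_one_over field_simps)
        also have "?d * (1 - 1 / u) = ?d - ?d / u" by (simp add: algebra_simps)
        finally show "(2 ^ ?M * (1 / 2) ^ (i * ?M)) * (2 * \<epsilon> * (v * (2 powr i * r) powr ?d) powr (1 - 1 / u)) \<le> ?Q * (1 / 2) ^ i" .
      qed
      finally show "ennreal (2 ^ ?M * (1 / 2) ^ (i * ?M)) * (\<integral>\<^sup>+x\<in>ball x0 (2 ^ i * r). G x \<partial>lborel) \<le> ennreal (?Q * (1 / 2) ^ i)" .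
    qed
    also have "\<dots> = ennreal (\<Sum>i. ?Q * (1 / 2) ^ i)"
      using \<epsilon> by (intro suminf_ennreal2) (auto intro!: summable_mult summable_geometric)
    also have "(\<Sum>i. ?Q * (1 / 2) ^ i) = ?C * \<epsilon> * r powr (?d - ?d / u)"
      by (subst suminf_mult) (auto simp: suminf_geometric intro!: summable_geometric)
    finally show "(\<integral>\<^sup>+x. G x * ennreal (inverse ((1 + norm (x - x0) / r) ^ ?M)) \<partial>lborel)
      \<le> ennreal (?C * \<epsilon> * r powr (?d - ?d / u))" .
  qed
qed

section \<open>The lacunary series\<close>

text \<open>The support is the ball of radius 3/32 around a point of norm 7/8, so on its dilate by \<open>2 ^ j\<close> the
  \<open>j\<close>-th resolution function is 1 and all others vanish.\<close>

definition annulus_bump :: "(real^'n::finite \<Rightarrow> real) \<Rightarrow> real^'n \<Rightarrow> real" where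
  "annulus_bump \<phi>0 \<xi> = \<phi>0 (16 *\<^sub>R \<xi> + (- 14) *\<^sub>R axis undefined 1)"

text \<open>The phase becomes a translation after transforming: \<open>fourier\<close> is centred at
  \<open>a\<close> and \<open>inverse_fourier\<close> at \<open>- a\<close>. Therefore the series
  uses \<open>- x0\<close> and the test functions use \<open>x0\<close>.\<close>

definition freq_bump :: "(real^'n::finite \<Rightarrow> real) \<Rightarrow> nat \<Rightarrow> real^'n \<Rightarrow> real^'n \<Rightarrow> complex" where
  "freq_bump \<phi>0 j a \<xi> = iexp (\<xi> \<bullet> a) * of_real (annulus_bump \<phi>0 ((1 / 2 ^ j) *\<^sub>R \<xi>))"

lemma annulus_bump_support:
  fixes \<phi>0 :: "real^'n::finite \<Rightarrow> real"
  assumes rg: "resolution_generator \<phi>0" and nz: "annulus_bump \<phi>0 \<xi> \<noteq> 0"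
  shows "3 / 4 < norm \<xi>" "norm \<xi> < 1"
proof -
  let ?e = "axis undefined 1 :: real^'n"
  have "norm (16 *\<^sub>R \<xi> + (- 14) *\<^sub>R ?e) < 3 / 2"
    using rg nz unfolding annulus_bump_def resolution_generator_def by (meson not_less)
  moreover have "norm (16 *\<^sub>R \<xi>) \<le> norm (16 *\<^sub>R \<xi> + (- 14) *\<^sub>R ?e) + norm (14 *\<^sub>R ?e)"
    using norm_triangle_ineq[of "16 *\<^sub>R \<xi> + (- 14) *\<^sub>R ?e" "14 *\<^sub>R ?e"] by simp
  moreover have "norm (14 *\<^sub>R ?e) \<le> norm (16 *\<^sub>R \<xi>) + norm (16 *\<^sub>R \<xi> + (- 14) *\<^sub>R ?e)"
    using norm_triangle_ineq4[of "16 *\<^sub>R \<xi>" "16 *\<^sub>R \<xi> + (- 14) *\<^sub>R ?e"] by simp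
  ultimately show "3 / 4 < norm \<xi>" "norm \<xi> < 1" by simp_all
qed

lemma freq_bump_support:
  fixes \<phi>0 :: "real^'n::finite \<Rightarrow> real"
  assumes "resolution_generator \<phi>0" "freq_bump \<phi>0 j a \<xi> \<noteq> 0"
  shows "3 / 4 * 2 ^ j < norm \<xi>" "norm \<xi> < 2 ^ j"
  using annulus_bump_support[OF assms(1), of "(1 / 2 ^ j) *\<^sub>R \<xi>"] assms(2)
  by (auto simp: freq_bump_def field_simps)

lemma annulus_bump_schwartz:
  assumes "resolution_generator (\<phi>0 :: real^'n::finite \<Rightarrow> real)"
  shows "(\<lambda>\<xi>. of_real (annulus_bump \<phi>0 \<xi>) :: complex) \<in> schwartz"
  using schwartz_affine_comp[OF resolution_generator_schwartz[OF assms], of 16 "(- 14) *\<^sub>R axis undefined 1"]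
  unfolding annulus_bump_def by simp

lemma freq_bump_schwartz:
  assumes "resolution_generator (\<phi>0 :: real^'n::finite \<Rightarrow> real)"
  shows "freq_bump \<phi>0 j a \<in> schwartz"
  unfolding freq_bump_def[abs_def]
  using schwartz_mult[OF slowly_increasing_exp schwartz_affine_comp[OF annulus_bump_schwartz[OF assms], of "1 / 2 ^ j" 0]]
  by simp

text \<open>On the shell \<open>3/4 * 2 ^ j < norm \<xi> < 2 ^ j\<close> the dilate of
  \<open>\<phi>0\<close> by \<open>2 ^ m\<close> is 1 for \<open>m >= j\<close>, and 0 for
  \<open>m < j\<close> because \<open>3/4 * 2 ^ j >= 3/2 * 2 ^ m\<close>. A resolution function of
  positive index is a difference of consecutive dilates, so only the one with \<open>k = j\<close>
  survives.\<close>

lemma resolution_mult_freq_bump: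
  fixes \<phi>0 :: "real^'n::finite \<Rightarrow> real"
  assumes rg: "resolution_generator \<phi>0"
  shows "of_real (resolution \<phi>0 k \<xi>) * freq_bump \<phi>0 j a \<xi> = (if k = j then freq_bump \<phi>0 j a \<xi> else 0)"
proof (cases "freq_bump \<phi>0 j a \<xi> = 0")
  case False
  note supp = freq_bump_support[OF rg False]
  have inner: "\<phi>0 ((2 powi (- int m)) *\<^sub>R \<xi>) = 1" if "j \<le> m" for m
  proof -
    have "(2::real) ^ j \<le> 2 ^ m" using that by simp
    then have "norm \<xi> \<le> 2 ^ m" using supp(2) by linarith
    then show ?thesis using rg by (simp add: resolution_generator_def power_int_minus field_simps)
  qed
  have outer: "\<phi>0 ((2 powi (- int m)) *\<^sub>R \<xi>) = 0" if "m < j" for m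
  proof -
    have "(2::real) ^ Suc m \<le> 2 ^ j" using that by (intro power_increasing) auto
    then have "norm \<xi> \<ge> 3 / 2 * 2 ^ m" using supp(1) by simp
    then show ?thesis using rg by (simp add: resolution_generator_def power_int_minus field_simps)
  qed
  have "resolution \<phi>0 k \<xi> = (if k = j then 1 else 0)"
  proof (cases k)
    case 0
    then show ?thesis using inner[of 0] outer[of 0] by (cases "j = 0") (auto simp: resolution_def)
  next
    case (Suc m)
    have "- int k + 1 = - int m" using Suc by simp
    then have "resolution \<phi>0 k \<xi> = \<phi>0 ((2 powi (- int k)) *\<^sub>R \<xi>) - \<phi>0 ((2 powi (- int m)) *\<^sub>R \<xi>)"
      using Suc by (simp only: resolution_def) simp
    then show ?thesis using inner[of k] inner[of m] outer[of k] outer[of m] Suc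
      by (cases "k = j"; cases "j \<le> m") auto
  qed
  then show ?thesis by simp
qed simp

lemma fourier_freq_bump:
  fixes \<phi>0 :: "real^'n::finite \<Rightarrow> real"
  assumes rg: "resolution_generator \<phi>0"
  shows "fourier (freq_bump \<phi>0 j a) x =
    2 ^ (j * CARD('n)) * fourier (\<lambda>\<xi>. of_real (annulus_bump \<phi>0 \<xi>)) (2 ^ j *\<^sub>R (x - a))"
proof -
  have m: "(\<lambda>\<xi>. iexp (\<xi> \<bullet> - x) * freq_bump \<phi>0 j a \<xi>) \<in> borel_measurable borel"
    using schwartz_borel[OF freq_bump_schwartz[OF rg]] by measurable
  have "(LINT \<xi>|lborel. iexp (\<xi> \<bullet> - x) * freq_bump \<phi>0 j a \<xi>)
    = \<bar>2 ^ j\<bar> ^ CARD('n) *\<^sub>R (LINT \<xi>|lborel. iexp ((0 + 2 ^ j *\<^sub>R \<xi>) \<bullet> - x) * freq_bump \<phi>0 j a (0 + 2 ^ j *\<^sub>R \<xi>))"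
    using integral_lborel_affine[OF m, of "2 ^ j" 0] by simp
  also have "\<dots> = 2 ^ (j * CARD('n)) *
      (LINT \<xi>|lborel. iexp (\<xi> \<bullet> - (2 ^ j *\<^sub>R (x - a))) * of_real (annulus_bump \<phi>0 \<xi>))"
  proof -
    have "iexp ((0 + 2 ^ j *\<^sub>R \<xi>) \<bullet> - x) * freq_bump \<phi>0 j a (0 + 2 ^ j *\<^sub>R \<xi>)
       = iexp (\<xi> \<bullet> - (2 ^ j *\<^sub>R (x - a))) * of_real (annulus_bump \<phi>0 \<xi>)" for \<xi> :: "real^'n"
      by (simp add: freq_bump_def inner_diff_right algebra_simps flip: exp_add)
    then show ?thesis by (simp add: scaleR_conv_of_real power_mult)
  qed
  finally show ?thesis unfolding fourier_eq by simp
qed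

lemma inverse_fourier_freq_bump:
  fixes \<phi>0 :: "real^'n::finite \<Rightarrow> real"
  assumes rg: "resolution_generator \<phi>0"
  shows "inverse_fourier (freq_bump \<phi>0 j (- a)) x =
    2 ^ (j * CARD('n)) * inverse_fourier (\<lambda>\<xi>. of_real (annulus_bump \<phi>0 \<xi>)) (2 ^ j *\<^sub>R (x - a))"
proof -
  have "2 ^ j *\<^sub>R (- x - - a) = - (2 ^ j *\<^sub>R (x - a))" by (simp add: algebra_simps)
  then show ?thesis unfolding inverse_fourier_eq_fourier fourier_freq_bump[OF rg] by simp
qed

text \<open>The lacunary series \<open>\<Sum>j. 2 powr (j \<delta>) \<psi> (2 ^ j (x - x0))\<close> with the Schwartz function
  \<open>\<psi> = inverse_fourier (annulus_bump \<phi>0)\<close>; it behaves like \<open>norm (x - x0) powr (- \<delta>)\<close> near \<open>x0\<close>.\<close>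

definition lacunary :: "(real^'n::finite \<Rightarrow> real) \<Rightarrow> real \<Rightarrow> real^'n \<Rightarrow> (real^'n \<Rightarrow> complex) \<Rightarrow> complex" where
  "lacunary \<phi>0 \<delta> x0 w = (if w \<in> schwartz then
     (\<Sum>j. of_real (2 powr (real j * (\<delta> - real CARD('n)))) *
        (LINT x|lborel. inverse_fourier (freq_bump \<phi>0 j (- x0)) x * w x)) else 0)"

text \<open>The functions paired with \<open>w\<close> are dilates of one Schwartz function
  normalised in \<open>L^1\<close>, so their \<open>L^1\<close> norm, which is \<open>A\<close>,
  does not depend on \<open>j\<close>.\<close>

lemma lacunary_term_bound:
  fixes \<phi>0 :: "real^'n::finite \<Rightarrow> real"
  assumes rg: "resolution_generator \<phi>0"
  obtains A where "A \<ge> 0" "\<And>j w b. w \<in> schwartz \<Longrightarrow> (\<And>x. cmod (w x) \<le> b) \<Longrightarrow>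
    cmod (LINT x|lborel. inverse_fourier (freq_bump \<phi>0 j (- x0)) x * w x) \<le> A * b"
proof -
  let ?\<psi> = "inverse_fourier (\<lambda>\<xi>. of_real (annulus_bump \<phi>0 \<xi>) :: complex)"
  have \<psi>: "?\<psi> \<in> schwartz" by (intro inverse_fourier_schwartz annulus_bump_schwartz rg)
  note [measurable] = schwartz_borel[OF \<psi>]
  show thesis
  proof (rule that[of "LINT x|lborel. cmod (?\<psi> x)"])
    fix j and w :: "real^'n \<Rightarrow> complex" and b :: real
    assume w: "w \<in> schwartz" "\<And>x. cmod (w x) \<le> b"
    let ?f = "inverse_fourier (freq_bump \<phi>0 j (- x0))"
    have f: "?f \<in> schwartz" by (intro inverse_fourier_schwartz freq_bump_schwartz rg)
    have "cmod (LINT x|lborel. ?f x * w x) \<le> (LINT x|lborel. cmod (?f x) * b)"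
    proof (rule Bochner_Integration.integral_norm_bound_integral)
      show "integrable lborel (\<lambda>x. ?f x * w x)"
        by (intro schwartz_integrable schwartz_mult schwartz_slowly_increasing f w)
      show "integrable lborel (\<lambda>x. cmod (?f x) * b)"
        by (intro integrable_mult_left integrable_norm schwartz_integrable f)
      show "cmod (?f x * w x) \<le> cmod (?f x) * b" for x
        unfolding norm_mult by (intro mult_left_mono w) auto
    qed
    also have "\<dots> = (LINT x|lborel. cmod (?f x)) * b" by simp
    also have "(LINT x|lborel. cmod (?f x)) = (LINT x|lborel. cmod (?\<psi> x))"
    proof -
      have "(LINT x|lborel. cmod (?\<psi> x)) = 2 ^ (j * CARD('n)) * (LINT x|lborel. cmod (?\<psi> (- (2 ^ j *\<^sub>R x0) + 2 ^ j *\<^sub>R x)))"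
        using integral_lborel_affine[of "\<lambda>x. cmod (?\<psi> x)" "2 ^ j" "- (2 ^ j *\<^sub>R x0)"]
        by (simp add: power_mult)
      then show ?thesis
        unfolding inverse_fourier_freq_bump[OF rg] norm_mult
        by (simp add: norm_power algebra_simps)
    qed
    finally show "cmod (LINT x|lborel. ?f x * w x) \<le> (LINT x|lborel. cmod (?\<psi> x)) * b" .
  qed simp
qed

text \<open>The weights form a geometric series with ratio \<open>2 powr (\<delta> - d) < 1\<close>.
  The bound involves the sup norm of \<open>w\<close> alone, so the distribution has order
  0.\<close>

lemma lacunary_bound:
  fixes \<phi>0 :: "real^'n::finite \<Rightarrow> real"
  assumes rg: "resolution_generator \<phi>0" and \<delta>: "\<delta> < real CARD('n)"
  obtains C where "C \<ge> 0"
    "\<And>w. w \<in> schwartz \<Longrightarrow> summable (\<lambda>j. of_real (2 powr (real j * (\<delta> - real CARD('n)))) *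
        (LINT x|lborel. inverse_fourier (freq_bump \<phi>0 j (- x0)) x * w x))"
    "\<And>w b. w \<in> schwartz \<Longrightarrow> (\<And>x. cmod (w x) \<le> b) \<Longrightarrow> cmod (lacunary \<phi>0 \<delta> x0 w) \<le> C * b"
proof -
  obtain A where A: "A \<ge> 0" "\<And>j w b. w \<in> schwartz \<Longrightarrow> (\<And>x. cmod (w x) \<le> b) \<Longrightarrow>
    cmod (LINT x|lborel. inverse_fourier (freq_bump \<phi>0 j (- x0)) x * w x) \<le> A * b"
    using lacunary_term_bound[OF rg, of x0] by blast
  define \<rho> where "\<rho> = 2 powr (\<delta> - real CARD('n))"
  have \<rho>: "0 < \<rho>" "\<rho> < 1" using \<delta> by (auto simp: \<rho>_def intro!: powr_less_one)
  have pw: "2 powr (real j * (\<delta> - real CARD('n))) = \<rho> ^ j" for j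
    unfolding \<rho>_def by (simp add: powr_powr mult.commute flip: powr_realpow)
  let ?T = "\<lambda>w j. of_real (2 powr (real j * (\<delta> - real CARD('n)))) *
        (LINT x|lborel. inverse_fourier (freq_bump \<phi>0 j (- x0)) x * w x)"
  have T: "cmod (?T w j) \<le> \<rho> ^ j * (A * b)" if "w \<in> schwartz" "\<And>x. cmod (w x) \<le> b" for w b j
    unfolding pw norm_mult using A(2)[OF that] \<rho> by (simp add: norm_power mult_left_mono)
  have geo: "summable (\<lambda>j. \<rho> ^ j * B)" for B using \<rho> by (intro summable_mult2 summable_geometric) auto
  have sn: "summable (\<lambda>j. cmod (?T w j))" if w: "w \<in> schwartz" for w
  proof -
    obtain b where "\<And>x. cmod (w x) \<le> b" using schwartz_decay[OF w, of 0] by auto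
    then show ?thesis by (intro summable_comparison_test[OF _ geo[of "A * b"]]) (use T[OF w] in auto)
  qed
  show thesis
  proof (rule that[of "A / (1 - \<rho>)"])
    show "A / (1 - \<rho>) \<ge> 0" using A \<rho> by simp
    show "summable (?T w)" if "w \<in> schwartz" for w by (rule summable_norm_cancel[OF sn[OF that]])
    fix w :: "real^'n \<Rightarrow> complex" and b :: real
    assume w: "w \<in> schwartz" "\<And>x. cmod (w x) \<le> b"
    have "cmod (lacunary \<phi>0 \<delta> x0 w) \<le> (\<Sum>j. cmod (?T w j))"
      using summable_norm[OF sn[OF w(1)]] w by (simp add: lacunary_def)
    also have "\<dots> \<le> (\<Sum>j. \<rho> ^ j * (A * b))" by (intro suminf_le T w sn geo)
    also have "\<dots> = A / (1 - \<rho>) * b"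
      using \<rho> by (subst suminf_mult2[symmetric]) (auto simp: suminf_geometric intro!: summable_geometric)
    finally show "cmod (lacunary \<phi>0 \<delta> x0 w) \<le> A / (1 - \<rho>) * b" .
  qed
qed

lemma lacunary_linear:
  fixes \<phi>0 :: "real^'n::finite \<Rightarrow> real"
  assumes rg: "resolution_generator \<phi>0" and \<delta>: "\<delta> < real CARD('n)"
  shows "linear_functional_on schwartz (lacunary \<phi>0 \<delta> x0)"
  unfolding linear_functional_on_def
proof (intro ballI allI)
  fix f g :: "real^'n \<Rightarrow> complex" and a b
  assume f: "f \<in> schwartz" and g: "g \<in> schwartz"
  let ?w = "\<lambda>j. of_real (2 powr (real j * (\<delta> - real CARD('n)))) :: complex"
  let ?I = "\<lambda>j w. LINT x|lborel. inverse_fourier (freq_bump \<phi>0 j (- x0)) x * w x"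
  have S: "summable (\<lambda>j. ?w j * ?I j h)" if "h \<in> schwartz" for h
    by (rule lacunary_bound[OF rg \<delta>, of x0]) (blast intro: that)
  have int: "integrable lborel (\<lambda>x. inverse_fourier (freq_bump \<phi>0 j (- x0)) x * h x)" if "h \<in> schwartz" for h j
    by (intro schwartz_integrable schwartz_mult schwartz_slowly_increasing inverse_fourier_schwartz freq_bump_schwartz rg that)
  have I: "?I j (\<lambda>x. a * f x + b * g x) = a * ?I j f + b * ?I j g" for j
  proof -
    have "?I j (\<lambda>x. a * f x + b * g x) = (LINT x|lborel. a * (inverse_fourier (freq_bump \<phi>0 j (- x0)) x * f x)
        + b * (inverse_fourier (freq_bump \<phi>0 j (- x0)) x * g x))"
      by (intro Bochner_Integration.integral_cong refl) (simp add: algebra_simps)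
    then show ?thesis using int[OF f] int[OF g] by simp
  qed
  have "(\<Sum>j. ?w j * ?I j (\<lambda>x. a * f x + b * g x)) = (\<Sum>j. a * (?w j * ?I j f) + b * (?w j * ?I j g))"
    unfolding I by (intro suminf_cong) (simp add: algebra_simps)
  also have "\<dots> = a * (\<Sum>j. ?w j * ?I j f) + b * (\<Sum>j. ?w j * ?I j g)"
    using S[OF f] S[OF g] by (simp add: suminf_mult summable_mult flip: suminf_add)
  finally show "lacunary \<phi>0 \<delta> x0 (\<lambda>x. a * f x + b * g x) = a * lacunary \<phi>0 \<delta> x0 f + b * lacunary \<phi>0 \<delta> x0 g"
    using f g schwartz_add[OF schwartz_cmult[OF f, of a] schwartz_cmult[OF g, of b]] by (simp add: lacunary_def)
qed

lemma schwartz_le_seminorm: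
  assumes "w \<in> schwartz"
  shows "cmod (w x) \<le> seminorm 0 0 w"
proof -
  obtain b where b: "\<And>x. cmod (w x) \<le> b" using schwartz_decay[OF assms, of 0] by auto
  show ?thesis unfolding seminorm_def
    using cSUP_upper[of "(x, [])" "UNIV \<times> {js. length js \<le> 0}" "\<lambda>(x, js). (1 + norm x) ^ 0 * cmod (partials js w x)"]
      bdd_aboveI2[of "UNIV \<times> {js. length js \<le> 0}" "\<lambda>(x, js). (1 + norm x) ^ 0 * cmod (partials js w x)" b] b
    by auto
qed

lemma linear_functional_cmult:
  "linear_functional_on D h \<Longrightarrow> linear_functional_on D (\<lambda>w. c * h w)"
  by (simp add: linear_functional_on_def algebra_simps)

lemma lacunary_tempered:
  fixes \<phi>0 :: "real^'n::finite \<Rightarrow> real"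
  assumes rg: "resolution_generator \<phi>0" and \<delta>: "\<delta> < real CARD('n)"
  shows "(\<lambda>w. c * lacunary \<phi>0 \<delta> x0 w) \<in> tempered_distributions"
proof -
  obtain C where C: "\<And>w b. w \<in> schwartz \<Longrightarrow> (\<And>x. cmod (w x) \<le> b) \<Longrightarrow> cmod (lacunary \<phi>0 \<delta> x0 w) \<le> C * b"
    by (rule lacunary_bound[OF rg \<delta>, of x0]) blast
  have "cmod (c * lacunary \<phi>0 \<delta> x0 w) \<le> (cmod c * C) * seminorm 0 0 w" if "w \<in> schwartz" for w
    using mult_left_mono[OF C[OF that schwartz_le_seminorm[OF that]] norm_ge_zero[of c]]
    by (simp add: norm_mult mult.assoc)
  then show ?thesis
    using linear_functional_cmult[OF lacunary_linear[OF rg \<delta>]]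
    unfolding tempered_distributions_def by (auto simp: lacunary_def)
qed

text \<open>Moved to the frequency side by \<open>fourier_pairing\<close>, the \<open>j\<close>-th
  term meets the \<open>k\<close>-th resolution function, and the product is 0 unless
  \<open>j = k\<close>.\<close>

lemma frequency_piece_lacunary:
  fixes \<phi>0 :: "real^'n::finite \<Rightarrow> real"
  assumes rg: "resolution_generator \<phi>0" and \<delta>: "\<delta> < real CARD('n)"
  shows "frequency_piece \<phi>0 k (\<lambda>w. c * lacunary \<phi>0 \<delta> x0 w) =
    (\<lambda>x. c * of_real (2 powr (real k * (\<delta> - real CARD('n)))) * inverse_fourier (freq_bump \<phi>0 k (- x0)) x)"
    (is "_ = ?H")
proof (rule frequency_piece_eqI[OF rg])
  have inv: "inverse_fourier (freq_bump \<phi>0 j (- x0)) \<in> schwartz" for j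
    by (intro inverse_fourier_schwartz freq_bump_schwartz rg)
  have H: "?H \<in> schwartz" by (intro schwartz_cmult inv)
  show "continuous_on UNIV ?H" by (rule schwartz_continuous[OF H])
  fix w :: "real^'n \<Rightarrow> complex" assume w: "w \<in> schwartz"
  show "integrable lborel (\<lambda>x. ?H x * w x)"
    by (intro schwartz_integrable schwartz_mult schwartz_slowly_increasing H w)
  let ?b = "\<lambda>\<xi>. of_real (resolution \<phi>0 k \<xi>) * inverse_fourier w \<xi>"
  have b: "?b \<in> schwartz"
    by (intro schwartz_mult schwartz_slowly_increasing resolution_schwartz rg inverse_fourier_schwartz w)
  have I: "(LINT x|lborel. inverse_fourier (freq_bump \<phi>0 j (- x0)) x * fourier ?b x)
      = (if j = k then (LINT x|lborel. inverse_fourier (freq_bump \<phi>0 k (- x0)) x * w x) else 0)" for j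
  proof -
    have "(LINT x|lborel. inverse_fourier (freq_bump \<phi>0 j (- x0)) x * fourier ?b x)
       = (LINT \<xi>|lborel. freq_bump \<phi>0 j (- x0) \<xi> * ?b \<xi>)"
      by (rule fourier_pairing[OF freq_bump_schwartz[OF rg] b])
    also have "\<dots> = (LINT \<xi>|lborel. (of_real (resolution \<phi>0 k \<xi>) * freq_bump \<phi>0 j (- x0) \<xi>) * inverse_fourier w \<xi>)"
      by (simp only: mult_ac)
    also have "\<dots> = (if j = k then (LINT \<xi>|lborel. freq_bump \<phi>0 k (- x0) \<xi> * inverse_fourier w \<xi>) else 0)"
      unfolding resolution_mult_freq_bump[OF rg] by auto
    also have "(LINT \<xi>|lborel. freq_bump \<phi>0 k (- x0) \<xi> * inverse_fourier w \<xi>)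
        = (LINT x|lborel. inverse_fourier (freq_bump \<phi>0 k (- x0)) x * w x)"
      by (rule inverse_fourier_multiplication_formula[symmetric])
        (intro schwartz_integrable freq_bump_schwartz rg w)+
    finally show ?thesis .
  qed
  have "lacunary \<phi>0 \<delta> x0 (fourier ?b) = of_real (2 powr (real k * (\<delta> - real CARD('n)))) *
      (LINT x|lborel. inverse_fourier (freq_bump \<phi>0 k (- x0)) x * w x)"
    unfolding lacunary_def I using fourier_schwartz[OF b] by (subst suminf_finite[of "{k}"]) auto
  then show "c * lacunary \<phi>0 \<delta> x0 (fourier ?b) = (LINT x|lborel. ?H x * w x)"
    by (simp add: mult.assoc)
qed

text \<open>Only the term of index \<open>j\<close> survives. In it the opposite phases cancel and
  leave the integral of a dilated square, that is \<open>2 ^ (j d) * \<kappa>\<close>, which raises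
  the weight \<open>2 powr (j (\<delta> - d))\<close> to \<open>2 powr (j \<delta>)\<close>.
  Positivity of \<open>\<kappa>\<close> comes from the ball on which the bump is 1.\<close>

lemma lacunary_fourier_freq_bump:
  fixes \<phi>0 :: "real^'n::finite \<Rightarrow> real"
  assumes rg: "resolution_generator \<phi>0"
  obtains \<kappa> where "\<kappa> > 0" "\<And>j. lacunary \<phi>0 \<delta> x0 (fourier (freq_bump \<phi>0 j x0)) = of_real (2 powr (real j * \<delta>) * \<kappa>)"
proof -
  let ?\<eta> = "annulus_bump \<phi>0"
  define \<kappa> where "\<kappa> = (LINT \<xi>|lborel. (?\<eta> \<xi>)\<^sup>2)"
  have sq: "(\<lambda>\<xi>. of_real ((?\<eta> \<xi>)\<^sup>2) :: complex) \<in> schwartz"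
    using schwartz_mult[OF schwartz_slowly_increasing[OF annulus_bump_schwartz[OF rg]] annulus_bump_schwartz[OF rg]]
    by (simp add: power2_eq_square)
  have int: "integrable lborel (\<lambda>\<xi>. (?\<eta> \<xi>)\<^sup>2)"
    using schwartz_integrable[OF sq] by (simp only: complex_of_real_integrable_eq)
  have "\<kappa> > 0" unfolding \<kappa>_def
    by (rule integral_pos_of_ball[OF int, of "- ((- 14) *\<^sub>R axis undefined 1) /\<^sub>R 16" "1 / 16"])
      (use bump_eq_1[OF rg, of 16] in \<open>simp_all add: annulus_bump_def del: scaleR_minus_left\<close>)
  moreover have "lacunary \<phi>0 \<delta> x0 (fourier (freq_bump \<phi>0 j x0)) = of_real (2 powr (real j * \<delta>) * \<kappa>)" for j
  proof -
    have I: "(LINT x|lborel. inverse_fourier (freq_bump \<phi>0 i (- x0)) x * fourier (freq_bump \<phi>0 j x0) x)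
      = (if i = j then of_real (2 ^ (j * CARD('n)) * \<kappa>) else 0)" for i
    proof -
      have "(LINT x|lborel. inverse_fourier (freq_bump \<phi>0 i (- x0)) x * fourier (freq_bump \<phi>0 j x0) x)
         = (LINT \<xi>|lborel. freq_bump \<phi>0 i (- x0) \<xi> * freq_bump \<phi>0 j x0 \<xi>)"
        by (intro fourier_pairing freq_bump_schwartz rg)
      also have "\<dots> = (if i = j then of_real (2 ^ (j * CARD('n)) * \<kappa>) else 0)"
      proof (cases "i = j")
        case True
        have "freq_bump \<phi>0 j (- x0) \<xi> * freq_bump \<phi>0 j x0 \<xi> = of_real ((?\<eta> ((1 / 2 ^ j) *\<^sub>R \<xi>))\<^sup>2)" for \<xi>
          by (simp add: freq_bump_def power2_eq_square exp_minus)
        moreover have "(LINT \<xi>|lborel. of_real ((?\<eta> \<xi>)\<^sup>2) :: complex) =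
            \<bar>1 / 2 ^ j\<bar> ^ CARD('n) *\<^sub>R (LINT \<xi>|lborel. of_real ((?\<eta> (0 + (1 / 2 ^ j) *\<^sub>R \<xi>))\<^sup>2))"
          using integral_lborel_affine[OF schwartz_borel[OF sq], of "1 / 2 ^ j" 0] by simp
        ultimately show ?thesis using True
          by (simp add: \<kappa>_def scaleR_conv_of_real power_mult power_one_over field_simps del: of_real_power)
      next
        case False
        \<comment> \<open>At a common point of the two supports the \<open>i\<close>-th resolution
          function would have both values 1 and 0.\<close>
        have z: "freq_bump \<phi>0 i (- x0) \<xi> * freq_bump \<phi>0 j x0 \<xi> = 0" for \<xi>
        proof (rule ccontr)
          assume "freq_bump \<phi>0 i (- x0) \<xi> * freq_bump \<phi>0 j x0 \<xi> \<noteq> 0"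
          then have "freq_bump \<phi>0 i (- x0) \<xi> \<noteq> 0" "freq_bump \<phi>0 j x0 \<xi> \<noteq> 0" by auto
          then have "of_real (resolution \<phi>0 i \<xi>) = (1::complex)" "of_real (resolution \<phi>0 i \<xi>) = (0::complex)"
            using resolution_mult_freq_bump[OF rg, of i \<xi> i "- x0"] resolution_mult_freq_bump[OF rg, of i \<xi> j x0] False
            by auto
          then show False by simp
        qed
        show ?thesis unfolding z using False by simp
      qed
      finally show ?thesis .
    qed
    have "lacunary \<phi>0 \<delta> x0 (fourier (freq_bump \<phi>0 j x0)) =
        of_real (2 powr (real j * (\<delta> - real CARD('n)))) * of_real (2 ^ (j * CARD('n)) * \<kappa>)"
      unfolding lacunary_def I using fourier_schwartz[OF freq_bump_schwartz[OF rg]]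
      by (subst suminf_finite[of "{j}"]) auto
    also have "\<dots> = of_real ((2 powr (real j * (\<delta> - real CARD('n))) * 2 ^ (j * CARD('n))) * \<kappa>)" by simp
    also have "2 powr (real j * (\<delta> - real CARD('n))) * 2 ^ (j * CARD('n)) = 2 powr (real j * \<delta>)"
      by (simp add: algebra_simps flip: powr_realpow powr_add)
    finally show ?thesis .
  qed
  ultimately show thesis by (rule that)
qed

text \<open>By \<open>s + \<delta> = d / u\<close> the \<open>k\<close>-th weighted piece has size
  \<open>2 powr (k d / u)\<close> times the profile at \<open>2 ^ k (x - x0)\<close>, and the
  profile decays at least with exponent \<open>2 d / u\<close>. \<open>dyadic_sum_bound\<close> with
  \<open>\<beta> = d / u\<close> sums these to the singular function of
  \<open>morrey_norm_singular\<close>. The multiple \<open>c\<close> is carried along because the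
  interpolation argument evaluates the norm on the whole line spanned by the series.\<close>

lemma lacunary_LTM_norm:
  fixes \<phi>0 :: "real^'n::finite \<Rightarrow> real"
  assumes rg: "resolution_generator \<phi>0" and \<delta>: "\<delta> < real CARD('n)"
    and p: "1 \<le> p" "p < u" and q: "1 \<le> q" and s: "s + \<delta> = real CARD('n) / u"
  obtains B where "B \<ge> 0" "\<And>c. LTM_norm \<phi>0 s u p q (\<lambda>w. c * lacunary \<phi>0 \<delta> x0 w) \<le> ennreal (cmod c * B)"
proof -
  let ?\<beta> = "real CARD('n) / u"
  let ?\<psi> = "inverse_fourier (\<lambda>\<xi>. of_real (annulus_bump \<phi>0 \<xi>) :: complex)"
  have \<beta>: "?\<beta> > 0" using p by simp
  obtain M where M: "2 * ?\<beta> \<le> real M" using real_arch_simple by blast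
  have \<psi>: "?\<psi> \<in> schwartz" by (intro inverse_fourier_schwartz annulus_bump_schwartz rg)
  obtain D where D: "D > 0" "\<And>x. (1 + norm x) ^ M * cmod (?\<psi> x) \<le> D" using schwartz_decay[OF \<psi>] by metis
  have \<psi>le: "cmod (?\<psi> x) \<le> D * (1 + norm x) powr (- 2 * ?\<beta>)" for x
  proof -
    have "cmod (?\<psi> x) \<le> D * (1 + norm x) powr (- real M)"
      using D(2)[of x] by (simp add: powr_minus powr_realpow add_pos_nonneg field_simps)
    also have "\<dots> \<le> D * (1 + norm x) powr (- 2 * ?\<beta>)" using M D(1) by (intro mult_left_mono powr_mono) auto
    finally show ?thesis .
  qed
  obtain C where C: "C > 0" "\<And>t n. t > 0 \<Longrightarrow>
    (\<Sum>k<n. 2 powr (real k * ?\<beta>) * (1 + 2 ^ k * t) powr (- 2 * ?\<beta>)) \<le> C * t powr (- ?\<beta>)"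
    by (rule dyadic_sum_bound[OF \<beta>]) (rule that)
  show thesis
  proof (rule morrey_norm_singular[OF p, of x0])
  fix E :: real assume E: "E > 0" "\<And>A G. 0 \<le> A \<Longrightarrow>
    (\<And>x. x \<noteq> x0 \<Longrightarrow> G x \<le> ennreal (A * norm (x - x0) powr (- ?\<beta>))) \<Longrightarrow>
    morrey_norm u p G \<le> ennreal (A * E)"
  show thesis
  proof (rule that[of "D * C * E"])
    show "D * C * E \<ge> 0" using C D E by simp
    fix c :: complex
    let ?a = "\<lambda>x k. 2 powr (real k * s) * cmod (frequency_piece \<phi>0 k (\<lambda>w. c * lacunary \<phi>0 \<delta> x0 w) x)"
    have a: "?a x k \<le> (cmod c * D) * (2 powr (real k * ?\<beta>) * (1 + 2 ^ k * norm (x - x0)) powr (- 2 * ?\<beta>))" for x k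
    proof -
      have "?a x k = cmod c * (2 powr (real k * s) * 2 powr (real k * (\<delta> - real CARD('n))) * 2 ^ (k * CARD('n)))
          * cmod (?\<psi> (2 ^ k *\<^sub>R (x - x0)))"
        unfolding frequency_piece_lacunary[OF rg \<delta>] inverse_fourier_freq_bump[OF rg]
        by (simp add: norm_mult norm_power)
      also have "2 powr (real k * s) * 2 powr (real k * (\<delta> - real CARD('n))) * 2 ^ (k * CARD('n)) = 2 powr (real k * ?\<beta>)"
        unfolding s[symmetric] by (simp add: algebra_simps flip: powr_realpow powr_add)
      also have "cmod c * 2 powr (real k * ?\<beta>) * cmod (?\<psi> (2 ^ k *\<^sub>R (x - x0)))
          \<le> cmod c * 2 powr (real k * ?\<beta>) * (D * (1 + norm (2 ^ k *\<^sub>R (x - x0))) powr (- 2 * ?\<beta>))"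
        by (intro mult_left_mono \<psi>le) auto
      finally show ?thesis by (simp add: mult_ac)
    qed
    have "lq_norm q (?a x) \<le> ennreal ((cmod c * D * C) * norm (x - x0) powr (- ?\<beta>))" if x: "x \<noteq> x0" for x
    proof (rule lq_norm_le[OF q])
      fix n
      have "(\<Sum>k<n. \<bar>?a x k\<bar>) \<le> (\<Sum>k<n. (cmod c * D) * (2 powr (real k * ?\<beta>) * (1 + 2 ^ k * norm (x - x0)) powr (- 2 * ?\<beta>)))"
        using a by (intro sum_mono) (simp add: abs_mult)
      also have "\<dots> = (cmod c * D) * (\<Sum>k<n. 2 powr (real k * ?\<beta>) * (1 + 2 ^ k * norm (x - x0)) powr (- 2 * ?\<beta>))"
        by (simp add: sum_distrib_left)
      also have "\<dots> \<le> (cmod c * D) * (C * norm (x - x0) powr (- ?\<beta>))"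
        using x D by (intro mult_left_mono C(2)) auto
      finally show "(\<Sum>k<n. \<bar>?a x k\<bar>) \<le> (cmod c * D * C) * norm (x - x0) powr (- ?\<beta>)" by (simp add: mult.assoc)
    qed
    then have "morrey_norm u p (\<lambda>x. lq_norm q (?a x)) \<le> ennreal ((cmod c * D * C) * E)"
      using C D by (intro E(2)) auto
    then show "LTM_norm \<phi>0 s u p q (\<lambda>w. c * lacunary \<phi>0 \<delta> x0 w) \<le> ennreal (cmod c * (D * C * E))"
      using lacunary_tempered[OF rg \<delta>] by (simp add: LTM_norm_def mult.assoc)
  qed
  qed
qed

section \<open>Testing against concentrating functions\<close>

text \<open>Made for the complement \<open>1 - cut\<close> of a cut-off. A constant plus a Schwartz
  function has Schwartz derivatives, so such sums form the required class.\<close>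

lemma slowly_increasing_const_diff:
  fixes f :: "real^'n::finite \<Rightarrow> complex"
  assumes "f \<in> schwartz"
  shows "(\<lambda>x. c - f x) \<in> slowly_increasing"
proof (rule slowly_increasing_coinduct)
  let ?A = "{\<lambda>x. c + f x |c f. f \<in> schwartz} :: (real^'n \<Rightarrow> complex) set"
  show "(\<lambda>x. c - f x) \<in> ?A"
    using schwartz_cmult[OF assms, of "- 1"]
    by (intro CollectI exI[of _ c] exI[of _ "\<lambda>x. (- 1) * f x"] conjI) auto
  fix g assume "g \<in> ?A"
  then obtain c f where g: "g = (\<lambda>x. c + f x)" and f: "f \<in> schwartz" by blast
  show "g differentiable (at x)" for x
    unfolding g by (intro differentiable_add differentiable_const schwartz_differentiable f)
  have "partial i g = (\<lambda>x. 0 + partial i f x)" for i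
    unfolding g by (auto simp: partial_add partial_const schwartz_differentiable[OF f])
  then show "partial i g \<in> ?A" for i using schwartz_partial[OF f, of i] by blast
  obtain C where C: "\<And>x. (1 + norm x) ^ 0 * cmod (f x) \<le> C" using schwartz_decay[OF f] by metis
  have "cmod (g x) \<le> (cmod c + C) * (1 + norm x) ^ 0" for x
    unfolding g using norm_triangle_ineq[of c "f x"] C[of x] by simp
  then show "\<exists>C N. \<forall>x. cmod (g x) \<le> C * (1 + norm x) ^ N" by blast
qed

lemma partials_sum_closure:
  fixes B :: "('k \<Rightarrow> real^'n::finite \<Rightarrow> complex) set"
  assumes "f \<in> sum_closure B"
    and "\<And>f k x. f \<in> B \<Longrightarrow> f k differentiable (at x)"
    and "\<And>f i. f \<in> B \<Longrightarrow> (\<lambda>k. partial i (f k)) \<in> sum_closure B"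
  shows "(\<lambda>k. partials js (f k)) \<in> sum_closure B"
proof (induction js)
  case (Cons i js)
  have "(\<forall>k x. partials js (f k) differentiable (at x)) \<and> (\<forall>i. (\<lambda>k. partial i (partials js (f k))) \<in> sum_closure B)"
    by (rule sum_closure_partial[OF Cons]) (rule assms, assumption)+
  then show ?case by simp
qed (simp add: assms(1))

text \<open>A derivative falls either on \<open>v\<close>, which stays 0 on the ball, or on
  \<open>\<Psi>\<close>, which produces a factor \<open>2 ^ j\<close>; the exponent \<open>m\<close>
  collects these factors. The members are sequences in \<open>j\<close> because the bounds have to
  tend to 0 as \<open>j\<close> grows.\<close>

definition concentrating_family :: "real^'n::finite \<Rightarrow> real \<Rightarrow> (nat \<Rightarrow> real^'n \<Rightarrow> complex) set" where
  "concentrating_family x0 r = {\<lambda>j x. 2 ^ (j * m) * (v x * \<Psi> (2 ^ j *\<^sub>R x + - (2 ^ j *\<^sub>R x0))) |m v \<Psi>.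
     v \<in> slowly_increasing \<and> (\<forall>x\<in>ball x0 r. v x = 0) \<and> \<Psi> \<in> schwartz}"

lemma concentrating_family_diff:
  assumes "f \<in> concentrating_family x0 r"
  shows "f j differentiable (at x)"
proof -
  obtain m v \<Psi> where f: "f = (\<lambda>j x. 2 ^ (j * m) * (v x * \<Psi> (2 ^ j *\<^sub>R x + - (2 ^ j *\<^sub>R x0))))"
    "v \<in> slowly_increasing" "\<Psi> \<in> schwartz" using assms unfolding concentrating_family_def by blast
  have "(\<lambda>x. \<Psi> (2 ^ j *\<^sub>R x + - (2 ^ j *\<^sub>R x0))) differentiable (at x)"
    by (rule schwartz_differentiable[OF schwartz_affine_comp[OF f(3)]]) simp
  then show ?thesis unfolding f(1)
    by (intro differentiable_mult differentiable_const slowly_increasing_differentiable[OF f(2)])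
qed

lemma concentrating_family_partial:
  assumes "f \<in> concentrating_family x0 r"
  shows "(\<lambda>j. partial i (f j)) \<in> sum_closure (concentrating_family x0 r)"
proof -
  obtain m v \<Psi> where f: "f = (\<lambda>j x. 2 ^ (j * m) * (v x * \<Psi> (2 ^ j *\<^sub>R x + - (2 ^ j *\<^sub>R x0))))"
    "v \<in> slowly_increasing" "\<forall>x\<in>ball x0 r. v x = 0" "\<Psi> \<in> schwartz"
    using assms unfolding concentrating_family_def by blast
  let ?P = "\<lambda>j x. \<Psi> (2 ^ j *\<^sub>R x + - (2 ^ j *\<^sub>R x0))"
  let ?g = "\<lambda>j x. 2 ^ (j * m) * (partial i v x * \<Psi> (2 ^ j *\<^sub>R x + - (2 ^ j *\<^sub>R x0)))"
  let ?h = "\<lambda>j x. 2 ^ (j * (m + 1)) * (v x * partial i \<Psi> (2 ^ j *\<^sub>R x + - (2 ^ j *\<^sub>R x0)))"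
  have "partial i v x = 0" if "x \<in> ball x0 r" for x
    using partial_zero_outside[of "ball x0 r" v x i] f(3) that by auto
  then have "?g \<in> concentrating_family x0 r"
    unfolding concentrating_family_def using slowly_increasing_partial[OF f(2)] f(4) by blast
  moreover have "?h \<in> concentrating_family x0 r"
    unfolding concentrating_family_def using schwartz_partial[OF f(4)] f(2,3) by blast
  moreover have "(\<lambda>j. partial i (f j)) = (\<lambda>j x. ?g j x + ?h j x)"
  proof (intro ext)
    fix j x
    have P: "?P j differentiable (at x)"
      by (rule schwartz_differentiable[OF schwartz_affine_comp[OF f(4)]]) simp
    have v: "v differentiable (at x)" by (rule slowly_increasing_differentiable[OF f(2)])
    have "partial i (f j) x = 2 ^ (j * m) * (partial i v x * ?P j x + v x * partial i (?P j) x)"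
      unfolding f(1) by (simp only: partial_cmult[OF differentiable_mult[OF v P]] partial_mult[OF v P])
    also have "partial i (?P j) x = of_real (2 ^ j) * partial i \<Psi> (2 ^ j *\<^sub>R x + - (2 ^ j *\<^sub>R x0))"
      by (rule partial_affine_comp[OF schwartz_differentiable[OF f(4)]])
    finally show "partial i (f j) x = ?g j x + ?h j x" by (simp add: power_add algebra_simps)
  qed
  ultimately show ?thesis by (simp only: sum_closure.add[OF sum_closure.base sum_closure.base])
qed

text \<open>Off the ball the argument of \<open>\<Psi>\<close> has norm at least
  \<open>2 ^ j * r\<close>. Of the decay of \<open>\<Psi>\<close>, \<open>N + M\<close> powers
  absorb the weight and the growth of \<open>v\<close>, and \<open>m + 1\<close> powers beat
  \<open>2 ^ (j * m)\<close> with a factor \<open>(1 / 2) ^ j\<close> to spare.\<close>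

lemma concentrating_family_decay:
  fixes x0 :: "real^'n::finite"
  assumes "f \<in> sum_closure (concentrating_family x0 r)" and r: "r > 0"
  shows "\<exists>b. b \<longlonglongrightarrow> 0 \<and> (\<forall>j x. (1 + norm x) ^ N * cmod (f j x) \<le> b j)"
  using assms(1)
proof induction
  case (base f)
  then obtain m v \<Psi> where f: "f = (\<lambda>j x. 2 ^ (j * m) * (v x * \<Psi> (2 ^ j *\<^sub>R x + - (2 ^ j *\<^sub>R x0))))"
    "v \<in> slowly_increasing" "\<forall>x\<in>ball x0 r. v x = 0" "\<Psi> \<in> schwartz"
    unfolding concentrating_family_def by blast
  obtain C M where C: "C > 0" "\<And>x. cmod (v x) \<le> C * (1 + norm x) ^ M"
    using slowly_increasing_bound[OF f(2)] by metis
  let ?L = "(N + M) + (m + 1)"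
  obtain D where D: "D > 0" "\<And>x. (1 + norm x) ^ ?L * cmod (\<Psi> x) \<le> D"
    using schwartz_decay[OF f(4)] by metis
  define E where "E = C * (1 + norm x0) ^ (N + M) * D / r ^ (m + 1)"
  have "(1 + norm x) ^ N * cmod (f j x) \<le> E * (1 / 2) ^ j" for j x
  proof (cases "x \<in> ball x0 r")
    case True
    then show ?thesis using f(3) r C D by (simp add: f(1) E_def)
  next
    case False
    define t where "t = norm (x - x0)"
    have t: "r \<le> t" "0 < t" using False r by (auto simp: t_def dist_norm norm_minus_commute)
    define y where "y = 2 ^ j *\<^sub>R x + - (2 ^ j *\<^sub>R x0)"
    have ny: "norm y = 2 ^ j * t"
    proof -
      have "y = 2 ^ j *\<^sub>R (x - x0)" by (simp add: y_def algebra_simps)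
      then show ?thesis by (simp add: t_def)
    qed
    have "(1 + t) ^ (N + M) * (2 ^ j * r) ^ (m + 1) \<le> (1 + norm y) ^ (N + M) * (1 + norm y) ^ (m + 1)"
    proof (intro mult_mono power_mono)
      have "1 * t \<le> 2 ^ j * t" using t by (intro mult_right_mono) auto
      then show "1 + t \<le> 1 + norm y" unfolding ny by simp
      have "2 ^ j * r \<le> 2 ^ j * t" using t by simp
      then show "2 ^ j * r \<le> 1 + norm y" unfolding ny by linarith
    qed (use t r in auto)
    then have "(1 + t) ^ (N + M) * (2 ^ j * r) ^ (m + 1) * cmod (\<Psi> y) \<le> (1 + norm y) ^ ?L * cmod (\<Psi> y)"
      unfolding power_add[of _ "N + M"] by (rule mult_right_mono) simp
    also have "\<dots> \<le> D" by (rule D)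
    finally have 1: "(1 + t) ^ (N + M) * (2 ^ j * r) ^ (m + 1) * cmod (\<Psi> y) \<le> D" .
    have "(1 + norm x) ^ (N + M) \<le> ((1 + t) * (1 + norm x0)) ^ (N + M)"
      unfolding t_def by (intro power_mono one_plus_norm_le) auto
    then have wt: "(1 + norm x) ^ (N + M) \<le> (1 + norm x0) ^ (N + M) * (1 + t) ^ (N + M)"
      by (simp add: power_mult_distrib mult.commute)
    have "(1 + norm x) ^ N * cmod (f j x) = (1 + norm x) ^ N * (2 ^ (j * m) * (cmod (v x) * cmod (\<Psi> y)))"
      unfolding f(1) y_def by (simp add: norm_mult norm_power)
    also have "\<dots> \<le> (1 + norm x) ^ N * (2 ^ (j * m) * ((C * (1 + norm x) ^ M) * cmod (\<Psi> y)))"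
      by (intro mult_left_mono mult_right_mono C) auto
    also have "\<dots> = C * 2 ^ (j * m) * cmod (\<Psi> y) * (1 + norm x) ^ (N + M)" by (simp add: power_add)
    also have "\<dots> \<le> C * 2 ^ (j * m) * cmod (\<Psi> y) * ((1 + norm x0) ^ (N + M) * (1 + t) ^ (N + M))"
      using C by (intro mult_left_mono wt) auto
    also have "\<dots> = C * (1 + norm x0) ^ (N + M) * 2 ^ (j * m) / (2 ^ j * r) ^ (m + 1) *
        ((1 + t) ^ (N + M) * (2 ^ j * r) ^ (m + 1) * cmod (\<Psi> y))" using r by simp
    also have "\<dots> \<le> C * (1 + norm x0) ^ (N + M) * 2 ^ (j * m) / (2 ^ j * r) ^ (m + 1) * D"
      using C r by (intro mult_left_mono 1) auto
    also have "\<dots> = E * (1 / 2) ^ j"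
      using r by (simp add: E_def power_mult_distrib power_add power_mult power_one_over field_simps)
    finally show ?thesis .
  qed
  moreover have "(\<lambda>j. E * (1 / 2) ^ j) \<longlonglongrightarrow> 0"
    by (intro tendsto_mult_right_zero LIMSEQ_power_zero) simp
  ultimately show ?case by blast
next
  case (add f g)
  then obtain b b' where b: "b \<longlonglongrightarrow> 0" "\<And>j x. (1 + norm x) ^ N * cmod (f j x) \<le> b j"
    "b' \<longlonglongrightarrow> 0" "\<And>j x. (1 + norm x) ^ N * cmod (g j x) \<le> b' j" by blast
  have "(1 + norm x) ^ N * cmod (f j x + g j x) \<le> b j + b' j" for j x
  proof -
    have "(1 + norm x) ^ N * cmod (f j x + g j x) \<le> (1 + norm x) ^ N * (cmod (f j x) + cmod (g j x))"
      by (intro mult_left_mono norm_triangle_ineq) auto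
    also have "\<dots> \<le> b j + b' j" unfolding distrib_left by (intro add_mono b)
    finally show ?thesis .
  qed
  moreover have "(\<lambda>j. b j + b' j) \<longlonglongrightarrow> 0" using tendsto_add[OF b(1,3)] by simp
  ultimately show ?case by blast
qed

text \<open>The part of a concentrating function away from \<open>x0\<close> is negligible for every
  tempered distribution: continuity involves finitely many weighted derivatives, and each of them
  tends to 0 uniformly in \<open>x\<close>.\<close>

lemma tempered_tail:
  fixes x0 :: "real^'n::finite"
  assumes h: "h \<in> tempered_distributions" and v: "v \<in> slowly_increasing" "\<And>x. x \<in> ball x0 r \<Longrightarrow> v x = 0"
    and r: "r > 0" and \<Psi>: "\<Psi> \<in> schwartz"
  shows "(\<lambda>j. h (\<lambda>x. v x * (2 ^ (j * m) * \<Psi> (2 ^ j *\<^sub>R (x - x0))))) \<longlonglongrightarrow> 0"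
proof -
  define f where "f = (\<lambda>j x. 2 ^ (j * m) * (v x * \<Psi> (2 ^ j *\<^sub>R x + - (2 ^ j *\<^sub>R x0))))"
  have f_eq: "f j = (\<lambda>x. v x * (2 ^ (j * m) * \<Psi> (2 ^ j *\<^sub>R (x - x0))))" for j
    unfolding f_def by (auto simp: algebra_simps)
  have f: "f \<in> concentrating_family x0 r"
    unfolding concentrating_family_def f_def using v \<Psi> by blast
  have fS: "f j \<in> schwartz" for j
    unfolding f_def by (rule schwartz_cmult[OF schwartz_mult[OF v(1) schwartz_affine_comp[OF \<Psi>]]]) simp
  obtain C N where C: "C > 0" "\<And>f b. f \<in> schwartz \<Longrightarrow>
    (\<And>x js. length js \<le> N \<Longrightarrow> (1 + norm x) ^ N * cmod (partials js f x) \<le> b) \<Longrightarrow> cmod (h f) \<le> C * b"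
    using tempered_bound[OF h] by blast
  have part: "(\<lambda>j. partials js (f j)) \<in> sum_closure (concentrating_family x0 r)" for js
    by (rule partials_sum_closure[OF sum_closure.base[OF f]])
      (rule concentrating_family_diff concentrating_family_partial, assumption)+
  have "\<forall>js. \<exists>b. b \<longlonglongrightarrow> 0 \<and> (\<forall>j x. (1 + norm x) ^ N * cmod (partials js (f j) x) \<le> b j)"
    by (intro allI concentrating_family_decay[OF part r])
  from choice[OF this] obtain b where b: "\<And>js. b js \<longlonglongrightarrow> 0"
    "\<And>js j x. (1 + norm x) ^ N * cmod (partials js (f j) x) \<le> b js j" by blast
  let ?J = "{js::'n list. length js \<le> N}"
  have fin: "finite ?J" using finite_lists_length_le[of "UNIV :: 'n set" N] by simp
  have bound: "cmod (h (f j)) \<le> C * (\<Sum>js\<in>?J. b js j)" for j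
  proof (rule C(2)[OF fS])
    fix x :: "real^'n" and js :: "'n list"
    assume js: "length js \<le> N"
    have "0 \<le> b js j" for js using b(2)[of 0 js j] by (simp add: order_trans[OF norm_ge_zero])
    then have "b js j \<le> (\<Sum>js\<in>?J. b js j)" using fin js by (intro member_le_sum) auto
    then show "(1 + norm x) ^ N * cmod (partials js (f j) x) \<le> (\<Sum>js\<in>?J. b js j)"
      using b(2)[of x js j] by simp
  qed
  have lim: "(\<lambda>j. C * (\<Sum>js\<in>?J. b js j)) \<longlonglongrightarrow> 0"
    using tendsto_sum[of ?J b "\<lambda>_. 0" sequentially] b(1) by (intro tendsto_mult_right_zero) simp
  have "(\<lambda>j. h (f j)) \<longlonglongrightarrow> 0"
    by (rule Lim_null_comparison[OF always_eventually lim]) (use bound in blast)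
  then show ?thesis unfolding f_eq .
qed

lemma morrey_norm_mono:
  assumes "0 \<le> p" "\<And>x. g x \<le> g' x"
  shows "morrey_norm u p g \<le> morrey_norm u p g'"
  unfolding morrey_norm_def
  by (rule SUP_subset_mono[OF order_refl])
    (use assms in \<open>auto intro!: mult_left_mono ennreal_powr_mono nn_integral_mono mult_right_mono\<close>)

text \<open>The embedding of the Lizorkin-Triebel-Morrey space into the Besov space with smoothness
  \<open>s - d / u\<close> and both integrability indices infinite, tested against the functions \<open>fourier (freq_bump \<phi>0 j x0)\<close>.\<close>

lemma LTM_norm_imp_test_bound:
  fixes \<phi>0 :: "real^'n::finite \<Rightarrow> real"
  assumes rg: "resolution_generator \<phi>0" and u: "0 < u" and p: "1 \<le> p" and q: "0 < q"
  obtains C where "C > 0" "\<And>h \<epsilon> j. 0 < \<epsilon> \<Longrightarrow> h \<in> tempered_distributions \<Longrightarrow> LTM_norm \<phi>0 s u p q h \<le> ennreal \<epsilon> \<Longrightarrow>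
    cmod (h (fourier (freq_bump \<phi>0 j x0))) \<le> C * \<epsilon> * 2 powr (real j * (real CARD('n) / u - s))"
proof -
  let ?d = "real CARD('n)" and ?F = "fourier (\<lambda>\<xi>. of_real (annulus_bump \<phi>0 \<xi>) :: complex)"
  have F: "?F \<in> schwartz" by (intro fourier_schwartz annulus_bump_schwartz rg)
  obtain D where D: "D > 0" "\<And>x. (1 + norm x) ^ (CARD('n) + 1) * cmod (?F x) \<le> D"
    using schwartz_decay[OF F] by metis
  show thesis
  proof (rule morrey_norm_imp_weighted_L1[OF u p])
    fix C assume C: "C > 0" "\<And>(G :: real^'n \<Rightarrow> ennreal) \<epsilon> r x0. G \<in> borel_measurable borel \<Longrightarrow> 0 < \<epsilon> \<Longrightarrow>
      morrey_norm u p G \<le> ennreal \<epsilon> \<Longrightarrow> 0 < r \<Longrightarrow>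
      (\<integral>\<^sup>+x. G x * ennreal (inverse ((1 + norm (x - x0) / r) ^ (CARD('n) + 1))) \<partial>lborel)
        \<le> ennreal (C * \<epsilon> * r powr (?d - ?d / u))"
    show thesis
    proof (rule that[of "D * C"])
      show "D * C > 0" using C D by simp
      fix h \<epsilon> j
      assume \<epsilon>: "0 < \<epsilon>" and h: "h \<in> tempered_distributions" and le: "LTM_norm \<phi>0 s u p q h \<le> ennreal \<epsilon>"
      let ?fp = "frequency_piece \<phi>0 j h" and ?\<Psi> = "fourier (freq_bump \<phi>0 j x0)"
      have \<Psi>: "?\<Psi> \<in> schwartz" by (intro fourier_schwartz freq_bump_schwartz rg)
      note rep = frequency_piece_represents[OF rg h, where k = j]
      have [measurable]: "?fp \<in> borel_measurable borel" by (rule borel_measurable_continuous_onI[OF rep(1)])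
      let ?G = "\<lambda>x. ennreal (2 powr (real j * s) * cmod (?fp x))"
      \<comment> \<open>A single term is dominated by the \<open>l^q\<close> norm, so the norm of
        \<open>h\<close> controls the \<open>j\<close>-th piece by itself.\<close>
      have "morrey_norm u p ?G \<le> LTM_norm \<phi>0 s u p q h"
      proof -
        have "?G x \<le> lq_norm q (\<lambda>k. 2 powr (real k * s) * cmod (frequency_piece \<phi>0 k h x))" for x
          using lq_norm_ge[OF q, of "\<lambda>k. 2 powr (real k * s) * cmod (frequency_piece \<phi>0 k h x)" j] by (simp add: abs_mult)
        then show ?thesis unfolding LTM_norm_def using h p by (simp add: morrey_norm_mono)
      qed
      with le have G: "morrey_norm u p ?G \<le> ennreal \<epsilon>" by (rule order_trans[rotated])
      let ?w = "\<lambda>x. inverse ((1 + norm (x - x0) / (1 / 2 ^ j)) ^ (CARD('n) + 1))"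
      have \<Psi>le: "cmod (?\<Psi> x) \<le> 2 ^ (j * CARD('n)) * (D * ?w x)" for x
      proof -
        have pos: "(1 + norm (2 ^ j *\<^sub>R (x - x0))) ^ (CARD('n) + 1) > 0" by (intro zero_less_power add_pos_nonneg) auto
        have "cmod (?F (2 ^ j *\<^sub>R (x - x0))) \<le> D / (1 + norm (2 ^ j *\<^sub>R (x - x0))) ^ (CARD('n) + 1)"
          using D(2)[of "2 ^ j *\<^sub>R (x - x0)"] by (simp only: pos_le_divide_eq[OF pos] mult.commute)
        also have "\<dots> = D * ?w x" by (simp add: divide_inverse mult.commute)
        finally show ?thesis unfolding fourier_freq_bump[OF rg] norm_mult by (simp add: norm_power)
      qed
      \<comment> \<open>The \<open>j\<close>-th resolution function is 1 on the frequency support of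
        \<open>?\<Psi>\<close> and reproduces it, so the pairing with \<open>h\<close> becomes one
        with the \<open>j\<close>-th piece.\<close>
      have "h ?\<Psi> = (LINT x|lborel. ?fp x * ?\<Psi> x)"
        using rep(3)[OF \<Psi>] unfolding inverse_fourier_fourier[OF freq_bump_schwartz[OF rg]]
          resolution_mult_freq_bump[OF rg] by simp
      also have "ennreal (cmod \<dots>) \<le> (\<integral>\<^sup>+x. ennreal (cmod (?fp x * ?\<Psi> x)) \<partial>lborel)"
        by (rule integral_norm_bound_ennreal[OF rep(2)[OF \<Psi>]])
      also have "\<dots> \<le> (\<integral>\<^sup>+x. ennreal (2 ^ (j * CARD('n)) * D * 2 powr (- (real j * s))) * (?G x * ennreal (?w x)) \<partial>lborel)"
      proof (rule nn_integral_mono)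
        fix x
        have "cmod (?fp x * ?\<Psi> x) \<le> cmod (?fp x) * (2 ^ (j * CARD('n)) * (D * ?w x))"
          unfolding norm_mult by (intro mult_left_mono \<Psi>le) auto
        also have "\<dots> = (2 ^ (j * CARD('n)) * D * 2 powr (- (real j * s))) * ((2 powr (real j * s) * cmod (?fp x)) * ?w x)"
          by (simp add: powr_minus field_simps)
        finally show "ennreal (cmod (?fp x * ?\<Psi> x)) \<le> ennreal (2 ^ (j * CARD('n)) * D * 2 powr (- (real j * s))) * (?G x * ennreal (?w x))"
          using D(1) by (simp add: ennreal_leI flip: ennreal_mult')
      qed
      also have "\<dots> = ennreal (2 ^ (j * CARD('n)) * D * 2 powr (- (real j * s))) * (\<integral>\<^sup>+x. ?G x * ennreal (?w x) \<partial>lborel)"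
        by (rule nn_integral_cmult) measurable
      also have "\<dots> \<le> ennreal (2 ^ (j * CARD('n)) * D * 2 powr (- (real j * s))) * ennreal (C * \<epsilon> * (1 / 2 ^ j) powr (?d - ?d / u))"
        by (intro mult_left_mono C(2) \<epsilon> G) auto
      also have "\<dots> = ennreal ((2 ^ (j * CARD('n)) * D * 2 powr (- (real j * s))) * (C * \<epsilon> * (1 / 2 ^ j) powr (?d - ?d / u)))"
        using D(1) by (intro ennreal_mult'[symmetric]) simp
      also have "(2 ^ (j * CARD('n)) * D * 2 powr (- (real j * s))) * (C * \<epsilon> * (1 / 2 ^ j) powr (?d - ?d / u))
          = D * C * \<epsilon> * 2 powr (real j * (?d / u - s))"
      proof -
        have "(1 / 2 ^ j :: real) = 2 powr (- real j)" by (simp add: powr_minus powr_realpow field_simps)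
        then have "(1 / 2 ^ j) powr (?d - ?d / u) = 2 powr (- real j * (?d - ?d / u))" by (simp only: powr_powr)
        moreover have "(2::real) ^ (j * CARD('n)) = 2 powr (real j * ?d)" by (simp flip: powr_realpow)
        ultimately have "(2 ^ (j * CARD('n)) * D * 2 powr (- (real j * s))) * (C * \<epsilon> * (1 / 2 ^ j) powr (?d - ?d / u))
          = D * C * \<epsilon> * (2 powr (real j * ?d) * 2 powr (- (real j * s)) * 2 powr (- real j * (?d - ?d / u)))"
          by (simp only: mult_ac)
        also have "2 powr (real j * ?d) * 2 powr (- (real j * s)) * 2 powr (- real j * (?d - ?d / u)) = 2 powr (real j * (?d / u - s))"
          unfolding powr_add[symmetric] by (simp add: algebra_simps)
        finally show ?thesis .
      qed
      finally show "cmod (h ?\<Psi>) \<le> D * C * \<epsilon> * 2 powr (real j * (?d / u - s))"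
        using C D \<epsilon> by (subst (asm) ennreal_le_iff) auto
    qed
  qed
qed

text \<open>The exact growth of the series and the largest growth possible for \<open>h\<close> have
  the same rate \<open>2 powr (j \<delta>)\<close>, so the comparison rests on the constants. The
  relation between \<open>h\<close>, the series and \<open>f\<close> holds only on test functions of
  \<open>\<Omega>\<close>, hence the cut-off.\<close>

lemma lacunary_not_approximable:
  fixes \<phi>0 :: "real^'n::finite \<Rightarrow> real"
  assumes rg: "resolution_generator \<phi>0" and u: "0 < u" and p: "1 \<le> p" and q: "0 < q"
    and \<delta>: "0 < \<delta>" "\<delta> < real CARD('n)" and s: "s + \<delta> = real CARD('n) / u"
    and \<Omega>: "open \<Omega>" "x0 \<in> \<Omega>"
  obtains \<epsilon> where "\<epsilon> > 0" "\<And>h f. h \<in> tempered_distributions \<Longrightarrow> smooth_on \<Omega> f \<Longrightarrow>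
    (\<And>w. w \<in> test_functions \<Omega> \<Longrightarrow> h w = lacunary \<phi>0 \<delta> x0 w - regular_distribution \<Omega> f w) \<Longrightarrow>
    \<not> LTM_norm \<phi>0 s u p q h \<le> ennreal \<epsilon>"
proof -
  obtain \<kappa> where \<kappa>: "\<kappa> > 0" "\<And>j. lacunary \<phi>0 \<delta> x0 (fourier (freq_bump \<phi>0 j x0)) = of_real (2 powr (real j * \<delta>) * \<kappa>)"
    using lacunary_fourier_freq_bump[OF rg] by blast
  have s': "real CARD('n) / u - s = \<delta>" using s by simp
  show thesis
  proof (rule LTM_norm_imp_test_bound[OF rg u p q, of s x0])
    fix C assume C: "C > 0" "\<And>h \<epsilon> j. 0 < \<epsilon> \<Longrightarrow> h \<in> tempered_distributions \<Longrightarrow> LTM_norm \<phi>0 s u p q h \<le> ennreal \<epsilon> \<Longrightarrow>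
      cmod (h (fourier (freq_bump \<phi>0 j x0))) \<le> C * \<epsilon> * 2 powr (real j * (real CARD('n) / u - s))"
    \<comment> \<open>With this choice \<open>h\<close> accounts for at most half of
      \<open>\<kappa> * 2 powr (j * \<delta>)\<close>; the other half would have to come from
      bounded terms.\<close>
    define \<epsilon> where "\<epsilon> = \<kappa> / (2 * C)"
    have \<epsilon>: "\<epsilon> > 0" using \<kappa> C by (simp add: \<epsilon>_def)
    show thesis
    proof (rule that[OF \<epsilon>], rule notI)
      fix h :: "(real^'n \<Rightarrow> complex) \<Rightarrow> complex" and f :: "real^'n \<Rightarrow> complex"
      assume h: "h \<in> tempered_distributions" and f: "smooth_on \<Omega> f"
        and eq: "\<And>w. w \<in> test_functions \<Omega> \<Longrightarrow> h w = lacunary \<phi>0 \<delta> x0 w - regular_distribution \<Omega> f w"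
        and le: "LTM_norm \<phi>0 s u p q h \<le> ennreal \<epsilon>"
      obtain e where e: "e > 0" "cball x0 e \<subseteq> \<Omega>" using \<Omega> open_contains_cball by blast
      \<comment> \<open>The cut-off is then 1 up to distance \<open>e / 2\<close> and 0 from
        distance \<open>3 / 4 * e\<close> on, so its support lies in
        \<open>cball x0 e\<close>.\<close>
      define a where "a = 2 / e"
      have a: "a > 0" using e by (simp add: a_def)
      define cut where "cut x = (of_real (\<phi>0 (a *\<^sub>R x + - (a *\<^sub>R x0))) :: complex)" for x
      have cutS: "cut \<in> schwartz" unfolding cut_def
        using schwartz_affine_comp[OF resolution_generator_schwartz[OF rg], of a "- (a *\<^sub>R x0)"] a by simp
      have na: "norm (a *\<^sub>R x + - (a *\<^sub>R x0)) = a * norm (x - x0)" for x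
        using a by (simp flip: scaleR_diff_right)
      have cut1: "1 - cut x = 0" if "x \<in> ball x0 (e / 2)" for x
      proof -
        have "a * norm (x - x0) \<le> 1" using that e by (simp add: a_def dist_norm norm_minus_commute field_simps)
        then show ?thesis using rg unfolding cut_def na[symmetric] by (simp add: resolution_generator_def)
      qed
      have cut0: "cut x = 0" if "x \<notin> cball x0 e" for x
      proof -
        have "a * norm (x - x0) \<ge> 3 / 2" using that e by (simp add: a_def dist_norm norm_minus_commute field_simps)
        then show ?thesis using rg unfolding cut_def na[symmetric] by (simp add: resolution_generator_def)
      qed
      let ?F = "fourier (\<lambda>\<xi>. of_real (annulus_bump \<phi>0 \<xi>) :: complex)"
      have F: "?F \<in> schwartz" by (intro fourier_schwartz annulus_bump_schwartz rg)
      define \<Psi> where "\<Psi> j = fourier (freq_bump \<phi>0 j x0)" for j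
      have \<Psi>: "\<Psi> j \<in> schwartz" for j unfolding \<Psi>_def by (intro fourier_schwartz freq_bump_schwartz rg)
      have \<Psi>_eq: "\<Psi> j = (\<lambda>x. 2 ^ (j * CARD('n)) * ?F (2 ^ j *\<^sub>R (x - x0)))" for j
        unfolding \<Psi>_def using fourier_freq_bump[OF rg] by blast
      have v: "(\<lambda>x. 1 - cut x) \<in> slowly_increasing" by (rule slowly_increasing_const_diff[OF cutS])
      have vS: "(\<lambda>x. (1 - cut x) * \<Psi> j x) \<in> schwartz" for j by (rule schwartz_mult[OF v \<Psi>])
      have split: "g (\<lambda>x. cut x * \<Psi> j x) = g (\<Psi> j) - g (\<lambda>x. (1 - cut x) * \<Psi> j x)"
        if "linear_functional_on schwartz g" for g j
        using linear_functional_diff[OF that \<Psi>[of j] vS[of j]] by (simp add: algebra_simps)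
      have tail: "Bseq (\<lambda>j. g (\<lambda>x. (1 - cut x) * \<Psi> j x))" if "g \<in> tempered_distributions" for g
        unfolding \<Psi>_eq
        by (rule convergent_imp_Bseq[OF convergentI[OF tempered_tail[where r = "e / 2", OF that v cut1 _ F]]]) (use e in auto)
      have lac: "lacunary \<phi>0 \<delta> x0 \<in> tempered_distributions"
        using lacunary_tempered[OF rg \<delta>(2), of 1 x0] by simp
      obtain K1 where K1: "\<And>j. cmod (h (\<lambda>x. (1 - cut x) * \<Psi> j x)) \<le> K1" using BseqD[OF tail[OF h]] by blast
      obtain K2 where K2: "\<And>j. cmod (lacunary \<phi>0 \<delta> x0 (\<lambda>x. (1 - cut x) * \<Psi> j x)) \<le> K2" using BseqD[OF tail[OF lac]] by blast
      \<comment> \<open>The \<open>\<Psi> j\<close> have a common \<open>L^1\<close> norm, and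
        \<open>f\<close> is bounded on \<open>cball x0 e\<close> by continuity.\<close>
      have "\<exists>K3. \<forall>j. cmod (regular_distribution \<Omega> f (\<lambda>x. cut x * \<Psi> j x)) \<le> K3"
      proof -
        have "f differentiable (at x)" if "x \<in> \<Omega>" for x using f that by (auto simp: smooth_on_def dest: spec[of _ "[]"])
        then have "continuous_on (cball x0 e) f" using e(2)
          by (intro continuous_at_imp_continuous_on ballI differentiable_imp_continuous_within) auto
        then have "compact (f ` cball x0 e)" by (rule compact_continuous_image) simp
        from compact_imp_bounded[OF this] obtain B where "\<forall>y\<in>f ` cball x0 e. cmod y \<le> B"
          unfolding bounded_iff ..
        then have B: "cmod (f x) \<le> B" if "x \<in> cball x0 e" for x using that by simp
        obtain c where c: "c > 0" "\<And>x. (1 + norm x) ^ 0 * cmod (cut x) \<le> c" using schwartz_decay[OF cutS] by metis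
        have B0: "0 \<le> B" by (rule order_trans[OF norm_ge_zero B[of x0]]) (use e(1) in simp)
        have "cmod (regular_distribution \<Omega> f (\<lambda>x. cut x * \<Psi> j x)) \<le> B * c * (LINT x|lborel. cmod (?F x))" for j
        proof -
          let ?g = "\<lambda>x. indicator \<Omega> x *\<^sub>R (f x * (cut x * \<Psi> j x))"
          have int: "integrable lborel (\<lambda>x. B * c * cmod (\<Psi> j x))"
            by (intro integrable_mult_right integrable_norm schwartz_integrable \<Psi>)
          have ptw: "cmod (?g x) \<le> B * c * cmod (\<Psi> j x)" for x
          proof (cases "x \<in> cball x0 e")
            case True
            have "cmod (f x) * (cmod (cut x) * cmod (\<Psi> j x)) \<le> B * (c * cmod (\<Psi> j x))"
              using B[OF True] B0 c by (intro mult_mono) auto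
            then show ?thesis using e(2) True by (auto simp: norm_mult mult.assoc)
          next
            case False
            then show ?thesis using cut0[OF False] B0 c(1) by simp
          qed
          have "cmod (regular_distribution \<Omega> f (\<lambda>x. cut x * \<Psi> j x)) \<le> cmod (LINT x|lborel. ?g x)"
            by (simp add: regular_distribution_def set_lebesgue_integral_def)
          also have "\<dots> \<le> (LINT x|lborel. B * c * cmod (\<Psi> j x))"
          \<comment> \<open>If the integrand were not integrable, its integral would be 0 by
            convention and the bound would hold as well.\<close>
          proof (cases "integrable lborel ?g")
            case True
            then show ?thesis by (rule Bochner_Integration.integral_norm_bound_integral[OF _ int ptw])
          next
            case False
            then show ?thesis using B0 c(1) by (simp add: not_integrable_integral_eq)
          qed
          also have "(LINT x|lborel. B * c * cmod (\<Psi> j x)) = B * c * (LINT x|lborel. cmod (\<Psi> j x))" by simp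
          also have "(LINT x|lborel. cmod (\<Psi> j x)) = (LINT x|lborel. cmod (?F x))"
          proof -
            note [measurable] = schwartz_borel[OF F]
            have "(LINT x|lborel. cmod (?F x)) = 2 ^ (j * CARD('n)) * (LINT x|lborel. cmod (?F (- (2 ^ j *\<^sub>R x0) + 2 ^ j *\<^sub>R x)))"
              using integral_lborel_affine[of "\<lambda>x. cmod (?F x)" "2 ^ j" "- (2 ^ j *\<^sub>R x0)"] by (simp add: power_mult)
            then show ?thesis unfolding \<Psi>_eq norm_mult by (simp add: norm_power algebra_simps)
          qed
          finally show ?thesis .
        qed
        then show ?thesis by blast
      qed
      then obtain K3 where K3: "\<And>j. cmod (regular_distribution \<Omega> f (\<lambda>x. cut x * \<Psi> j x)) \<le> K3" by blast
      have main: "2 powr (real j * \<delta>) * \<kappa> \<le> 2 * (K1 + K2 + K3)" for j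
      proof -
        let ?w = "\<lambda>x. cut x * \<Psi> j x"
        have "?w \<in> schwartz" by (intro schwartz_mult schwartz_slowly_increasing cutS \<Psi>)
        then have "?w \<in> test_functions \<Omega>" unfolding test_functions_def schwartz_def
          using cut0 e(2) by (auto intro!: exI[of _ "cball x0 e"])
        from eq[OF this] have decomp: "of_real (2 powr (real j * \<delta>) * \<kappa>) = h (\<Psi> j) - h (\<lambda>x. (1 - cut x) * \<Psi> j x)
            + lacunary \<phi>0 \<delta> x0 (\<lambda>x. (1 - cut x) * \<Psi> j x) + regular_distribution \<Omega> f ?w"
          unfolding split[OF tempered_linear[OF h]] split[OF tempered_linear[OF lac]] \<kappa>(2)[folded \<Psi>_def]
          by (simp add: algebra_simps)
        have "cmod (of_real (2 powr (real j * \<delta>) * \<kappa>)) \<le> cmod (h (\<Psi> j)) + cmod (h (\<lambda>x. (1 - cut x) * \<Psi> j x))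
            + cmod (lacunary \<phi>0 \<delta> x0 (\<lambda>x. (1 - cut x) * \<Psi> j x)) + cmod (regular_distribution \<Omega> f ?w)"
          unfolding decomp by (rule norm_triangle_le[OF add_mono[OF norm_triangle_le[OF add_mono[OF norm_triangle_ineq4 order_refl]] order_refl]])
        also have "\<dots> \<le> C * \<epsilon> * 2 powr (real j * \<delta>) + K1 + K2 + K3"
        proof -
          have "cmod (h (\<Psi> j)) \<le> C * \<epsilon> * 2 powr (real j * \<delta>)"
            unfolding \<Psi>_def by (rule C(2)[OF \<epsilon> h le, of j, unfolded s'])
          from add_mono[OF add_mono[OF add_mono[OF this K1] K2] K3] show ?thesis .
        qed
        also have "C * \<epsilon> = \<kappa> / 2" using C(1) by (simp add: \<epsilon>_def)
        finally have "2 powr (real j * \<delta>) * \<kappa> \<le> \<kappa> / 2 * 2 powr (real j * \<delta>) + K1 + K2 + K3"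
          using \<kappa>(1) by (simp only: norm_of_real abs_of_nonneg[OF mult_nonneg_nonneg] powr_ge_zero less_imp_le)
        moreover have "y \<le> y / 2 + a + b + c \<Longrightarrow> y \<le> 2 * (a + b + c)" for y a b c :: real by simp
        ultimately show ?thesis unfolding mult.commute[of "\<kappa> / 2"] times_divide_eq_right by blast
      qed
      have "2 powr \<delta> > 1" using \<delta> by simp
      then obtain j where "2 * (K1 + K2 + K3) / \<kappa> < (2 powr \<delta>) ^ j" using real_arch_pow by blast
      also have "(2 powr \<delta>) ^ j = 2 powr (real j * \<delta>)" by (simp add: powr_powr mult.commute flip: powr_realpow)
      finally show False using main[of j] \<kappa>(1) by (simp add: field_simps)
    qed
  qed
qed

section \<open>Complex interpolation\<close>

text \<open>On the line spanned by \<open>G\<close> a limit of scalars becomes a limit of norms. All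
  continuity, decay and derivative claims of the interpolation argument are of this kind.\<close>

lemma homogeneous_norm_tendsto_0:
  fixes N :: "('b \<Rightarrow> complex) \<Rightarrow> ennreal"
  assumes N: "\<And>c. N (\<lambda>b. c * G b) \<le> ennreal (cmod c * B)" and k: "(k \<longlongrightarrow> 0) F"
  shows "((\<lambda>r. N (\<lambda>b. k r * G b)) \<longlongrightarrow> 0) F"
proof (rule tendsto_sandwich[OF _ _ tendsto_const])
  show "\<forall>\<^sub>F r in F. N (\<lambda>b. k r * G b) \<le> ennreal (cmod (k r) * B)" using N by simp
  have "((\<lambda>r. cmod (k r) * B) \<longlongrightarrow> 0) F" by (intro tendsto_mult_left_zero tendsto_norm_zero k)
  from tendsto_ennrealI[OF this] show "((\<lambda>r. ennreal (cmod (k r) * B)) \<longlongrightarrow> 0) F" by simp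
qed simp

text \<open>\<open>F\<close> moves along the line spanned by \<open>G\<close>, so every condition on
  it is one on the scalar function \<open>e\<close>. Subtracting \<open>\<Theta>\<^sup>2\<close>
  makes \<open>e\<close> equal to 1 at \<open>\<Theta>\<close>, and on vertical lines
  \<open>cmod (e z)\<close> decays like \<open>exp (- t\<^sup>2)\<close>.\<close>

lemma interpolation_of_intersection:
  fixes N0 N1 :: "('b \<Rightarrow> complex) \<Rightarrow> ennreal"
  assumes N0: "\<And>c. N0 (\<lambda>b. c * G b) \<le> ennreal (cmod c * B0)"
    and N1: "\<And>c. N1 (\<lambda>b. c * G b) \<le> ennreal (cmod c * B1)"
  shows "G \<in> complex_interpolation N0 N1 \<Theta>"
proof -
  let ?S = "sum_norm N0 N1"
  define e where "e z = exp (z\<^sup>2 - of_real (\<Theta>\<^sup>2))" for z :: complex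
  define F where "F z = (\<lambda>b. e z * G b)" for z
  have S: "?S (\<lambda>b. c * G b) \<le> ennreal (cmod c * B0)" for c
  proof -
    \<comment> \<open>The second summand is written as \<open>0 * G b\<close>, so that the
      hypothesis on \<open>N1\<close> with \<open>c = 0\<close> gives it norm 0.\<close>
    have "?S (\<lambda>b. c * G b) \<le> N0 (\<lambda>b. c * G b) + N1 (\<lambda>b. 0 * G b)"
      unfolding sum_norm_def by (rule INF_lower2[of "(\<lambda>b. c * G b, \<lambda>b. 0 * G b)"]) auto
    also have "\<dots> \<le> ennreal (cmod c * B0) + ennreal (cmod 0 * B1)" by (intro add_mono N0 N1)
    finally show ?thesis by simp
  qed
  have fin: "(\<lambda>b. c * G b) \<in> finite_part N" if "\<And>c. N (\<lambda>b. c * G b) \<le> ennreal (cmod c * B)"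
    for N :: "('b \<Rightarrow> complex) \<Rightarrow> ennreal" and B c
    using le_less_trans[OF that ennreal_less_top] by (simp add: finite_part_def)
  have e_cont: "isCont e z" for z unfolding e_def by (intro continuous_intros)
  have diff: "(\<lambda>b. F r b - F t b) = (\<lambda>b. (e r - e t) * G b)" for r t
    by (simp add: F_def left_diff_distrib)
  have S_cont: "norm_continuous_on {z. 0 \<le> Re z \<and> Re z \<le> 1} ?S F"
    unfolding norm_continuous_on_def diff
  proof (intro ballI conjI)
    fix z
    show "F z \<in> finite_part ?S" unfolding F_def by (rule fin[OF S])
    have "(e \<longlongrightarrow> e z) (at z within {z. 0 \<le> Re z \<and> Re z \<le> 1})"
      using continuous_within_subset[OF e_cont[of z] subset_UNIV] by (simp add: continuous_within)
    then show "((\<lambda>r. ?S (\<lambda>b. (e r - e z) * G b)) \<longlongrightarrow> 0) (at z within {z. 0 \<le> Re z \<and> Re z \<le> 1})"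
      by (intro homogeneous_norm_tendsto_0[where N = ?S and G = G, OF S] LIM_zero)
  qed
  have edge_cont: "norm_continuous_on UNIV N (\<lambda>t. F (Complex a t))"
    if N: "\<And>c. N (\<lambda>b. c * G b) \<le> ennreal (cmod c * B)" for N B a
    unfolding norm_continuous_on_def diff
  proof (intro ballI conjI)
    fix t :: real
    show "F (Complex a t) \<in> finite_part N" unfolding F_def by (rule fin[OF N])
    have "((\<lambda>r. Complex a r) \<longlongrightarrow> Complex a t) (at t)" by (intro tendsto_Complex tendsto_intros)
    then have "((\<lambda>r. e (Complex a r)) \<longlongrightarrow> e (Complex a t)) (at t)"
      by (rule isCont_tendsto_compose[OF e_cont])
    then show "((\<lambda>r. N (\<lambda>b. (e (Complex a r) - e (Complex a t)) * G b)) \<longlongrightarrow> 0) (at t within UNIV)"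
      by (intro homogeneous_norm_tendsto_0[where N = N and G = G, OF N] LIM_zero)
  qed
  have norm_e: "cmod (e (Complex a t)) = exp (a\<^sup>2 - \<Theta>\<^sup>2 - t\<^sup>2)" for a t
    by (simp add: e_def norm_exp_eq_Re complex_eq_iff power2_eq_square algebra_simps)
  have edge_decay: "((\<lambda>t::real. N (F (Complex a t))) \<longlongrightarrow> 0) at_infinity"
    if N: "\<And>c. N (\<lambda>b. c * G b) \<le> ennreal (cmod c * B)" for N B a
    unfolding F_def
  proof (rule homogeneous_norm_tendsto_0[where N = N and G = G, OF N], rule Lim_null_comparison)
    have "cmod (e (Complex a t)) \<le> exp (a\<^sup>2 - \<Theta>\<^sup>2) * norm (inverse t)" if "t \<noteq> 0" for t
    proof -
      \<comment> \<open>Decay like \<open>1 / |t|\<close> is enough; it follows from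
        \<open>1 + x <= exp x\<close> at \<open>x = t\<^sup>2\<close>.\<close>
      have "\<bar>t\<bar> \<le> 1 + t\<^sup>2"
        using zero_le_power2[of "\<bar>t\<bar> - 1 / 2"] by (simp add: power2_eq_square algebra_simps)
      also have "\<dots> \<le> exp (t\<^sup>2)" by (rule exp_ge_add_one_self)
      finally have "exp (- t\<^sup>2) \<le> inverse \<bar>t\<bar>" using that by (simp add: exp_minus le_imp_inverse_le)
      then have "exp (a\<^sup>2 - \<Theta>\<^sup>2) * exp (- t\<^sup>2) \<le> exp (a\<^sup>2 - \<Theta>\<^sup>2) * inverse \<bar>t\<bar>" by (rule mult_left_mono) simp
      then show ?thesis unfolding norm_e by (simp flip: exp_add)
    qed
    then show "\<forall>\<^sub>F t in at_infinity. norm (e (Complex a t)) \<le> exp (a\<^sup>2 - \<Theta>\<^sup>2) * norm (inverse t)"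
      unfolding eventually_at_infinity by (intro exI[of _ 1]) auto
    show "((\<lambda>t::real. exp (a\<^sup>2 - \<Theta>\<^sup>2) * norm (inverse t)) \<longlongrightarrow> 0) at_infinity"
      by (intro tendsto_mult_right_zero tendsto_norm_zero tendsto_inverse_0)
  qed
  have bdd: "?S (F z) \<le> ennreal (exp 1 * \<bar>B0\<bar>)" if z: "0 \<le> Re z" "Re z \<le> 1" for z
  proof -
    have "(Re z)\<^sup>2 \<le> 1" using z by (simp add: power_le_one)
    then have "(Re z)\<^sup>2 - \<Theta>\<^sup>2 - (Im z)\<^sup>2 \<le> 1" by (smt (verit) zero_le_power2)
    then have "cmod (e z) \<le> exp 1" using norm_e[of "Re z" "Im z"] by simp
    then have "cmod (e z) * \<bar>B0\<bar> \<le> exp 1 * \<bar>B0\<bar>" by (rule mult_right_mono) simp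
    moreover have "cmod (e z) * B0 \<le> cmod (e z) * \<bar>B0\<bar>" by (intro mult_left_mono) auto
    ultimately have "cmod (e z) * B0 \<le> exp 1 * \<bar>B0\<bar>" by linarith
    then show ?thesis unfolding F_def by (intro order_trans[OF S] ennreal_leI)
  qed
  have hol: "norm_holomorphic_on {z. 0 < Re z \<and> Re z < 1} ?S F"
    unfolding norm_holomorphic_on_def
  proof (intro ballI bexI)
    fix z
    define D where "D = 2 * z * e z"
    show "(\<lambda>b. D * G b) \<in> finite_part ?S" by (rule fin[OF S])
    have "(e has_field_derivative D) (at z within {z. 0 < Re z \<and> Re z < 1})"
      unfolding e_def D_def by (auto intro!: derivative_eq_intros)
    then have "((\<lambda>w. (e w - e z) / (w - z) - D) \<longlongrightarrow> 0) (at z within {z. 0 < Re z \<and> Re z < 1})"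
      unfolding has_field_derivative_iff by (rule LIM_zero)
    from homogeneous_norm_tendsto_0[where N = ?S and G = G, OF S this]
    show "((\<lambda>w. ?S (\<lambda>b. (F w b - F z b) / (w - z) - D * G b)) \<longlongrightarrow> 0) (at z within {z. 0 < Re z \<and> Re z < 1})"
      by (simp add: F_def left_diff_distrib diff_divide_distrib)
  qed
  have "F \<in> calderon_functions N0 N1"
    unfolding calderon_functions_def
    using S_cont hol edge_cont[OF N0] edge_cont[OF N1] edge_decay[OF N0] edge_decay[OF N1] bdd by blast
  moreover have "F (of_real \<Theta>) = G" by (simp add: F_def e_def)
  ultimately show ?thesis unfolding complex_interpolation_def by force
qed

section \<open>The lacunary series on the domain, and the conclusion\<close>

lemma restrict_lacunary_distribution:
  fixes \<phi>0 :: "real^'n::finite \<Rightarrow> real"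
  assumes rg: "resolution_generator \<phi>0" and \<delta>: "\<delta> < real CARD('n)"
  shows "restrict_distribution \<Omega> (\<lambda>w. c * lacunary \<phi>0 \<delta> x0 w) \<in> distributions \<Omega>"
proof -
  let ?T = "\<lambda>w. c * lacunary \<phi>0 \<delta> x0 w"
  note sub = test_functions_subset_schwartz[of \<Omega>]
  obtain C where C: "\<And>w b. w \<in> schwartz \<Longrightarrow> (\<And>x. cmod (w x) \<le> b) \<Longrightarrow> cmod (lacunary \<phi>0 \<delta> x0 w) \<le> C * b"
    by (rule lacunary_bound[OF rg \<delta>, of x0]) blast
  have T: "linear_functional_on schwartz ?T"
    by (rule linear_functional_cmult[OF lacunary_linear[OF rg \<delta>]])
  have "linear_functional_on (test_functions \<Omega>) (restrict_distribution \<Omega> ?T)"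
    unfolding linear_functional_on_def
  proof (intro ballI allI)
    fix f g a b assume f: "f \<in> test_functions \<Omega>" and g: "g \<in> test_functions \<Omega>"
    have fS: "f \<in> schwartz" and gS: "g \<in> schwartz" using f g sub by auto
    obtain K where K: "compact K" "K \<subseteq> \<Omega>" "\<And>x. x \<notin> K \<Longrightarrow> f x = 0" using f unfolding test_functions_def by blast
    obtain L where L: "compact L" "L \<subseteq> \<Omega>" "\<And>x. x \<notin> L \<Longrightarrow> g x = 0" using g unfolding test_functions_def by blast
    have "(\<lambda>x. a * f x + b * g x) \<in> schwartz" by (intro schwartz_add schwartz_cmult fS gS)
    then have "(\<lambda>x. a * f x + b * g x) \<in> test_functions \<Omega>"
    proof -
      have "a * f x + b * g x = 0" if "x \<notin> K \<union> L" for x using K(3) L(3) that by simp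
      moreover have "compact (K \<union> L)" "K \<union> L \<subseteq> \<Omega>" using K L by auto
      ultimately show ?thesis
        using \<open>(\<lambda>x. a * f x + b * g x) \<in> schwartz\<close> unfolding test_functions_def schwartz_def by blast
    qed
    then show "restrict_distribution \<Omega> ?T (\<lambda>x. a * f x + b * g x) = a * restrict_distribution \<Omega> ?T f + b * restrict_distribution \<Omega> ?T g"
      using f g fS gS T unfolding restrict_distribution_def linear_functional_on_def by simp
  qed
  moreover have "cmod (restrict_distribution \<Omega> ?T w) \<le> (cmod c * C) * seminorm 0 0 w" if w: "w \<in> test_functions \<Omega>" for w
  proof -
    have wS: "w \<in> schwartz" using w sub by auto
    have "cmod c * cmod (lacunary \<phi>0 \<delta> x0 w) \<le> cmod c * (C * seminorm 0 0 w)"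
      by (intro mult_left_mono C wS schwartz_le_seminorm) auto
    then show ?thesis using w by (simp add: restrict_distribution_def norm_mult mult.assoc)
  qed
  ultimately show ?thesis unfolding distributions_def by (auto simp: restrict_distribution_def)
qed

text \<open>The series on the whole space is one of the extensions over which the restriction norm
  takes its infimum.\<close>

lemma LTM_norm_on_restrict_lacunary:
  fixes \<phi>0 :: "real^'n::finite \<Rightarrow> real"
  assumes rg: "resolution_generator \<phi>0" and \<delta>: "\<delta> < real CARD('n)"
    and "1 \<le> p" "p < u" and "1 \<le> q" and "s + \<delta> = real CARD('n) / u"
  obtains B where "\<And>c. LTM_norm_on \<Omega> \<phi>0 s u p q (\<lambda>w. c * restrict_distribution \<Omega> (lacunary \<phi>0 \<delta> x0) w) \<le> ennreal (cmod c * B)"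
proof -
  obtain B where B: "\<And>c. LTM_norm \<phi>0 s u p q (\<lambda>w. c * lacunary \<phi>0 \<delta> x0 w) \<le> ennreal (cmod c * B)"
    using lacunary_LTM_norm[OF assms, of x0] by blast
  have "LTM_norm_on \<Omega> \<phi>0 s u p q (\<lambda>w. c * restrict_distribution \<Omega> (lacunary \<phi>0 \<delta> x0) w) \<le> ennreal (cmod c * B)" for c
  proof -
    let ?T = "\<lambda>w. c * lacunary \<phi>0 \<delta> x0 w"
    have eq: "(\<lambda>w. c * restrict_distribution \<Omega> (lacunary \<phi>0 \<delta> x0) w) = restrict_distribution \<Omega> ?T"
      by (auto simp: restrict_distribution_def)
    have "?T \<in> finite_part (LTM_norm \<phi>0 s u p q)"
      using le_less_trans[OF B ennreal_less_top] by (simp add: finite_part_def)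
    then have "LTM_norm_on \<Omega> \<phi>0 s u p q (restrict_distribution \<Omega> ?T) \<le> LTM_norm \<phi>0 s u p q ?T"
      unfolding LTM_norm_on_def restriction_norm_def
      using restrict_lacunary_distribution[OF rg \<delta>, of \<Omega> c x0] by (auto intro!: INF_lower)
    then show ?thesis unfolding eq using B by (rule order_trans)
  qed
  then show thesis by (rule that)
qed

theorem proposition1p5:
  fixes \<Omega> :: "(real^'n::finite) set"
    and \<phi>0 :: "real^'n \<Rightarrow> real"
    and p0 p1 p u0 u1 u s0 s1 s \<Theta> :: real
    and q0 q1 q :: ennreal
  assumes "open \<Omega>" "connected \<Omega>" "\<Omega> \<noteq> {}"
    and "resolution_generator \<phi>0"
    and "1 \<le> p0" "p0 < p1" "p0 < u0" "p1 < u1"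
    and "1 \<le> q0" "1 \<le> q1"
    and "p0 * u1 = p1 * u0"
    and "0 < s0" "s0 < real CARD('n) / u0"
    and "s1 = s0 - real CARD('n) * (1 / u0 - 1 / u1)" "0 < s1"
    and "0 < \<Theta>" "\<Theta> < 1"
    and "1 / p = (1 - \<Theta>) / p0 + \<Theta> / p1"
    and "1 / u = (1 - \<Theta>) / u0 + \<Theta> / u1"
    and "1 / q = ennreal (1 - \<Theta>) / q0 + ennreal \<Theta> / q1"
    and "s = (1 - \<Theta>) * s0 + \<Theta> * s1"
  shows "\<not> complex_interpolation (LTM_norm_on \<Omega> \<phi>0 s0 u0 p0 q0) (LTM_norm_on \<Omega> \<phi>0 s1 u1 p1 q1) \<Theta>
           \<subseteq> diamond \<Omega> (LTM_norm_on \<Omega> \<phi>0 s u p q)"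
proof
  assume sub: "complex_interpolation (LTM_norm_on \<Omega> \<phi>0 s0 u0 p0 q0) (LTM_norm_on \<Omega> \<phi>0 s1 u1 p1 q1) \<Theta>
           \<subseteq> diamond \<Omega> (LTM_norm_on \<Omega> \<phi>0 s u p q)"
  note rg = assms(4)
  let ?d = "real CARD('n)"
  define \<delta> where "\<delta> = ?d / u0 - s0"
  have pos: "0 < p0" "0 < p1" "0 < u0" "0 < u1" using assms(5-8) by linarith+
  have \<delta>0: "0 < \<delta>" using assms(13) by (simp add: \<delta>_def)
  \<comment> \<open>With \<open>u0 > p0 >= 1\<close> and \<open>s0 > 0\<close> this puts
    \<open>\<delta>\<close> below the dimension, as the convergence of the series demands.\<close>
  have "?d / u0 \<le> ?d" using assms(5,7) by (simp add: divide_le_eq_1 divide_le_eq)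
  then have \<delta>d: "\<delta> < ?d" using assms(12) by (simp add: \<delta>_def)
  have s0: "s0 + \<delta> = ?d / u0" by (simp add: \<delta>_def)
  have s1: "s1 + \<delta> = ?d / u1" using assms(14) by (simp add: \<delta>_def algebra_simps)
  have s: "s + \<delta> = ?d / u"
  proof -
    have "s + \<delta> = (1 - \<Theta>) * (s0 + \<delta>) + \<Theta> * (s1 + \<delta>)" using assms(21) by (simp add: algebra_simps)
    also have "\<dots> = ?d * (1 / u)" unfolding s0 s1 assms(19) by (simp add: algebra_simps)
    finally show ?thesis by simp
  qed
  have "1 / u > 0" unfolding assms(19) using pos assms(16,17) by (intro add_pos_pos divide_pos_pos) auto
  then have u: "0 < u" by simp
  have "1 / p > 0" unfolding assms(18) using pos assms(16,17) by (intro add_pos_pos divide_pos_pos) auto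
  then have p0: "0 < p" by simp
  have "1 / p \<le> (1 - \<Theta>) + \<Theta>" unfolding assms(18)
    using pos assms(5,6,16,17) by (intro add_mono) (simp_all add: divide_le_eq)
  then have p: "1 \<le> p" using p0 by simp
  \<comment> \<open>In \<open>ennreal\<close> the value of \<open>1 / 0\<close> is infinite, whereas
    the right-hand side of the relation for \<open>q\<close> is finite since \<open>q0\<close> and
    \<open>q1\<close> are at least 1.\<close>
  have q: "0 < q"
  proof (rule ccontr)
    assume "\<not> 0 < q"
    then have "1 / q = \<infinity>" by (simp add: ennreal_divide_zero)
    moreover have "q0 \<noteq> 0" "q1 \<noteq> 0" using assms(9,10) by auto
    ultimately show False using assms(20) by (simp add: ennreal_divide_eq_top_iff)
  qed
  obtain x0 where x0: "x0 \<in> \<Omega>" using assms(3) by blast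
  let ?G = "restrict_distribution \<Omega> (lacunary \<phi>0 \<delta> x0)"
  obtain B0 where B0: "\<And>c. LTM_norm_on \<Omega> \<phi>0 s0 u0 p0 q0 (\<lambda>w. c * ?G w) \<le> ennreal (cmod c * B0)"
    using LTM_norm_on_restrict_lacunary[OF rg \<delta>d assms(5,7,9) s0] by blast
  obtain B1 where B1: "\<And>c. LTM_norm_on \<Omega> \<phi>0 s1 u1 p1 q1 (\<lambda>w. c * ?G w) \<le> ennreal (cmod c * B1)"
    using LTM_norm_on_restrict_lacunary[OF rg \<delta>d _ assms(8,10) s1] assms(5,6) by (metis less_imp_le order_trans)
  have "?G \<in> diamond \<Omega> (LTM_norm_on \<Omega> \<phi>0 s u p q)"
    using sub interpolation_of_intersection[where G = ?G
      and ?N0.0 = "LTM_norm_on \<Omega> \<phi>0 s0 u0 p0 q0" and ?N1.0 = "LTM_norm_on \<Omega> \<phi>0 s1 u1 p1 q1", OF B0 B1] by blast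
  then have approx: "\<exists>f. smooth_on \<Omega> f \<and> LTM_norm_on \<Omega> \<phi>0 s u p q (\<lambda>w. ?G w - regular_distribution \<Omega> f w) < \<epsilon>"
    if "\<epsilon> > 0" for \<epsilon>
    using that unfolding diamond_def by blast
  show False
  proof (rule lacunary_not_approximable[OF rg u p q \<delta>0 \<delta>d s assms(1) x0])
    fix \<epsilon> assume \<epsilon>: "\<epsilon> > 0" "\<And>h f. h \<in> tempered_distributions \<Longrightarrow> smooth_on \<Omega> f \<Longrightarrow>
      (\<And>w. w \<in> test_functions \<Omega> \<Longrightarrow> h w = lacunary \<phi>0 \<delta> x0 w - regular_distribution \<Omega> f w) \<Longrightarrow>
      \<not> LTM_norm \<phi>0 s u p q h \<le> ennreal \<epsilon>"
    obtain f where f: "smooth_on \<Omega> f" "LTM_norm_on \<Omega> \<phi>0 s u p q (\<lambda>w. ?G w - regular_distribution \<Omega> f w) < ennreal \<epsilon>"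
      using approx[of "ennreal \<epsilon>"] \<epsilon>(1) by auto
    then obtain h where h: "h \<in> finite_part (LTM_norm \<phi>0 s u p q)"
      "restrict_distribution \<Omega> h = (\<lambda>w. ?G w - regular_distribution \<Omega> f w)" "LTM_norm \<phi>0 s u p q h < ennreal \<epsilon>"
      unfolding LTM_norm_on_def restriction_norm_def by (auto simp: INF_less_iff split: if_splits)
    have "h \<in> tempered_distributions" using h(1) by (auto simp: finite_part_def LTM_norm_def split: if_splits)
    moreover have "h w = lacunary \<phi>0 \<delta> x0 w - regular_distribution \<Omega> f w" if "w \<in> test_functions \<Omega>" for w
      using fun_cong[OF h(2), of w] that by (simp add: restrict_distribution_def)
    ultimately show False using \<epsilon>(2)[of h f] f(1) h(3) by (simp add: less_imp_le)
  qed
qed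

end
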